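(* Let $g$ be a special Bernstein function with rate function $r=r[g]$ such that $t\,r(t)\to\infty$ as $t\to\infty$. Let $-A$ be the generator of a bounded $C_0$-semigroup $(T(s))_{s\ge0}$ on a Banach space $X$ such that $0$ is an accumulation point of $\sigma(A)$. Then for every decreasing function $\epsilon:(0,\infty)\to(0,\infty)$ with $\lim_{t\to\infty}\epsilon(t)=0$ there exists $y\in\operatorname{ran}(g(A))$ such that \[\sup_{t\ge1}\frac{\|\mathcal C_t(A)y\|}{\epsilon(t)\,r(t)}=\infty.\]
   Context: A Bernstein function $g\sim(a,b,\mu)$ is $g(z)=a+bz+\int_{(0,\infty)}(1-e^{-sz})\mu(\mathrm ds)$ with $a,b\ge0$, $\mu$ positive Radon on $(0,\infty)$, $\int\frac{s}{1+s}\mu(\mathrm ds)<\infty$; it is special if $g\ne0$ and $z/g(z)$ is again a Bernstein function. Rate function $r[g](t):=\frac a2+\frac bt+\int_{(0,\infty)}\min(s/t,1)\mu(\mathrm ds)$. $g(A)$ is defined by the extended Hille–Phillips calculus (for Laplace transforms $\hat\nu$ of bounded complex measures $\nu$ on $[0,\infty)$, $\hat\nu(A)x=\int T(s)x\,\nu(\mathrm ds)$; for holomorphic $h$ on $\{\operatorname{Re}z>0\}$, $h(A):=e(A)^{-1}(eh)(A)$ with domain $\{x:(eh)(A)x\in\operatorname{ran}e(A)\}$ whenever $e,eh$ are such Laplace transforms and $e(A)$ is injective). Cesàro means: $\mathcal C_t(A)x=\frac1t\int_0^tT(s)x\,\mathrm ds$. *)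

theory Defs
  imports "HOL-Analysis.Analysis"
begin

text \<open>HOL has no class of complex vector spaces; a complex Banach space is a real
Banach space 'a together with a complex scalar multiplication sc extending the
real one and compatible with the norm.\<close>

definition complex_scaling :: "(complex \<Rightarrow> 'a::banach \<Rightarrow> 'a) \<Rightarrow> bool" where
  "complex_scaling sc \<longleftrightarrow>
     (\<forall>r x. sc (complex_of_real r) x = r *\<^sub>R x) \<and>
     (\<forall>a b x. sc (a * b) x = sc a (sc b x)) \<and>
     (\<forall>a b x. sc (a + b) x = sc a x + sc b x) \<and>
     (\<forall>a x y. sc a (x + y) = sc a x + sc a y) \<and>
     (\<forall>a x. norm (sc a x) = cmod a * norm x)"

definition c0_semigroup :: "(complex \<Rightarrow> 'a::banach \<Rightarrow> 'a) \<Rightarrow> (real \<Rightarrow> 'a \<Rightarrow> 'a) \<Rightarrow> bool" where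
  "c0_semigroup sc T \<longleftrightarrow>
     T 0 = id \<and>
     (\<forall>s t. 0 \<le> s \<longrightarrow> 0 \<le> t \<longrightarrow> T (s + t) = T s \<circ> T t) \<and>
     (\<forall>s\<ge>0. bounded_linear (T s) \<and> (\<forall>c x. T s (sc c x) = sc c (T s x))) \<and>
     (\<forall>x. continuous_on {0..} (\<lambda>s. T s x))"

definition bounded_semigroup :: "(real \<Rightarrow> 'a::real_normed_vector \<Rightarrow> 'a) \<Rightarrow> bool" where
  "bounded_semigroup T \<longleftrightarrow> (\<exists>M. \<forall>s\<ge>0. \<forall>x. norm (T s x) \<le> M * norm x)"

definition is_neg_generator ::
    "(real \<Rightarrow> 'a::real_normed_vector \<Rightarrow> 'a) \<Rightarrow> 'a set \<Rightarrow> ('a \<Rightarrow> 'a) \<Rightarrow> bool" where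
  "is_neg_generator T D A \<longleftrightarrow>
     D = {x. \<exists>y. ((\<lambda>h. (1 / h) *\<^sub>R (T h x - x)) \<longlongrightarrow> y) (at_right 0)} \<and>
     (\<forall>x\<in>D. ((\<lambda>h. (1 / h) *\<^sub>R (T h x - x)) \<longlongrightarrow> - A x) (at_right 0))"

definition in_resolvent ::
    "(complex \<Rightarrow> 'a::real_normed_vector \<Rightarrow> 'a) \<Rightarrow> 'a set \<Rightarrow> ('a \<Rightarrow> 'a) \<Rightarrow> complex \<Rightarrow> bool" where
  "in_resolvent sc D A lam \<longleftrightarrow>
     (\<exists>R. bounded_linear R \<and>
          (\<forall>y. R y \<in> D \<and> sc lam (R y) - A (R y) = y) \<and>
          (\<forall>x\<in>D. R (sc lam x - A x) = x))"

definition op_spectrum ::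
    "(complex \<Rightarrow> 'a::real_normed_vector \<Rightarrow> 'a) \<Rightarrow> 'a set \<Rightarrow> ('a \<Rightarrow> 'a) \<Rightarrow> complex set" where
  "op_spectrum sc D A = {lam. \<not> in_resolvent sc D A lam}"

definition bernstein_triple :: "real \<Rightarrow> real \<Rightarrow> real measure \<Rightarrow> bool" where
  "bernstein_triple a b \<mu> \<longleftrightarrow>
     0 \<le> a \<and> 0 \<le> b \<and> sets \<mu> = sets borel \<and> emeasure \<mu> {..0} = 0 \<and>
     (\<integral>\<^sup>+ s. ennreal (s / (1 + s)) \<partial>\<mu>) < \<infinity>"

definition bern_fun :: "real \<Rightarrow> real \<Rightarrow> real measure \<Rightarrow> complex \<Rightarrow> complex" where
  "bern_fun a b \<mu> z =
     complex_of_real a + complex_of_real b * z + (\<integral>s. (1 - exp (- (complex_of_real s * z))) \<partial>\<mu>)"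

definition special_bernstein :: "real \<Rightarrow> real \<Rightarrow> real measure \<Rightarrow> bool" where
  "special_bernstein a b \<mu> \<longleftrightarrow>
     bernstein_triple a b \<mu> \<and>
     (\<exists>z>0. bern_fun a b \<mu> (complex_of_real z) \<noteq> 0) \<and>
     (\<exists>a' b' \<mu>'. bernstein_triple a' b' \<mu>' \<and>
        (\<forall>z>0. complex_of_real z / bern_fun a b \<mu> (complex_of_real z)
                 = bern_fun a' b' \<mu>' (complex_of_real z)))"

definition rate_fun :: "real \<Rightarrow> real \<Rightarrow> real measure \<Rightarrow> real \<Rightarrow> real" where
  "rate_fun a b \<mu> t = a / 2 + b / t + (\<integral>s. min (s / t) 1 \<partial>\<mu>)"

text \<open>A bounded complex measure on [0,\<infinity>) is represented as h d\<rho>, with \<rho> a finite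
Borel measure on the reals vanishing on (-\<infinity>,0) and h \<rho>-integrable (polar
decomposition shows every bounded complex measure has this form).\<close>

definition bcm :: "real measure \<Rightarrow> (real \<Rightarrow> complex) \<Rightarrow> bool" where
  "bcm \<rho> h \<longleftrightarrow> sets \<rho> = sets borel \<and> finite_measure \<rho> \<and> emeasure \<rho> {..<0} = 0 \<and>
                integrable \<rho> h"

definition laplace_bcm :: "real measure \<Rightarrow> (real \<Rightarrow> complex) \<Rightarrow> complex \<Rightarrow> complex" where
  "laplace_bcm \<rho> h z = (\<integral>s. h s * exp (- (complex_of_real s * z)) \<partial>\<rho>)"

text \<open>The vector integral \<integral> T(s)x \<nu>(ds). Isabelle's Bochner integral requires a
second countable codomain, so the integral is characterised weakly (the integrand
is continuous, hence separably valued, so this agrees with the Bochner integral).\<close>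

definition hp_integral ::
    "(complex \<Rightarrow> 'a::banach \<Rightarrow> 'a) \<Rightarrow> (real \<Rightarrow> 'a \<Rightarrow> 'a) \<Rightarrow> real measure \<Rightarrow> (real \<Rightarrow> complex)
       \<Rightarrow> 'a \<Rightarrow> 'a \<Rightarrow> bool" where
  "hp_integral sc T \<rho> h x v \<longleftrightarrow>
     (\<forall>\<phi>::'a \<Rightarrow> real. bounded_linear \<phi> \<longrightarrow>
        integrable \<rho> (\<lambda>s. if 0 \<le> s then \<phi> (sc (h s) (T s x)) else 0) \<and>
        \<phi> v = (\<integral>s. (if 0 \<le> s then \<phi> (sc (h s) (T s x)) else 0) \<partial>\<rho>))"

definition hp_op ::
    "(complex \<Rightarrow> 'a::banach \<Rightarrow> 'a) \<Rightarrow> (real \<Rightarrow> 'a \<Rightarrow> 'a) \<Rightarrow> real measure \<Rightarrow> (real \<Rightarrow> complex)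
       \<Rightarrow> 'a \<Rightarrow> 'a" where
  "hp_op sc T \<rho> h x = (THE v. hp_integral sc T \<rho> h x v)"

definition regulariser ::
    "(complex \<Rightarrow> 'a::banach \<Rightarrow> 'a) \<Rightarrow> (real \<Rightarrow> 'a \<Rightarrow> 'a) \<Rightarrow> (complex \<Rightarrow> complex)
       \<Rightarrow> real measure \<times> (real \<Rightarrow> complex) \<times> real measure \<times> (real \<Rightarrow> complex) \<Rightarrow> bool" where
  "regulariser sc T f R \<longleftrightarrow>
     (case R of (\<rho>1, h1, \<rho>2, h2) \<Rightarrow>
        bcm \<rho>1 h1 \<and> bcm \<rho>2 h2 \<and>
        (\<forall>z. 0 < Re z \<longrightarrow> laplace_bcm \<rho>1 h1 z * f z = laplace_bcm \<rho>2 h2 z) \<and>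
        inj (hp_op sc T \<rho>1 h1))"

text \<open>Range of f(A) := e(A)^{-1} (e f)(A) (for a chosen regulariser e):
 y \<in> ran f(A) iff y = f(A) x for some x in the domain, i.e. e(A) y = (e f)(A) x.\<close>
definition fc_range ::
    "(complex \<Rightarrow> 'a::banach \<Rightarrow> 'a) \<Rightarrow> (real \<Rightarrow> 'a \<Rightarrow> 'a) \<Rightarrow> (complex \<Rightarrow> complex) \<Rightarrow> 'a set" where
  "fc_range sc T f =
     {y. (\<exists>R. regulariser sc T f R) \<and>
         (case (SOME R. regulariser sc T f R) of (\<rho>1, h1, \<rho>2, h2) \<Rightarrow>
            \<exists>x. hp_op sc T \<rho>1 h1 y = hp_op sc T \<rho>2 h2 x)}"

definition cesaro :: "(real \<Rightarrow> 'a::banach \<Rightarrow> 'a) \<Rightarrow> real \<Rightarrow> 'a \<Rightarrow> 'a" where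
  "cesaro T t x = (1 / t) *\<^sub>R integral {0..t} (\<lambda>s. T s x)"

end

theory Submission
  imports Defs
begin

text \<open>If the claim failed, the uniform boundedness principle would give
  norm (C_t(A) (gc)(A)) \<le> K \<epsilon>(t) r(t) for t \<ge> 1, where c(z) = (1 - e^-z)/z: the operator (gc)(A) is
  bounded with range inside ran g(A). By spectral inclusion, |c(t\<lambda>) c(\<lambda>) g(\<lambda>)| is then at most twice
  that bound for boundary points \<lambda> of the spectrum. Such \<lambda> exist arbitrarily close to 0, since
  circles around 0 meet the resolvent set in the left half-plane. For special g the factorisation
  g(z) h(z) = z gives |g(\<lambda>)| \<ge> r(1/|\<lambda>|)/8, so t = 1/(4|\<lambda>|) forces \<epsilon>(t) to stay away from 0.

  Complex measures on [0,\<infinity>) are handled as functionals on bounded continuous functions; products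
  become convolutions, and every identity between them is checked on exponentials. Hahn-Banach
  reduces vector integrals to scalar ones.\<close>

section \<open>Functional analysis in Banach spaces\<close>

text \<open>g(A) is unbounded, so the uniform boundedness principle is not applied to it directly.
  The factor c makes gc the transform of a bounded measure: convolved with c, a translation by s
  changes f by at most 2 min(s,1) sup|f|, which \<mu> can integrate. But c vanishes at 2 pi i k for
  nonzero integers k, so c(A) may fail to be injective; the calculus therefore gets another
  regulariser, e(z) = 1/((1+z)(2+z)), a product of resolvents. Since the range is defined through an
  arbitrarily chosen regulariser, membership in it has to be proved for whichever one is chosen.
  Boundary points of the spectrum may lie on the imaginary axis, so transforms are evaluated on the
  closed half-plane. There |g(z)| can be far below g(|z|); specialness excludes this near 0, because
  an upper bound for the conjugate h is a lower bound for g = z/h. Functionals must respect bounded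
  pointwise limits: boundedness alone would admit functionals living at infinity, which all e^(-zs)
  with z > 0 fail to see.\<close>

lemma hahn_banach_norming:
  fixes v :: "'a::real_normed_vector"
  obtains \<phi> :: "'a \<Rightarrow> real"
  where "bounded_linear \<phi>" "\<phi> v = norm v" "\<And>x. \<bar>\<phi> x\<bar> \<le> norm x"
proof -
  \<comment> \<open>Graphs of partial functionals dominated by the norm. Single-valuedness comes for
    free: a pair (0, r) in such a subspace forces r = 0, see \<open>uniq\<close>.\<close>
  define \<A> :: "('a \<times> real) set set" where
    "\<A> = {G. subspace G \<and> (v, norm v) \<in> G \<and> (\<forall>p\<in>G. snd p \<le> norm (fst p))}"
  have "t * norm v \<le> \<bar>t\<bar> * norm v" for t :: real by (simp add: mult_right_mono)
  then have "span {(v, norm v)} \<in> \<A>"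
    unfolding \<A>_def by (auto simp: span_base) (auto simp: span_singleton)
  then have ne: "\<A> \<noteq> {}" by auto
  obtain M where M: "M \<in> \<A>" and max: "\<And>X. X \<in> \<A> \<Longrightarrow> M \<subseteq> X \<Longrightarrow> X = M"
  proof -
    have "\<exists>M\<in>\<A>. \<forall>X\<in>\<A>. M \<subseteq> X \<longrightarrow> X = M"
    proof (rule subset_Zorn_nonempty[OF ne])
      fix \<C> assume "\<C> \<noteq> {}" and ch: "subset.chain \<A> \<C>"
      then have sub: "\<C> \<subseteq> \<A>" and tot: "\<And>X Y. X \<in> \<C> \<Longrightarrow> Y \<in> \<C> \<Longrightarrow> X \<subseteq> Y \<or> Y \<subseteq> X"
        by (auto simp: subset.chain_def)
      have "subspace (\<Union>\<C>)"
        unfolding subspace_def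
      proof (intro conjI ballI allI)
        obtain X where "X \<in> \<C>" using \<open>\<C> \<noteq> {}\<close> by blast
        then show "0 \<in> \<Union>\<C>" using sub by (auto simp: \<A>_def dest: subspace_0)
      next
        fix x y assume "x \<in> \<Union>\<C>" "y \<in> \<Union>\<C>"
        then obtain X Y where "X \<in> \<C>" "Y \<in> \<C>" "x \<in> X" "y \<in> Y" by blast
        moreover obtain Z where "Z \<in> \<C>" "x \<in> Z" "y \<in> Z"
          using tot[OF \<open>X \<in> \<C>\<close> \<open>Y \<in> \<C>\<close>] calculation by blast
        ultimately show "x + y \<in> \<Union>\<C>" using sub by (auto simp: \<A>_def intro: subspace_add)
      next
        fix c :: real and x assume "x \<in> \<Union>\<C>"
        then show "c *\<^sub>R x \<in> \<Union>\<C>" using sub by (auto simp: \<A>_def intro: subspace_scale)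
      qed
      then show "\<Union>\<C> \<in> \<A>" using \<open>\<C> \<noteq> {}\<close> sub by (fastforce simp: \<A>_def)
    qed
    then show ?thesis using that by blast
  qed
  have sM: "subspace M" and vM: "(v, norm v) \<in> M" and bM: "\<And>x r. (x, r) \<in> M \<Longrightarrow> r \<le> norm x"
    using M by (auto simp: \<A>_def)
  have addM: "(x + y, r + s) \<in> M" if "(x, r) \<in> M" "(y, s) \<in> M" for x y r s
    using subspace_add[OF sM that] by simp
  have scM: "(c *\<^sub>R x, c * r) \<in> M" if "(x, r) \<in> M" for c x r
    using subspace_scale[OF sM that, of c] by simp
  have uniq: "r = s" if "(x, r) \<in> M" "(x, s) \<in> M" for x r s
  proof -
    have "(0, r - s) \<in> M" "(0, s - r) \<in> M"
      using subspace_diff[OF sM that] subspace_diff[OF sM that(2,1)] by simp_all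
    then show ?thesis using bM[of 0 "r - s"] bM[of 0 "s - r"] by simp
  qed
  have total: "\<exists>r. (z, r) \<in> M" for z
  proof (rule ccontr)
    assume nz: "\<nexists>r. (z, r) \<in> M"
    \<comment> \<open>Every lower bound for an admissible value at z lies below every upper bound; c
      is the supremum of the lower ones.\<close>
    have key: "r - norm (x - z) \<le> norm (y + z) - s" if "(x, r) \<in> M" "(y, s) \<in> M" for x y r s
    proof -
      have "r + s \<le> norm (x + y)" using addM[OF that] bM by blast
      also have "\<dots> \<le> norm (x - z) + norm (y + z)"
        using norm_triangle_ineq[of "x - z" "y + z"] by simp
      finally show ?thesis by simp
    qed
    define c where "c = (SUP p\<in>M. snd p - norm (fst p - z))"
    have M0: "(0, 0) \<in> M" using subspace_0[OF sM] by (simp add: zero_prod_def)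
    have bdd: "bdd_above ((\<lambda>p. snd p - norm (fst p - z)) ` M)"
      by (rule bdd_aboveI2[where M="norm z"]) (use key[OF _ M0] in auto)
    have c1: "r - norm (x - z) \<le> c" if "(x, r) \<in> M" for x r
      unfolding c_def using cSUP_upper[OF that bdd] by simp
    have c2: "c \<le> norm (y + z) - s" if "(y, s) \<in> M" for y s
      unfolding c_def using M0 key[OF _ that] by (intro cSUP_least) auto
    \<comment> \<open>Rescaling by 1/|t| reduces this to t = 1 and t = -1, which are
      \<open>c2\<close> and \<open>c1\<close>.\<close>
    have main: "r + t * c \<le> norm (x + t *\<^sub>R z)" if xr: "(x, r) \<in> M" for x r t
    proof (cases t "0::real" rule: linorder_cases)
      case equal then show ?thesis using bM[OF xr] by simp
    next
      case greater
      have "c \<le> norm ((1/t) *\<^sub>R x + z) - (1/t) * r" by (rule c2[OF scM[OF xr]])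
      then have "t * c \<le> t * norm ((1/t) *\<^sub>R x + z) - r"
        using greater by (simp add: field_simps)
      also have "t * norm ((1/t) *\<^sub>R x + z) = norm (t *\<^sub>R ((1/t) *\<^sub>R x + z))" using greater by simp
      also have "t *\<^sub>R ((1/t) *\<^sub>R x + z) = x + t *\<^sub>R z" using greater by (simp add: algebra_simps)
      finally show ?thesis by simp
    next
      case less
      have "(1/(-t)) * r - norm ((1/(-t)) *\<^sub>R x - z) \<le> c" by (rule c1[OF scM[OF xr]])
      then have "r - (-t) * norm ((1/(-t)) *\<^sub>R x - z) \<le> (-t) * c"
        using less by (simp add: field_simps)
      also have "(-t) * norm ((1/(-t)) *\<^sub>R x - z) = norm ((-t) *\<^sub>R ((1/(-t)) *\<^sub>R x - z))"
        using less by (simp add: norm_scaleR)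
      also have "(-t) *\<^sub>R ((1/(-t)) *\<^sub>R x - z) = x + t *\<^sub>R z" using less by (simp add: algebra_simps)
      finally show ?thesis by simp
    qed
    define N where "N = {p + q |p q. p \<in> M \<and> q \<in> span {(z, c)}}"
    have "subspace N" unfolding N_def by (rule subspace_sums[OF sM subspace_span])
    moreover have MN: "M \<subseteq> N" unfolding N_def using span_zero by (metis (mono_tags, lifting) add.right_neutral mem_Collect_eq subsetI)
    moreover have "\<forall>p\<in>N. snd p \<le> norm (fst p)"
      unfolding N_def span_singleton using main by auto
    ultimately have "N \<in> \<A>" using vM by (auto simp: \<A>_def)
    with max MN have "N = M" by blast
    moreover have "(z, c) \<in> N"
      unfolding N_def using subspace_0[OF sM] span_base[of "(z,c)" "{(z,c)}"]
      by (metis (mono_tags, lifting) add.left_neutral insertI1 mem_Collect_eq)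
    ultimately show False using nz by auto
  qed
  define \<phi> where "\<phi> x = (THE r. (x, r) \<in> M)" for x
  have eqI: "\<phi> x = r" if "(x, r) \<in> M" for x r
    unfolding \<phi>_def using that uniq by blast
  have mem: "(x, \<phi> x) \<in> M" for x using total eqI by metis
  have le: "\<bar>\<phi> x\<bar> \<le> norm x" for x
    using bM[OF mem, of x] bM[OF scM[OF mem, of "-1" x]] by simp
  have "bounded_linear \<phi>"
    by (rule bounded_linear_intro[where K=1])
       (use eqI[OF addM[OF mem mem]] eqI[OF scM[OF mem]] le in auto)
  then show ?thesis using that le eqI[OF vM] by blast
qed

lemma functionals_separate:
  fixes v w :: "'a::real_normed_vector"
  assumes "\<And>\<phi>::'a \<Rightarrow> real. bounded_linear \<phi> \<Longrightarrow> \<phi> v = \<phi> w"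
  shows "v = w"
proof -
  obtain \<phi> where "bounded_linear \<phi>" and "\<phi> (v - w) = norm (v - w)"
    by (rule hahn_banach_norming[of "v - w"]) blast
  then have "norm (v - w) = \<phi> v - \<phi> w" by (metis bounded_linear.linear linear_diff)
  also have "\<dots> = 0" using assms[OF \<open>bounded_linear \<phi>\<close>] by simp
  finally show ?thesis by simp
qed

text \<open>Gliding hump: each step moves the current point by at most 3^-n, towards an operator
so large that the later steps cannot undo its growth.\<close>
theorem uniform_boundedness:
  fixes B :: "'i \<Rightarrow> 'a::banach \<Rightarrow> 'b::real_normed_vector"
  assumes lin: "\<And>i. i \<in> I \<Longrightarrow> bounded_linear (B i)"
    and ptw: "\<And>x. \<exists>K. \<forall>i\<in>I. norm (B i x) \<le> K"
  shows "\<exists>K. \<forall>i\<in>I. \<forall>x. norm (B i x) \<le> K * norm x"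
proof (rule ccontr)
  assume neg: "\<nexists>K. \<forall>i\<in>I. \<forall>x. norm (B i x) \<le> K * norm x"
  have big: "\<exists>i\<in>I. onorm (B i) > K" for K
  proof (rule ccontr)
    assume "\<not> (\<exists>i\<in>I. onorm (B i) > K)"
    then have le: "onorm (B i) \<le> K" if "i \<in> I" for i using that by force
    have "norm (B i x) \<le> K * norm x" if "i \<in> I" for i x
      using onorm[OF lin[OF that], of x] mult_right_mono[OF le[OF that] norm_ge_zero[of x]] by linarith
    with neg show False by blast
  qed
  have step: "\<exists>y. dist x y \<le> r \<and> norm (B i y) \<ge> 2/3 * r * onorm (B i)"
    if "i \<in> I" and "r > 0" and "onorm (B i) > 0" for i x r
  proof -
    interpret L: bounded_linear "B i" by (rule lin[OF that(1)])
    have "\<exists>h. norm (B i h) > 5/6 * onorm (B i) * norm h"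
    proof (rule ccontr)
      assume "\<nexists>h. norm (B i h) > 5/6 * onorm (B i) * norm h"
      then have "onorm (B i) \<le> 5/6 * onorm (B i)"
        by (intro onorm_bound) (use that in \<open>auto simp: not_less\<close>)
      then show False using that by simp
    qed
    then obtain h where h: "norm (B i h) > 5/6 * onorm (B i) * norm h" by blast
    then have h0: "h \<noteq> 0" by (auto simp: L.zero)
    define k where "k = (r / norm h) *\<^sub>R h"
    have nk: "norm k = r" using h0 that by (simp add: k_def)
    have "norm (B i k) = (r / norm h) * norm (B i h)"
      using that by (simp add: k_def L.scaleR)
    also have "\<dots> \<ge> (r / norm h) * (5/6 * onorm (B i) * norm h)"
      using h that by (intro mult_left_mono) auto
    finally have Bk: "norm (B i k) \<ge> 5/6 * r * onorm (B i)" using h0 by (simp add: field_simps)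
    \<comment> \<open>Twice B k is B (x + k) - B (x - k), so one of these two points at distance r
      from x has an image at least as long as that of k.\<close>
    have "2 * norm (B i k) \<le> norm (B i (x + k)) + norm (B i (x - k))"
      using norm_triangle_ineq4[of "B i (x + k)" "B i (x - k)"]
      by (simp add: L.add L.diff flip: scaleR_2)
    then have "norm (B i (x + k)) \<ge> norm (B i k) \<or> norm (B i (x - k)) \<ge> norm (B i k)" by linarith
    moreover have "2/3 * r * onorm (B i) \<le> 5/6 * r * onorm (B i)" using that by simp
    ultimately show ?thesis
      using Bk nk by (elim disjE) (rule exI[of _ "x + k"], simp add: dist_norm, rule exI[of _ "x - k"], simp add: dist_norm)
  qed
  \<comment> \<open>Operator norms above 4^n against steps of size 3^-n leave a factor (4/3)^n,
    which diverges.\<close>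
  have "\<forall>n::nat. \<exists>i. i \<in> I \<and> onorm (B i) > 4 ^ n" using big by blast
  then obtain \<iota> where \<iota>: "\<And>n::nat. \<iota> n \<in> I" "\<And>n. onorm (B (\<iota> n)) > 4 ^ n"
    by metis
  then have pos: "onorm (B (\<iota> n)) > 0" for n by (metis less_trans zero_less_numeral zero_less_power)
  define nxt where "nxt n x = (SOME y. dist x y \<le> (1/3)^n \<and>
      norm (B (\<iota> n) y) \<ge> 2/3 * (1/3)^n * onorm (B (\<iota> n)))" for n x
  have nxt: "dist x (nxt n x) \<le> (1/3)^n \<and> norm (B (\<iota> n) (nxt n x)) \<ge> 2/3 * (1/3)^n * onorm (B (\<iota> n))" for n x
    unfolding nxt_def by (rule someI_ex) (use step[OF \<iota>(1) _ pos] in simp)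
  define X where "X = rec_nat 0 nxt"
  have XS: "X (Suc n) = nxt n (X n)" for n by (simp add: X_def)
  have d: "dist (X n) (X (Suc n)) \<le> (1/3)^n" for n using nxt by (simp add: XS)
  have dd: "dist (X n) (X (n + k)) \<le> 3/2 * (1/3)^n - 3/2 * (1/3)^(n+k)" for n k
  proof (induction k)
    case (Suc k)
    have "dist (X n) (X (n + Suc k)) \<le> dist (X n) (X (n+k)) + dist (X (n+k)) (X (Suc (n+k)))"
      using dist_triangle by simp
    then show ?case using Suc d[of "n+k"] by simp
  qed simp
  have dd': "dist (X n) (X m) \<le> 3/2 * (1/3)^n" if "n \<le> m" for n m
  proof -
    have "dist (X n) (X m) \<le> 3/2 * (1/3)^n - 3/2 * (1/3)^m" using dd[of n "m-n"] that by simp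
    moreover have "(0::real) \<le> (1/3)^m" by simp
    ultimately show ?thesis by linarith
  qed
  have lim0: "(\<lambda>n. 3/2 * (1/3::real)^n) \<longlonglongrightarrow> 0"
    using tendsto_mult[OF tendsto_const LIMSEQ_power_zero[of "1/3::real"], of "3/2"] by simp
  have "Cauchy X"
  proof (rule metric_CauchyI)
    fix e :: real assume "0 < e"
    then obtain N where "3/2 * (1/3::real)^N < e / 2"
      using order_tendstoD(2)[OF lim0, of "e/2"] by (auto simp: eventually_sequentially)
    moreover have "dist (X m) (X n) \<le> dist (X N) (X m) + dist (X N) (X n)" for m n
      by (metis dist_commute dist_triangle)
    ultimately have "dist (X m) (X n) < e" if "N \<le> m" "N \<le> n" for m n
      using dd'[of N m] dd'[of N n] that by (smt (verit) field_sum_of_halves)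
    then show "\<exists>M. \<forall>m\<ge>M. \<forall>n\<ge>M. dist (X m) (X n) < e" by blast
  qed
  then obtain x where x: "X \<longlonglongrightarrow> x" using Cauchy_convergent convergent_def by blast
  have dx: "dist (X n) x \<le> 3/2 * (1/3)^n" for n
    by (rule Lim_bounded[OF tendsto_dist[OF tendsto_const x], of n]) (use dd' in auto)
  obtain K where K: "\<And>i. i \<in> I \<Longrightarrow> norm (B i x) \<le> K" using ptw by blast
  \<comment> \<open>1/6 = 2/3 - 1/2: step n gains 2/3 * 3^-n times the operator norm, and all later
    steps together move the point by at most 3/2 * 3^-(n+1) = 1/2 * 3^-n.\<close>
  have "(1/6) * (4/3)^n \<le> K" for n
  proof -
    interpret L: bounded_linear "B (\<iota> n)" by (rule lin[OF \<iota>(1)])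
    let ?o = "onorm (B (\<iota> n))"
    have "norm (B (\<iota> n) (X (Suc n) - x)) \<le> ?o * dist (X (Suc n)) x"
      using onorm[OF lin[OF \<iota>(1)]] by (simp add: dist_norm)
    also have "\<dots> \<le> ?o * (1/2 * (1/3)^n)"
      using dx[of "Suc n"] pos[of n] by (intro mult_left_mono) auto
    finally have "norm (B (\<iota> n) x) \<ge> 2/3 * (1/3)^n * ?o - 1/2 * (1/3)^n * ?o"
      using nxt[of "X n" n] norm_triangle_ineq2[of "B (\<iota> n) (X (Suc n))" "B (\<iota> n) x"]
      by (simp add: XS L.diff algebra_simps)
    then have "norm (B (\<iota> n) x) \<ge> 1/6 * (1/3)^n * ?o" by (simp add: mult.commute)
    moreover have "1/6 * (1/3)^n * ?o \<ge> 1/6 * (1/3)^n * 4^n"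
      using \<iota>(2)[of n] by (intro mult_left_mono) auto
    moreover have "1/6 * (1/3)^n * 4^n = (1/6) * (4/3::real)^n"
      by (simp add: power_divide)
    ultimately show ?thesis using K[OF \<iota>(1), of n] by linarith
  qed
  moreover obtain n where "6 * K < (4/3::real)^n" using real_arch_pow[of "4/3" "6 * K"] by auto
  moreover from this have "K < (1/6) * (4/3)^n" by simp
  ultimately show False using leD by blast
qed

section \<open>Measures on the half-line as functionals\<close>

text \<open>Test functions are total on the reals, but only their restriction to the half-line is
  constrained; values at negative arguments are arbitrary and invisible to the functionals below
  (\<open>cong\<close>).\<close>

definition BC :: "(real \<Rightarrow> complex) set" where
  "BC = {f. continuous_on {0..} f \<and> (\<exists>B. \<forall>s\<ge>0. cmod (f s) \<le> B)}"

lemma BCI: "continuous_on {0..} f \<Longrightarrow> (\<And>s. 0 \<le> s \<Longrightarrow> cmod (f s) \<le> B) \<Longrightarrow> f \<in> BC"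
  by (auto simp: BC_def)

lemma BC_continuous: "f \<in> BC \<Longrightarrow> continuous_on {0..} f"
  by (simp add: BC_def)

lemma BC_bound:
  assumes "f \<in> BC" obtains B where "0 \<le> B" "\<And>s. 0 \<le> s \<Longrightarrow> cmod (f s) \<le> B"
proof -
  obtain B where B: "\<forall>s\<ge>0. cmod (f s) \<le> B" using assms by (auto simp: BC_def)
  then have "0 \<le> B" using norm_ge_zero[of "f 0"] by (metis order_refl order_trans)
  with B that show ?thesis by blast
qed

lemma BC_const [simp]: "(\<lambda>s. c) \<in> BC"
  by (rule BCI[where B="cmod c"]) auto

lemma BC_add [intro]:
  assumes "f \<in> BC" "g \<in> BC" shows "(\<lambda>s. f s + g s) \<in> BC"
proof -
  obtain B where B: "\<And>s. 0 \<le> s \<Longrightarrow> cmod (f s) \<le> B" by (rule BC_bound[OF assms(1)]) blast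
  obtain C where C: "\<And>s. 0 \<le> s \<Longrightarrow> cmod (g s) \<le> C" by (rule BC_bound[OF assms(2)]) blast
  have "cmod (f s + g s) \<le> B + C" if "0 \<le> s" for s
    using norm_triangle_mono[OF B[OF that] C[OF that]] .
  then show ?thesis using assms by (intro BCI continuous_on_add) (auto simp: BC_continuous)
qed

lemma BC_cmult [intro]:
  assumes "f \<in> BC" shows "(\<lambda>s. c * f s) \<in> BC"
proof -
  obtain B where "\<And>s. 0 \<le> s \<Longrightarrow> cmod (f s) \<le> B" by (rule BC_bound[OF assms]) blast
  then have "cmod (c * f s) \<le> cmod c * B" if "0 \<le> s" for s
    using that by (simp add: norm_mult mult_left_mono)
  then show ?thesis using assms by (intro BCI continuous_on_mult) (auto simp: BC_continuous)
qed

lemma BC_diff [intro]: "f \<in> BC \<Longrightarrow> g \<in> BC \<Longrightarrow> (\<lambda>s. f s - g s) \<in> BC"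
  using BC_add[OF _ BC_cmult[of g "-1"]] by simp

lemma BC_sum [intro]: "(\<And>i. i \<in> I \<Longrightarrow> f i \<in> BC) \<Longrightarrow> (\<lambda>s. \<Sum>i\<in>I. f i s) \<in> BC"
  by (induction I rule: infinite_finite_induct) auto

lemma BC_of_real:
  assumes "continuous_on {0..} f" "\<And>s. 0 \<le> s \<Longrightarrow> \<bar>f s\<bar> \<le> B"
  shows "(\<lambda>s. complex_of_real (f s)) \<in> BC"
  using assms by (intro BCI[where B=B] continuous_on_of_real) auto

lemma BC_Re: "f \<in> BC \<Longrightarrow> (\<lambda>s. complex_of_real (Re (f s))) \<in> BC"
  and BC_Im: "f \<in> BC \<Longrightarrow> (\<lambda>s. complex_of_real (Im (f s))) \<in> BC"
proof -
  assume f: "f \<in> BC"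
  then obtain B where B: "\<And>s. 0 \<le> s \<Longrightarrow> cmod (f s) \<le> B" by (rule BC_bound) blast
  have "\<bar>Re (f s)\<bar> \<le> B" "\<bar>Im (f s)\<bar> \<le> B" if "0 \<le> s" for s
    using B[OF that] abs_Re_le_cmod[of "f s"] abs_Im_le_cmod[of "f s"] by simp_all
  then show "(\<lambda>s. complex_of_real (Re (f s))) \<in> BC" "(\<lambda>s. complex_of_real (Im (f s))) \<in> BC"
    using BC_continuous[OF f] by (auto intro!: BC_of_real[where B=B] continuous_intros)
qed

lemma BC_shift:
  assumes "f \<in> BC" "0 \<le> t" shows "(\<lambda>s. f (t + s)) \<in> BC"
proof -
  obtain B where "\<And>s. 0 \<le> s \<Longrightarrow> cmod (f s) \<le> B" by (rule BC_bound[OF assms(1)]) blast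
  moreover have "continuous_on {0..} (\<lambda>s. f (t + s))"
    by (rule continuous_on_compose2[OF BC_continuous[OF assms(1)]]) (use assms in \<open>auto intro!: continuous_intros\<close>)
  ultimately show ?thesis using assms(2) by (intro BCI[where B=B]) auto
qed

definition cexp :: "complex \<Rightarrow> real \<Rightarrow> complex" where
  "cexp z s = exp (- (of_real s * z))"

lemma norm_cexp: "cmod (cexp z s) = exp (- (s * Re z))"
  by (simp add: cexp_def)

lemma norm_cexp_le_1: "0 \<le> Re z \<Longrightarrow> 0 \<le> s \<Longrightarrow> cmod (cexp z s) \<le> 1"
  by (simp add: norm_cexp)

lemma cexp_add: "cexp z (s + t) = cexp z s * cexp z t"
  by (simp add: cexp_def ring_distribs exp_diff exp_minus field_simps)

lemma cexp_0 [simp]: "cexp z 0 = 1"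
  by (simp add: cexp_def)

lemma continuous_on_cexp [continuous_intros]: "continuous_on S (cexp z)"
  unfolding cexp_def by (intro continuous_intros)

lemma cexp_BC [simp]: "0 \<le> Re z \<Longrightarrow> cexp z \<in> BC"
  by (rule BCI[where B=1]) (auto simp: norm_cexp_le_1 continuous_on_cexp)

text \<open>By the Riesz representation theorem these are exactly the functionals f -> \<integral> f d\<nu> for
bounded complex measures \<nu> on [0,\<infinity>).\<close>
locale measure_functional =
  fixes L :: "(real \<Rightarrow> complex) \<Rightarrow> complex"
  assumes add: "f \<in> BC \<Longrightarrow> g \<in> BC \<Longrightarrow> L (\<lambda>s. f s + g s) = L f + L g"
    and cmult: "f \<in> BC \<Longrightarrow> L (\<lambda>s. c * f s) = c * L f"
    and bounded: "\<exists>C\<ge>0. \<forall>f\<in>BC. \<forall>B. (\<forall>s\<ge>0. cmod (f s) \<le> B) \<longrightarrow> cmod (L f) \<le> C * B"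
    and lim: "(\<And>n. F n \<in> BC) \<Longrightarrow> f \<in> BC \<Longrightarrow> (\<And>n s. 0 \<le> s \<Longrightarrow> cmod (F n s) \<le> B) \<Longrightarrow>
      (\<And>s. 0 \<le> s \<Longrightarrow> (\<lambda>n. F n s) \<longlonglongrightarrow> f s) \<Longrightarrow> (\<lambda>n. L (F n)) \<longlonglongrightarrow> L f"
begin

lemma diff: "f \<in> BC \<Longrightarrow> g \<in> BC \<Longrightarrow> L (\<lambda>s. f s - g s) = L f - L g"
  using add[OF _ BC_cmult[of g "-1"]] cmult[of g "-1"] by simp

lemma zero: "L (\<lambda>s. 0) = 0"
  using cmult[of "\<lambda>s. 0" 0] by simp

lemma sum: "finite I \<Longrightarrow> (\<And>i. i \<in> I \<Longrightarrow> f i \<in> BC) \<Longrightarrow> L (\<lambda>s. \<Sum>i\<in>I. f i s) = (\<Sum>i\<in>I. L (f i))"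
  by (induction I rule: finite_induct) (auto simp: zero add BC_sum)

text \<open>The norm estimate with bound 0 applies to f - g.\<close>

lemma cong:
  assumes "f \<in> BC" "g \<in> BC" "\<And>s. 0 \<le> s \<Longrightarrow> f s = g s" shows "L f = L g"
proof -
  obtain C where "\<And>f B. f \<in> BC \<Longrightarrow> (\<forall>s\<ge>0. cmod (f s) \<le> B) \<Longrightarrow> cmod (L f) \<le> C * B"
    using bounded by blast
  from this[of "\<lambda>s. f s - g s" 0] have "cmod (L (\<lambda>s. f s - g s)) \<le> 0"
    using assms by auto
  then show ?thesis using diff[OF assms(1,2)] by simp
qed

text \<open>Makes the iterated functional in \<open>conv\<close> meaningful. Continuity in t is an
  instance of \<open>lim\<close>, as f (t + s) converges boundedly and pointwise in s.\<close>

lemma shift_BC: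
  assumes f: "f \<in> BC" shows "(\<lambda>t. L (\<lambda>s. f (t + s))) \<in> BC"
proof -
  obtain C where C: "\<And>f B. f \<in> BC \<Longrightarrow> (\<forall>s\<ge>0. cmod (f s) \<le> B) \<Longrightarrow> cmod (L f) \<le> C * B"
    using bounded by blast
  obtain B where B: "\<And>s. 0 \<le> s \<Longrightarrow> cmod (f s) \<le> B" by (rule BC_bound[OF f]) blast
  show ?thesis
  proof (rule BCI)
    show "continuous_on {0..} (\<lambda>t. L (\<lambda>s. f (t + s)))"
      unfolding continuous_on_sequentially comp_def
    proof (intro allI ballI impI, elim conjE)
      fix x :: "nat \<Rightarrow> real" and a assume a: "a \<in> {0..}" and x: "\<forall>n. x n \<in> {0..}" "x \<longlonglongrightarrow> a"
      show "(\<lambda>n. L (\<lambda>s. f (x n + s))) \<longlonglongrightarrow> L (\<lambda>s. f (a + s))"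
      proof (rule lim[where B=B])
        fix s :: real assume "0 \<le> s"
        then show "(\<lambda>n. f (x n + s)) \<longlonglongrightarrow> f (a + s)"
          using a x by (intro continuous_on_tendsto_compose[OF BC_continuous[OF f]] tendsto_intros) auto
      qed (use x a B BC_shift[OF f] in auto)
    qed
    show "cmod (L (\<lambda>s. f (t + s))) \<le> C * B" if "0 \<le> t" for t
      using that B by (intro C BC_shift[OF f]) auto
  qed
qed

lemma cexp_shift:
  assumes "0 \<le> Re z" shows "L (\<lambda>s. cexp z (t + s)) = cexp z t * L (cexp z)"
  using cmult[of "cexp z" "cexp z t"] assms by (simp add: cexp_add)

text \<open>With x = e^-s, powers x^k are exponentials at z = k, and x^k (1-x)^(j+1) = x^k (1-x)^j -
  x^(k+1) (1-x)^j gives the induction on j.\<close>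

lemma sum_Bernstein_eq_0:
  assumes "\<And>z. 0 < z \<Longrightarrow> L (cexp (of_real z)) = 0"
  shows "L (\<lambda>s. of_real (exp (-s) ^ k * (1 - exp (-s)) ^ j)) = 0"
proof (induction j arbitrary: k)
  case 0
  show ?case
  proof (cases "k = 0")
    case False
    have "(\<lambda>s. of_real (exp (-s) ^ k * (1 - exp (-s)) ^ 0)) = cexp (of_real (real k))"
      by (rule ext) (simp add: cexp_def exp_of_nat_mult[symmetric] exp_of_real[symmetric] mult.commute)
    then show ?thesis using assms[of "real k"] False by simp
  next
    \<comment> \<open>The constant 1 is the exponential at z = 0, outside the hypothesis; it is
      reached as the limit of z = 1/(n+1).\<close>
    case True
    have "(\<lambda>n. L (cexp (of_real (1 / real (Suc n))))) \<longlonglongrightarrow> L (\<lambda>s. 1)"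
    proof (rule lim[where B=1])
      fix s :: real
      have "(\<lambda>n. cexp (of_real (1 / real (Suc n))) s) \<longlonglongrightarrow> exp (- (of_real s * of_real 0))"
        unfolding cexp_def by (intro tendsto_intros LIMSEQ_Suc[OF lim_1_over_n, unfolded of_real_0])
      then show "(\<lambda>n. cexp (of_real (1 / real (Suc n))) s) \<longlonglongrightarrow> 1" by simp
    qed (auto intro!: norm_cexp_le_1)
    moreover have "(\<lambda>n. L (cexp (of_real (1 / real (Suc n))))) = (\<lambda>n. 0)"
      by (rule ext, rule assms) simp
    ultimately have "L (\<lambda>s. 1) = 0" using LIMSEQ_unique tendsto_const by metis
    then show ?thesis using True by simp
  qed
next
  case (Suc j)
  have B: "(\<lambda>s. of_real (exp (-s) ^ k * (1 - exp (-s)) ^ j)) \<in> BC" for k j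
    by (rule BC_of_real[where B=1])
      (auto intro!: continuous_intros mult_le_one power_le_one simp: abs_mult power_abs)
  have "L (\<lambda>s. of_real (exp (-s) ^ k * (1 - exp (-s)) ^ Suc j))
     = L (\<lambda>s. of_real (exp (-s) ^ k * (1 - exp (-s)) ^ j) - of_real (exp (-s) ^ Suc k * (1 - exp (-s)) ^ j))"
    by (rule arg_cong[where f=L]) (auto simp: algebra_simps)
  also have "\<dots> = 0" unfolding diff[OF B B] Suc.IH by simp
  finally show ?case .
qed

text \<open>Uniqueness of Laplace transforms: f (min s N) is a continuous function of
x = e^-s in [0,1], hence a uniform limit of Bernstein polynomials in e^-s.\<close>
lemma laplace_unique:
  assumes "\<And>z. 0 < z \<Longrightarrow> L (cexp (of_real z)) = 0" and f: "f \<in> BC"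
  shows "L f = 0"
proof -
  have clamped: "L (\<lambda>s. of_real (g (min s (real N)))) = 0"
    if g: "continuous_on {0..} g" and gB: "\<And>s. 0 \<le> s \<Longrightarrow> \<bar>g s\<bar> \<le> B" for g :: "real \<Rightarrow> real" and N B
  proof -
    \<comment> \<open>The cut-off at N keeps the logarithm away from 0, so G is continuous up to x =
      0 although s = -ln x runs to infinity there.\<close>
    define G where "G x = g (- ln (max x (exp (- real N))))" for x
    have G: "G (exp (-s)) = g (min s (real N))" for s
      by (auto simp: G_def max_def min_def)
    have contG: "continuous_on {0..1} G" unfolding G_def
    proof (rule continuous_on_compose2[OF g])
      show "continuous_on {0..1} (\<lambda>x. - ln (max x (exp (- real N))))"
        by (intro continuous_intros) (auto simp: max_def)
      have "ln (max x (exp (- real N))) \<le> 0" if "x \<le> 1" for x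
        using that ln_le_zero_iff[of "max x (exp (- real N))"] by (simp add: less_max_iff_disj)
      then show "(\<lambda>x. - ln (max x (exp (- real N)))) ` {0..1} \<subseteq> {0..}" by auto
    qed
    define p where "p n x = (\<Sum>k\<le>n. G (real k / real n) * Bernstein n k x)" for n x
    have pL: "L (\<lambda>s. of_real (p n (exp (-s)))) = 0" for n
    proof -
      have "(\<lambda>s. complex_of_real (p n (exp (-s)))) = (\<lambda>s. \<Sum>k\<le>n. of_real (G (real k / real n) * of_nat (n choose k)) *
          of_real (exp (-s) ^ k * (1 - exp (-s)) ^ (n - k)))"
        by (simp add: p_def Bernstein_def mult.assoc)
      moreover have B: "(\<lambda>s. complex_of_real (exp (-s) ^ k * (1 - exp (-s)) ^ j)) \<in> BC" for k j
        by (rule BC_of_real[where B=1])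
          (auto intro!: continuous_intros mult_le_one power_le_one simp: abs_mult power_abs)
      ultimately show ?thesis
        using sum_Bernstein_eq_0[OF assms(1)] by (simp add: sum cmult BC_cmult)
    qed
    define F where "F n = (SOME m. \<forall>x\<in>{0..1}. \<bar>G x - p m x\<bar> < 1 / real (Suc n))" for n
    have F: "\<bar>G x - p (F n) x\<bar> < 1 / real (Suc n)" if "0 \<le> x" "x \<le> 1" for n x
    proof -
      have "\<exists>m. \<forall>x\<in>{0..1}. \<bar>G x - p m x\<bar> < 1 / real (Suc n)"
        using Bernstein_Weierstrass[OF contG, of "1 / real (Suc n)"] unfolding p_def
        by (meson order_refl of_nat_0_less_iff zero_less_Suc zero_less_divide_1_iff)
      then have "\<forall>x\<in>{0..1}. \<bar>G x - p (F n) x\<bar> < 1 / real (Suc n)"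
        unfolding F_def by (rule someI_ex)
      then show ?thesis using that by auto
    qed
    have pc: "continuous_on {0..} (\<lambda>s. p n (exp (- s)))" for n
      unfolding p_def Bernstein_def by (intro continuous_intros)
    have pB: "\<bar>p (F n) (exp (-s))\<bar> \<le> B + 1" if "0 \<le> s" for n s
    proof -
      have "1 / real (Suc n) \<le> 1" by simp
      moreover have "\<bar>G (exp (-s))\<bar> \<le> B" using that by (auto simp: G intro!: gB)
      ultimately show ?thesis using F[OF exp_ge_zero, of "-s" n] that unfolding exp_le_one_iff by linarith
    qed
    have "(\<lambda>n. L (\<lambda>s. of_real (p (F n) (exp (-s))))) \<longlonglongrightarrow> L (\<lambda>s. of_real (g (min s (real N))))"
    proof (rule lim[where B="B+1"])
      show "(\<lambda>s. complex_of_real (p (F n) (exp (- s)))) \<in> BC" for n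
        using pc pB by (intro BC_of_real) auto
      show "(\<lambda>s. complex_of_real (g (min s (real N)))) \<in> BC"
        by (rule BC_of_real[where B=B], rule continuous_on_compose2[OF g]) (auto intro!: continuous_intros gB)
      show "cmod (complex_of_real (p (F n) (exp (- s)))) \<le> B + 1" if "0 \<le> s" for n s
        using pB[OF that] by simp
      show "(\<lambda>n. complex_of_real (p (F n) (exp (- s)))) \<longlonglongrightarrow> complex_of_real (g (min s (real N)))" if "0 \<le> s" for s
      proof (rule tendsto_of_real, rule LIM_zero_cancel, rule Lim_null_comparison)
        show "\<forall>\<^sub>F n in sequentially. norm (p (F n) (exp (- s)) - g (min s (real N))) \<le> 1 / real (Suc n)"
          using F[of "exp (-s)"] that by (auto simp: G abs_minus_commute intro!: always_eventually less_imp_le)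
        show "(\<lambda>n. 1 / real (Suc n)) \<longlonglongrightarrow> 0" by (rule LIMSEQ_Suc[OF lim_1_over_n])
      qed
    qed
    then show ?thesis by (simp add: pL LIMSEQ_const_iff)
  qed
  have realcase: "L (\<lambda>s. of_real (g s)) = 0"
    if g: "continuous_on {0..} g" and gB: "\<And>s. 0 \<le> s \<Longrightarrow> \<bar>g s\<bar> \<le> B" for g :: "real \<Rightarrow> real" and B
  proof -
    \<comment> \<open>The cut-off is removed by bounded pointwise convergence; g has no limit at
      infinity in general, so no uniform approximation could do this.\<close>
    have "(\<lambda>N. L (\<lambda>s. of_real (g (min s (real N))))) \<longlonglongrightarrow> L (\<lambda>s. of_real (g s))"
    proof (rule lim[where B=B])
      show "(\<lambda>s. complex_of_real (g (min s (real N)))) \<in> BC" for N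
        by (rule BC_of_real[where B=B], rule continuous_on_compose2[OF g]) (auto intro!: continuous_intros gB)
      show "(\<lambda>s. complex_of_real (g s)) \<in> BC" by (rule BC_of_real[OF g gB])
      show "(\<lambda>N. complex_of_real (g (min s (real N)))) \<longlonglongrightarrow> complex_of_real (g s)" for s
      proof (rule tendsto_eventually, rule eventually_mono[OF eventually_ge_at_top[of "nat \<lceil>s\<rceil>"]])
        show "complex_of_real (g (min s (real N))) = complex_of_real (g s)" if "nat \<lceil>s\<rceil> \<le> N" for N
          using that by (simp add: min_def)
      qed
    qed (auto intro!: gB)
    then show ?thesis by (simp add: clamped[OF g gB] LIMSEQ_const_iff)
  qed
  obtain B where B: "\<And>s. 0 \<le> s \<Longrightarrow> cmod (f s) \<le> B" by (rule BC_bound[OF f]) blast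
  have "\<bar>Re (f s)\<bar> \<le> B" "\<bar>Im (f s)\<bar> \<le> B" if "0 \<le> s" for s
    using B[OF that] abs_Re_le_cmod[of "f s"] abs_Im_le_cmod[of "f s"] by simp_all
  then have "L (\<lambda>s. of_real (Re (f s))) = 0" "L (\<lambda>s. of_real (Im (f s))) = 0"
    using BC_continuous[OF f] by (auto intro!: realcase[where B=B] continuous_intros)
  moreover have "f = (\<lambda>s. of_real (Re (f s)) + \<i> * of_real (Im (f s)))"
    by (rule ext) (rule complex_eq)
  ultimately show ?thesis
    using add[OF BC_Re[OF f] BC_cmult[OF BC_Im[OF f], of \<i>]] cmult[OF BC_Im[OF f], of \<i>] by simp
qed

end

section \<open>Operations on measure functionals, convolution, and comparison by Laplace
  transforms\<close>

lemma measure_functional_point: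
  "0 \<le> t \<Longrightarrow> measure_functional (\<lambda>f. f t)"
  by unfold_locales (auto intro: exI[of _ 1])

lemma measure_functional_cmult:
  assumes "measure_functional L" shows "measure_functional (\<lambda>f. c * L f)"
proof -
  interpret measure_functional L by fact
  obtain C where C: "C \<ge> 0" "\<And>f B. f \<in> BC \<Longrightarrow> (\<forall>s\<ge>0. cmod (f s) \<le> B) \<Longrightarrow> cmod (L f) \<le> C * B"
    using bounded by blast
  show ?thesis
  proof
    show "\<exists>C\<ge>0. \<forall>f\<in>BC. \<forall>B. (\<forall>s\<ge>0. cmod (f s) \<le> B) \<longrightarrow> cmod (c * L f) \<le> C * B"
      using C by (intro exI[of _ "cmod c * C"]) (auto simp: norm_mult mult.assoc intro!: mult_left_mono)
  next
    fix F f B assume "\<And>n::nat. F n \<in> BC" "f \<in> BC"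
      "\<And>n s. 0 \<le> s \<Longrightarrow> cmod (F n s) \<le> B" "\<And>s. 0 \<le> s \<Longrightarrow> (\<lambda>n. F n s) \<longlonglongrightarrow> f s"
    then show "(\<lambda>n. c * L (F n)) \<longlonglongrightarrow> c * L f"
      by (intro tendsto_mult tendsto_const) (rule lim)
  qed (simp_all add: add cmult algebra_simps)
qed

lemma measure_functional_add:
  assumes "measure_functional L" "measure_functional L'"
  shows "measure_functional (\<lambda>f. L f + L' f)"
proof -
  interpret measure_functional L by fact
  interpret L': measure_functional L' by fact
  obtain C where C: "C \<ge> 0" "\<And>f B. f \<in> BC \<Longrightarrow> (\<forall>s\<ge>0. cmod (f s) \<le> B) \<Longrightarrow> cmod (L f) \<le> C * B"
    using bounded by blast
  obtain C' where C': "C' \<ge> 0" "\<And>f B. f \<in> BC \<Longrightarrow> (\<forall>s\<ge>0. cmod (f s) \<le> B) \<Longrightarrow> cmod (L' f) \<le> C' * B"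
    using L'.bounded by blast
  show ?thesis
  proof
    show "\<exists>C\<ge>0. \<forall>f\<in>BC. \<forall>B. (\<forall>s\<ge>0. cmod (f s) \<le> B) \<longrightarrow> cmod (L f + L' f) \<le> C * B"
      using C C' by (intro exI[of _ "C + C'"]) (auto simp: ring_distribs intro!: norm_triangle_mono)
  next
    fix F f B assume *: "\<And>n::nat. F n \<in> BC" "f \<in> BC"
      "\<And>n s. 0 \<le> s \<Longrightarrow> cmod (F n s) \<le> B" "\<And>s. 0 \<le> s \<Longrightarrow> (\<lambda>n. F n s) \<longlonglongrightarrow> f s"
    show "(\<lambda>n. L (F n) + L' (F n)) \<longlonglongrightarrow> L f + L' f"
      by (rule tendsto_add[OF lim[OF *] L'.lim[OF *]])
  qed (simp_all add: add cmult L'.add L'.cmult algebra_simps)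
qed

lemma measure_functional_diff:
  assumes "measure_functional L" "measure_functional L'"
  shows "measure_functional (\<lambda>f. L f - L' f)"
  using measure_functional_add[OF assms(1) measure_functional_cmult[OF assms(2), of "-1"]] by simp

text \<open>Integration against the convolution of two measures, written as an iterated integral.
  Its symmetry is obtained from the uniqueness of transforms, not from Fubini.\<close>

definition conv :: "((real \<Rightarrow> complex) \<Rightarrow> complex) \<Rightarrow> ((real \<Rightarrow> complex) \<Rightarrow> complex) \<Rightarrow> (real \<Rightarrow> complex) \<Rightarrow> complex" where
  "conv L L' f = L (\<lambda>t. L' (\<lambda>s. f (t + s)))"

lemma measure_functional_conv:
  assumes "measure_functional L" "measure_functional L'"
  shows "measure_functional (conv L L')"
proof -
  interpret measure_functional L by fact
  interpret L': measure_functional L' by fact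
  obtain C where C: "C \<ge> 0" "\<And>f B. f \<in> BC \<Longrightarrow> (\<forall>s\<ge>0. cmod (f s) \<le> B) \<Longrightarrow> cmod (L f) \<le> C * B"
    using bounded by blast
  obtain C' where C': "C' \<ge> 0" "\<And>f B. f \<in> BC \<Longrightarrow> (\<forall>s\<ge>0. cmod (f s) \<le> B) \<Longrightarrow> cmod (L' f) \<le> C' * B"
    using L'.bounded by blast
  have bd: "cmod (L' (\<lambda>s. f (t + s))) \<le> C' * B"
    if "f \<in> BC" "\<And>s. 0 \<le> s \<Longrightarrow> cmod (f s) \<le> B" "0 \<le> t" for f B t
    using that by (intro C' BC_shift[OF that(1)]) auto
  show ?thesis unfolding conv_def
  proof
    show "\<exists>C\<ge>0. \<forall>f\<in>BC. \<forall>B. (\<forall>s\<ge>0. cmod (f s) \<le> B) \<longrightarrow>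
        cmod (L (\<lambda>t. L' (\<lambda>s. f (t + s)))) \<le> C * B"
    proof (intro exI[of _ "C * C'"] conjI ballI allI impI)
      fix f B assume "f \<in> BC" "\<forall>s\<ge>0. cmod (f s) \<le> B"
      then have "cmod (L (\<lambda>t. L' (\<lambda>s. f (t + s)))) \<le> C * (C' * B)"
        using bd by (intro C(2) L'.shift_BC[of f]) auto
      then show "cmod (L (\<lambda>t. L' (\<lambda>s. f (t + s)))) \<le> C * C' * B" by (simp add: mult.assoc)
    qed (use C C' in auto)
  next
    fix f g assume fg: "f \<in> BC" "g \<in> BC"
    have "L (\<lambda>t. L' (\<lambda>s. f (t + s) + g (t + s))) = L (\<lambda>t. L' (\<lambda>s. f (t + s)) + L' (\<lambda>s. g (t + s)))"
      by (rule cong[OF L'.shift_BC[OF BC_add[OF fg]] BC_add[OF L'.shift_BC[OF fg(1)] L'.shift_BC[OF fg(2)]]])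
        (rule L'.add[OF BC_shift[OF fg(1)] BC_shift[OF fg(2)]])
    then show "L (\<lambda>t. L' (\<lambda>s. f (t + s) + g (t + s))) = L (\<lambda>t. L' (\<lambda>s. f (t + s))) + L (\<lambda>t. L' (\<lambda>s. g (t + s)))"
      unfolding add[OF L'.shift_BC[OF fg(1)] L'.shift_BC[OF fg(2)]] .
  next
    fix f c assume f: "f \<in> BC"
    have "L (\<lambda>t. L' (\<lambda>s. c * f (t + s))) = L (\<lambda>t. c * L' (\<lambda>s. f (t + s)))"
      by (rule cong[OF L'.shift_BC[OF BC_cmult[OF f]] BC_cmult[OF L'.shift_BC[OF f]]])
        (rule L'.cmult[OF BC_shift[OF f]])
    then show "L (\<lambda>t. L' (\<lambda>s. c * f (t + s))) = c * L (\<lambda>t. L' (\<lambda>s. f (t + s)))"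
      unfolding cmult[OF L'.shift_BC[OF f]] .
  next
    fix F f B assume F: "\<And>n. F n \<in> BC" and f: "f \<in> BC"
      and B: "\<And>n s. 0 \<le> s \<Longrightarrow> cmod (F n s) \<le> B" and l: "\<And>s. 0 \<le> s \<Longrightarrow> (\<lambda>n. F n s) \<longlonglongrightarrow> f s"
    show "(\<lambda>n. L (\<lambda>t. L' (\<lambda>s. F n (t + s)))) \<longlonglongrightarrow> L (\<lambda>t. L' (\<lambda>s. f (t + s)))"
    proof (rule lim[where B="C' * B"])
      show "(\<lambda>n. L' (\<lambda>s. F n (t + s))) \<longlonglongrightarrow> L' (\<lambda>s. f (t + s))" if "0 \<le> t" for t
        using that B l by (intro L'.lim[where B=B] BC_shift[OF F] BC_shift[OF f]) auto
    qed (rule L'.shift_BC[OF F] L'.shift_BC[OF f] bd[OF F B]; assumption)+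
  qed
qed

lemma conv_cexp:
  assumes "measure_functional L" "measure_functional L'" "0 \<le> Re z"
  shows "conv L L' (cexp z) = L (cexp z) * L' (cexp z)"
proof -
  interpret measure_functional L by fact
  interpret L': measure_functional L' by fact
  show ?thesis unfolding conv_def
    using L'.cexp_shift[OF assms(3)] cmult[of "cexp z" "L' (cexp z)"] assms(3) by (simp add: mult.commute)
qed

text \<open>The workhorse for all identities: a computation with exponentials at positive reals
  yields equality on all test functions, among them exponentials at complex z and the orbits of the
  semigroup.\<close>

lemma measure_functional_eqI:
  assumes "measure_functional L" "measure_functional L'"
    and "\<And>z. 0 < z \<Longrightarrow> L (cexp (of_real z)) = L' (cexp (of_real z))" and "f \<in> BC"
  shows "L f = L' f"
  using measure_functional.laplace_unique[OF measure_functional_diff[OF assms(1,2)] _ assms(4)] assms(3)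
  by simp

text \<open>Lets the gauge integral over an interval inherit the property from the Lebesgue
  integral, with which it is compared on test functions only.\<close>

lemma measure_functional_cong:
  assumes L: "measure_functional L" and eq: "\<And>f. f \<in> BC \<Longrightarrow> L' f = L f"
  shows "measure_functional L'"
proof -
  interpret measure_functional L by (rule L)
  show ?thesis
  proof
    show "\<exists>C\<ge>0. \<forall>f\<in>BC. \<forall>B. (\<forall>s\<ge>0. cmod (f s) \<le> B) \<longrightarrow> cmod (L' f) \<le> C * B"
      using bounded by (simp add: eq)
  next
    fix F f B assume *: "\<And>n::nat. F n \<in> BC" "f \<in> BC"
      "\<And>n s. 0 \<le> s \<Longrightarrow> cmod (F n s) \<le> B" "\<And>s. 0 \<le> s \<Longrightarrow> (\<lambda>n. F n s) \<longlonglongrightarrow> f s"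
    show "(\<lambda>n. L' (F n)) \<longlonglongrightarrow> L' f" using lim[OF *] by (simp add: eq *)
  qed (simp_all add: eq BC_add BC_cmult add cmult)
qed

text \<open>Precomposition with \<open>max 0\<close> extends f continuously from the half-line to
  the real line; f itself may be non-measurable on negative arguments.\<close>

lemma measurable_BC_compose:
  assumes f: "f \<in> BC" and X: "X \<in> borel_measurable M"
  shows "(\<lambda>x. f (max 0 (X x))) \<in> borel_measurable M"
proof -
  have "continuous_on UNIV (\<lambda>s. f (max 0 s))"
    by (rule continuous_on_compose2[OF BC_continuous[OF f]]) (auto intro!: continuous_intros)
  then have "(\<lambda>s. f (max 0 s)) \<in> borel_measurable borel" by (rule borel_measurable_continuous_onI)
  then show ?thesis using measurable_compose[OF X] by blast
qed

lemma integrable_mult_BC: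
  fixes k :: "'b \<Rightarrow> complex"
  assumes k: "integrable M k" and X: "X \<in> borel_measurable M" and f: "f \<in> BC"
  shows "integrable M (\<lambda>x. k x * f (max 0 (X x)))"
proof -
  obtain B where B: "\<And>s. 0 \<le> s \<Longrightarrow> cmod (f s) \<le> B" by (rule BC_bound[OF f]) blast
  have "cmod (k x * f (max 0 (X x))) \<le> norm (B * cmod (k x))" for x
  proof -
    have "cmod (f (max 0 (X x))) \<le> \<bar>B\<bar>" using B[of "max 0 (X x)"] by simp
    then show ?thesis by (simp add: norm_mult abs_mult mult.commute[of "\<bar>B\<bar>"] mult_left_mono)
  qed
  then show ?thesis
    by (rule Bochner_Integration.integrable_bound[where f="\<lambda>x. B * cmod (k x)", rotated 2, OF AE_I2])
      (use k in \<open>auto intro!: borel_measurable_times measurable_BC_compose[OF f X]\<close>)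
qed

lemma measure_functional_integral:
  fixes k :: "'b \<Rightarrow> complex"
  assumes k: "integrable M k" and X: "X \<in> borel_measurable M"
  shows "measure_functional (\<lambda>f. \<integral>x. k x * f (max 0 (X x)) \<partial>M)"
proof -
  note int = integrable_mult_BC[OF k X]
  show ?thesis
  proof
    fix f g assume "f \<in> BC" "g \<in> BC"
    then show "(\<integral>x. k x * (f (max 0 (X x)) + g (max 0 (X x))) \<partial>M) =
        (\<integral>x. k x * f (max 0 (X x)) \<partial>M) + (\<integral>x. k x * g (max 0 (X x)) \<partial>M)"
      using int by (simp add: ring_distribs)
  next
    fix f c
    show "(\<integral>x. k x * (c * f (max 0 (X x))) \<partial>M) = c * (\<integral>x. k x * f (max 0 (X x)) \<partial>M)"
      by (simp add: mult.left_commute)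
  next
    show "\<exists>C\<ge>0. \<forall>f\<in>BC. \<forall>B. (\<forall>s\<ge>0. cmod (f s) \<le> B) \<longrightarrow> cmod (\<integral>x. k x * f (max 0 (X x)) \<partial>M) \<le> C * B"
    proof (intro exI[of _ "\<integral>x. cmod (k x) \<partial>M"] conjI ballI allI impI)
      fix f B assume f: "f \<in> BC" and B: "\<forall>s\<ge>0. cmod (f s) \<le> B"
      have "cmod (\<integral>x. k x * f (max 0 (X x)) \<partial>M) \<le> (\<integral>x. cmod (k x * f (max 0 (X x))) \<partial>M)"
        by (rule integral_norm_bound)
      also have "\<dots> \<le> (\<integral>x. cmod (k x) * B \<partial>M)"
        by (rule integral_mono[OF integrable_norm[OF int[OF f]]])
          (use k B in \<open>simp_all add: norm_mult mult_left_mono\<close>)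
      finally have "cmod (\<integral>x. k x * f (max 0 (X x)) \<partial>M) \<le> (\<integral>x. cmod (k x) * B \<partial>M)" .
      then show "cmod (\<integral>x. k x * f (max 0 (X x)) \<partial>M) \<le> (\<integral>x. cmod (k x) \<partial>M) * B" by simp
    qed simp
  next
    fix F f B assume F: "\<And>n::nat. F n \<in> BC" and f: "f \<in> BC"
      and B: "\<And>n s. 0 \<le> s \<Longrightarrow> cmod (F n s) \<le> B" and l: "\<And>s. 0 \<le> s \<Longrightarrow> (\<lambda>n. F n s) \<longlonglongrightarrow> f s"
    show "(\<lambda>n. \<integral>x. k x * F n (max 0 (X x)) \<partial>M) \<longlonglongrightarrow> (\<integral>x. k x * f (max 0 (X x)) \<partial>M)"
    proof (rule integral_dominated_convergence[where w="\<lambda>x. cmod (k x) * B"])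
      show "AE x in M. (\<lambda>n. k x * F n (max 0 (X x))) \<longlonglongrightarrow> k x * f (max 0 (X x))"
        by (rule AE_I2, rule tendsto_mult[OF tendsto_const], rule l) simp
      show "AE x in M. cmod (k x * F n (max 0 (X x))) \<le> cmod (k x) * B" for n
        by (rule AE_I2) (simp add: norm_mult mult_left_mono B)
      show "integrable M (\<lambda>x. cmod (k x) * B)" using k by simp
    qed (rule borel_measurable_integrable[OF int[OF f]] borel_measurable_integrable[OF int[OF F]])+
  qed
qed

section \<open>Weak integrals in complex Banach spaces\<close>

locale complex_banach =
  fixes sc :: "complex \<Rightarrow> 'a::banach \<Rightarrow> 'a"
  assumes scaling: "complex_scaling sc"
begin

lemma sc_of_real: "sc (of_real r) x = r *\<^sub>R x"
  and sc_mult: "sc (a * b) x = sc a (sc b x)"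
  and sc_add_left: "sc (a + b) x = sc a x + sc b x"
  and sc_add_right: "sc a (x + y) = sc a x + sc a y"
  and norm_sc: "norm (sc a x) = cmod a * norm x"
  using scaling by (auto simp: complex_scaling_def)

lemma sc_1 [simp]: "sc 1 x = x"
  using sc_of_real[of 1 x] by simp

lemma sc_scaleR: "sc a (r *\<^sub>R x) = r *\<^sub>R sc a x"
  by (metis mult.commute sc_mult sc_of_real)

lemma bounded_linear_sc: "bounded_linear (sc a)"
  by (rule bounded_linear_intro[where K="cmod a"]) (auto simp: sc_add_right sc_scaleR norm_sc)

lemma sc_minus_right: "sc a (- x) = - sc a x" and sc_diff_right: "sc a (x - y) = sc a x - sc a y"
  and sc_zero_right [simp]: "sc a 0 = 0"
  using bounded_linear_sc[of a]
  by (auto simp: bounded_linear.linear linear_diff linear_neg linear_0)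

lemma sc_zero_left [simp]: "sc 0 x = 0"
  using norm_sc[of 0 x] by simp

lemma sc_minus_left: "sc (- a) x = - sc a x"
  using sc_add_left[of "-a" a x] by (simp add: eq_neg_iff_add_eq_0)

lemma sc_diff_left: "sc (a - b) x = sc a x - sc b x"
  using sc_add_left[of a "-b" x] by (simp add: sc_minus_left)

text \<open>The complex-linear functional with real part \<phi>.\<close>
definition cfun :: "('a \<Rightarrow> real) \<Rightarrow> 'a \<Rightarrow> complex" where
  "cfun \<phi> x = of_real (\<phi> x) - \<i> * of_real (\<phi> (sc \<i> x))"

lemma Re_cfun [simp]: "Re (cfun \<phi> x) = \<phi> x"
  by (simp add: cfun_def)

context
  fixes \<phi> :: "'a \<Rightarrow> real" assumes \<phi>: "bounded_linear \<phi>"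
begin

lemma cfun_add: "cfun \<phi> (x + y) = cfun \<phi> x + cfun \<phi> y"
  using \<phi> by (simp add: cfun_def sc_add_right bounded_linear.linear linear_add algebra_simps)

lemma cfun_scaleR: "cfun \<phi> (r *\<^sub>R x) = of_real r * cfun \<phi> x"
  using \<phi> by (simp add: cfun_def sc_scaleR bounded_linear.linear linear_cmul algebra_simps)

lemma cfun_sc: "cfun \<phi> (sc c x) = c * cfun \<phi> x"
proof -
  have i: "cfun \<phi> (sc \<i> x) = \<i> * cfun \<phi> x" for x
  proof -
    have "sc \<i> (sc \<i> x) = - x" using sc_of_real[of "-1" x] by (simp flip: sc_mult)
    then show ?thesis using \<phi> by (simp add: cfun_def algebra_simps bounded_linear.linear linear_neg)
  qed
  have "sc c x = Re c *\<^sub>R x + Im c *\<^sub>R sc \<i> x"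
    using sc_add_left[of "of_real (Re c)" "of_real (Im c) * \<i>" x] complex_eq[of c]
    by (simp add: sc_mult sc_of_real mult.commute[of \<i>])
  then have "cfun \<phi> (sc c x) = (of_real (Re c) + \<i> * of_real (Im c)) * cfun \<phi> x"
    by (simp add: cfun_add cfun_scaleR i algebra_simps)
  then show ?thesis by (simp flip: complex_eq)
qed

lemma cfun_diff: "cfun \<phi> (x - y) = cfun \<phi> x - cfun \<phi> y"
  using cfun_add[of x "- y"] cfun_scaleR[of "-1" y] by simp

lemma cfun_0 [simp]: "cfun \<phi> 0 = 0"
  using cfun_diff[of 0 0] by simp

lemma cfun_sum: "cfun \<phi> (\<Sum>i\<in>I. f i) = (\<Sum>i\<in>I. cfun \<phi> (f i))"
  by (induction I rule: infinite_finite_induct) (simp_all add: cfun_add)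

text \<open>Adding the bounds for the real and imaginary parts costs a factor 2 (rotating x would
  give K); it reappears in \<open>laplace_le_norm_rep\<close>.\<close>

lemma norm_cfun_le:
  assumes "\<And>x. \<bar>\<phi> x\<bar> \<le> K * norm x" shows "cmod (cfun \<phi> x) \<le> 2 * K * norm x"
proof -
  have "cmod (cfun \<phi> x) \<le> \<bar>\<phi> x\<bar> + \<bar>\<phi> (sc \<i> x)\<bar>"
    unfolding cfun_def using norm_triangle_ineq4[of "of_real (\<phi> x)" "\<i> * of_real (\<phi> (sc \<i> x))"]
    by (simp add: norm_mult)
  also have "\<dots> \<le> 2 * K * norm x"
    using assms[of x] assms[of "sc \<i> x"] by (simp add: norm_sc)
  finally show ?thesis .
qed

lemma bounded_linear_cfun: "bounded_linear (cfun \<phi>)"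
proof -
  obtain K where "\<And>x. norm (\<phi> x) \<le> norm x * K" using bounded_linear.bounded[OF \<phi>] by blast
  then have "\<bar>\<phi> x\<bar> \<le> K * norm x" for x by (simp add: mult.commute)
  note norm_cfun_le[OF this]
  then show ?thesis
    by (intro bounded_linear_intro[where K="2 * K"])
      (simp_all add: cfun_add cfun_scaleR scaleR_conv_of_real mult_ac)
qed

end

lemma cfun_separate:
  assumes "\<And>\<phi>. bounded_linear \<phi> \<Longrightarrow> cfun \<phi> x = cfun \<phi> y" shows "x = y"
proof (rule functionals_separate)
  fix \<phi> :: "'a \<Rightarrow> real" assume "bounded_linear \<phi>"
  then show "\<phi> x = \<phi> y" using assms[of \<phi>] Re_cfun by metis
qed

lemma norm_le_cfun:
  assumes "\<And>\<phi>. bounded_linear \<phi> \<Longrightarrow> (\<And>x. \<bar>\<phi> x\<bar> \<le> norm x) \<Longrightarrow> cmod (cfun \<phi> x) \<le> K"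
  shows "norm x \<le> K"
proof -
  obtain \<phi> :: "'a \<Rightarrow> real" where \<phi>: "bounded_linear \<phi>" "\<phi> x = norm x" "\<And>x. \<bar>\<phi> x\<bar> \<le> norm x"
    by (rule hahn_banach_norming[of x]) blast
  have "norm x \<le> cmod (cfun \<phi> x)" using complex_Re_le_cmod[of "cfun \<phi> x"] \<phi>(2) by simp
  also have "\<dots> \<le> K" by (rule assms[OF \<phi>(1,3)])
  finally show ?thesis .
qed

lemma cfun_BC:
  assumes \<phi>: "bounded_linear \<phi>" and F: "continuous_on {0..} F" "\<And>s. 0 \<le> s \<Longrightarrow> norm (F s) \<le> B"
  shows "(\<lambda>s. cfun \<phi> (F s)) \<in> BC"
proof -
  interpret c: bounded_linear "cfun \<phi>" by (rule bounded_linear_cfun[OF \<phi>])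
  obtain K where K: "K \<ge> 0" "\<And>x. norm (cfun \<phi> x) \<le> norm x * K" using c.nonneg_bounded by blast
  have "cmod (cfun \<phi> (F s)) \<le> B * K" if "0 \<le> s" for s
    using K(2)[of "F s"] mult_right_mono[OF F(2)[OF that] K(1)] by linarith
  then show ?thesis by (intro BCI c.continuous_on F)
qed

end

section \<open>Piecewise linear interpolation on a grid of mesh 1/(n+1)\<close>

definition clamp01 :: "real \<Rightarrow> real" where
  "clamp01 x = max 0 (min 1 x)"

text \<open>Interpolation at the nodes k/(n+1), constant after node N, in telescoped form:
  increments of F times scalar ramps. A functional applied to it becomes a finite sum with
  coefficients obtained from the ramps.\<close>

definition interp :: "nat \<Rightarrow> (real \<Rightarrow> 'a::real_normed_vector) \<Rightarrow> nat \<Rightarrow> real \<Rightarrow> 'a" where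
  "interp n F N s = F 0 + (\<Sum>k<N. clamp01 (real (Suc n) * s - real k) *\<^sub>R
      (F (real (Suc k) / real (Suc n)) - F (real k / real (Suc n))))"

text \<open>In the cell of index j the ramps before j are saturated and telescope, ramp j is
  partial, and later ramps vanish.\<close>

lemma interp_eq:
  assumes "real j \<le> real (Suc n) * s" "real (Suc n) * s < real j + 1"
  shows "interp n F N s = (if j < N then F (real j / real (Suc n)) + (real (Suc n) * s - real j) *\<^sub>R
      (F (real (Suc j) / real (Suc n)) - F (real j / real (Suc n))) else F (real N / real (Suc n)))"
proof (induction N)
  case 0 then show ?case by (simp add: interp_def)
next
  case (Suc N)
  have step: "interp n F (Suc N) s = interp n F N s + clamp01 (real (Suc n) * s - real N) *\<^sub>R
      (F (real (Suc N) / real (Suc n)) - F (real N / real (Suc n)))"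
    by (simp add: interp_def add.assoc)
  consider "N < j" | "N = j" | "j < N" by linarith
  then show ?case
  proof cases
    case 1
    then have "real N + 1 \<le> real j" by linarith
    then have "clamp01 (real (Suc n) * s - real N) = 1" using assms by (simp add: clamp01_def)
    with 1 show ?thesis unfolding step Suc.IH by simp
  next
    case 2
    then have "clamp01 (real (Suc n) * s - real N) = real (Suc n) * s - real j"
      using assms by (simp add: clamp01_def)
    with 2 show ?thesis unfolding step Suc.IH by simp
  next
    case 3
    then have "real j + 1 \<le> real N" by linarith
    then have "clamp01 (real (Suc n) * s - real N) = 0" using assms by (simp add: clamp01_def)
    with 3 show ?thesis unfolding step Suc.IH by simp
  qed
qed

text \<open>The value at s is a convex combination of F at the two neighbouring nodes, or F at the
  last node once s has passed it. Taking c = 0 gives uniform bounds, c = F s gives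
  convergence.\<close>

lemma interp_dist:
  fixes F :: "real \<Rightarrow> 'a::real_normed_vector"
  assumes "0 \<le> s" and near: "\<And>r. 0 \<le> r \<Longrightarrow> \<bar>r - s\<bar> \<le> 1 / real (Suc n) \<or> r = real N / real (Suc n) \<and> r \<le> s \<Longrightarrow> norm (F r - c) \<le> e"
  shows "norm (interp n F N s - c) \<le> e"
proof -
  define j where "j = nat \<lfloor>real (Suc n) * s\<rfloor>"
  have j: "real j \<le> real (Suc n) * s" "real (Suc n) * s < real j + 1"
    using assms(1) unfolding j_def by (simp_all add: of_nat_nat del: of_nat_Suc)
  show ?thesis
  proof (cases "j < N")
    case True
    define \<theta> where "\<theta> = real (Suc n) * s - real j"
    have \<theta>: "0 \<le> \<theta>" "\<theta> \<le> 1" using j by (auto simp: \<theta>_def)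
    have near': "norm (F (r / real (Suc n)) - c) \<le> e" if "0 \<le> r" "\<bar>r - real (Suc n) * s\<bar> \<le> 1" for r
    proof (rule near[OF _ disjI1])
      have "r / real (Suc n) - s = (r - real (Suc n) * s) / real (Suc n)"
        by (simp add: diff_divide_distrib del: of_nat_Suc)
      then show "\<bar>r / real (Suc n) - s\<bar> \<le> 1 / real (Suc n)"
        using that(2) by (simp add: divide_right_mono del: of_nat_Suc)
    qed (use that in simp)
    have 1: "norm (F (real j / real (Suc n)) - c) \<le> e" and 2: "norm (F (real (Suc j) / real (Suc n)) - c) \<le> e"
      using j near'[of "real j"] near'[of "real (Suc j)"] by simp_all
    have "interp n F N s - c = (1 - \<theta>) *\<^sub>R (F (real j / real (Suc n)) - c) + \<theta> *\<^sub>R (F (real (Suc j) / real (Suc n)) - c)"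
      unfolding interp_eq[OF j] if_P[OF True] \<theta>_def[symmetric] by (simp add: algebra_simps)
    also have "norm \<dots> \<le> (1 - \<theta>) * norm (F (real j / real (Suc n)) - c) + \<theta> * norm (F (real (Suc j) / real (Suc n)) - c)"
      using \<theta> norm_triangle_ineq[of "(1 - \<theta>) *\<^sub>R (F (real j / real (Suc n)) - c)" "\<theta> *\<^sub>R (F (real (Suc j) / real (Suc n)) - c)"] by simp
    also have "\<dots> \<le> (1 - \<theta>) * e + \<theta> * e"
      using 1 2 \<theta> by (intro add_mono mult_left_mono) auto
    finally show ?thesis by (simp add: algebra_simps)
  next
    case False
    then have "real N \<le> real (Suc n) * s" using j(1) by linarith
    then have "real N / real (Suc n) \<le> s" by (simp add: field_simps)
    then show ?thesis unfolding interp_eq[OF j] using False near[of "real N / real (Suc n)"] by simp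
  qed
qed

lemma continuous_on_interp: "continuous_on S (interp n F N)"
  unfolding interp_def clamp01_def by (intro continuous_intros)

text \<open>With (n+1)^2 cells of length 1/(n+1) the last node is n+1, so the grid refines and
  exhausts the half-line at once.\<close>

lemma interp_tendsto:
  fixes F :: "real \<Rightarrow> 'a::real_normed_vector"
  assumes F: "continuous_on {0..} F" and s: "0 \<le> s"
  shows "(\<lambda>n. interp n F (Suc n * Suc n) s) \<longlonglongrightarrow> F s"
proof (rule metric_LIMSEQ_I)
  fix e :: real assume "0 < e"
  then have "\<exists>d>0. \<forall>r\<in>{0..}. dist r s < d \<longrightarrow> dist (F r) (F s) < e / 2"
    using F s half_gt_zero unfolding continuous_on_iff by blast
  then obtain d where d: "d > 0" "\<And>r. 0 \<le> r \<Longrightarrow> \<bar>r - s\<bar> < d \<Longrightarrow> norm (F r - F s) < e / 2"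
    by (auto simp: dist_norm)
  obtain N1 where N1: "1 / real (Suc N1) < d" using d(1) nat_approx_posE by blast
  obtain N2 where N2: "s < real N2" using reals_Archimedean2 by blast
  have "dist (interp n F (Suc n * Suc n) s) (F s) < e" if "n \<ge> N1 + N2" for n
  proof -
    have "1 / real (Suc n) \<le> 1 / real (Suc N1)" using that by (intro divide_left_mono) auto
    with N1 have nd: "1 / real (Suc n) < d" by linarith
    have sn: "s < real (Suc n)" using N2 that by linarith
    have "norm (interp n F (Suc n * Suc n) s - F s) \<le> e / 2"
    proof (rule interp_dist[OF s])
      fix r :: real assume r: "0 \<le> r" "\<bar>r - s\<bar> \<le> 1 / real (Suc n) \<or> r = real (Suc n * Suc n) / real (Suc n) \<and> r \<le> s"
      have "real (Suc n * Suc n) / real (Suc n) = real (Suc n)" by (simp only: of_nat_mult) simp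
      with r sn have "\<bar>r - s\<bar> \<le> 1 / real (Suc n)" by auto
      with nd d(2)[OF r(1)] show "norm (F r - F s) \<le> e / 2" by simp
    qed
    then show ?thesis using \<open>0 < e\<close> by (simp add: dist_norm)
  qed
  then show "\<exists>N. \<forall>n\<ge>N. dist (interp n F (Suc n * Suc n) s) (F s) < e" by blast
qed

context complex_banach
begin

text \<open>F is replaced by its piecewise linear interpolations, for which the integral is a finite
sum. Those sums form a Cauchy sequence: otherwise norming functionals for their differences
would contradict the continuity of L under bounded pointwise convergence.\<close>
lemma weak_integral_exists:
  assumes L: "measure_functional L"
    and F: "continuous_on {0..} F" "\<And>s. 0 \<le> s \<Longrightarrow> norm (F s) \<le> B"
  shows "\<exists>v. \<forall>\<phi>. bounded_linear \<phi> \<longrightarrow> cfun \<phi> v = L (\<lambda>s. cfun \<phi> (F s))"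
proof -
  interpret measure_functional L by fact
  define N where "N n = Suc n * Suc n" for n
  define \<Delta> where "\<Delta> n k = F (real (Suc k) / real (Suc n)) - F (real k / real (Suc n))" for n k
  define c where "c n k s = complex_of_real (clamp01 (real (Suc n) * s - real k))" for n k s
  \<comment> \<open>The vector-valued integral of the interpolation, obtained by applying L to the
    scalar ramps.\<close>
  define v where "v n = sc (L (\<lambda>s. 1)) (F 0) + (\<Sum>k<N n. sc (L (c n k)) (\<Delta> n k))" for n
  define G where "G n = interp n F (N n)" for n
  have cBC: "c n k \<in> BC" for n k
    unfolding c_def clamp01_def by (rule BC_of_real[where B=1]) (auto intro!: continuous_intros)
  have GB: "norm (G n s) \<le> B" if "0 \<le> s" for n s
    using interp_dist[OF that, of n "N n" F 0 B] F(2) unfolding G_def by simp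
  have Gc: "continuous_on {0..} (G n)" for n unfolding G_def by (rule continuous_on_interp)
  have vG: "cfun \<phi> (v n) = L (\<lambda>s. cfun \<phi> (G n s))" if \<phi>: "bounded_linear \<phi>" for \<phi> n
  proof -
    have "(\<lambda>s. cfun \<phi> (G n s)) = (\<lambda>s. cfun \<phi> (F 0) * 1 + (\<Sum>k<N n. cfun \<phi> (\<Delta> n k) * c n k s))"
      by (simp add: G_def interp_def c_def \<Delta>_def cfun_add[OF \<phi>] cfun_sum[OF \<phi>] cfun_scaleR[OF \<phi>] mult.commute del: of_nat_Suc)
    then have "L (\<lambda>s. cfun \<phi> (G n s)) = cfun \<phi> (F 0) * L (\<lambda>s. 1) + (\<Sum>k<N n. cfun \<phi> (\<Delta> n k) * L (c n k))"
      by (simp only: add[OF BC_cmult[OF BC_const] BC_sum[OF BC_cmult[OF cBC]]]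
          sum[OF finite_lessThan BC_cmult[OF cBC]] cmult[OF cBC] cmult[OF BC_const])
    then show ?thesis
      by (simp add: v_def cfun_add[OF \<phi>] cfun_sum[OF \<phi>] cfun_sc[OF \<phi>] mult.commute)
  qed
  have GF: "(\<lambda>n. G n s) \<longlonglongrightarrow> F s" if "0 \<le> s" for s
    unfolding G_def N_def by (rule interp_tendsto[OF F(1) that])
  have "Cauchy v"
  proof (rule ccontr)
    assume "\<not> Cauchy v"
    then obtain e where e: "e > 0" "\<forall>M. \<exists>m n. m \<ge> M \<and> n \<ge> M \<and> \<not> dist (v m) (v n) < e"
      unfolding Cauchy_def by blast
    then obtain m n where mn: "\<And>k::nat. m k \<ge> k" "\<And>k::nat. n k \<ge> k" "\<And>k. \<not> dist (v (m k)) (v (n k)) < e"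
      by metis
    have "\<forall>k. \<exists>\<phi>::'a \<Rightarrow> real. bounded_linear \<phi> \<and> \<phi> (v (m k) - v (n k)) = norm (v (m k) - v (n k)) \<and> (\<forall>x. \<bar>\<phi> x\<bar> \<le> norm x)"
    proof
      fix k
      show "\<exists>\<phi>::'a \<Rightarrow> real. bounded_linear \<phi> \<and> \<phi> (v (m k) - v (n k)) = norm (v (m k) - v (n k)) \<and> (\<forall>x. \<bar>\<phi> x\<bar> \<le> norm x)"
        by (rule hahn_banach_norming[of "v (m k) - v (n k)"]) blast
    qed
    then obtain \<phi> :: "nat \<Rightarrow> 'a \<Rightarrow> real" where \<phi>: "\<And>k. bounded_linear (\<phi> k)"
        "\<And>k. \<phi> k (v (m k) - v (n k)) = norm (v (m k) - v (n k))" "\<And>k x. \<bar>\<phi> k x\<bar> \<le> norm x"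
      by metis
    define g where "g k s = cfun (\<phi> k) (G (m k) s - G (n k) s)" for k s
    have gb: "cmod (g k s) \<le> 2 * norm (G (m k) s - G (n k) s)" for k s
      unfolding g_def using norm_cfun_le[OF \<phi>(1), of k 1] \<phi>(3) by simp
    have "(\<lambda>k. L (g k)) \<longlonglongrightarrow> L (\<lambda>s. 0)"
    \<comment> \<open>4 * B = 2 * (B + B): two interpolations, and the factor 2 of
      \<open>norm_cfun_le\<close>.\<close>
    proof (rule lim[where B="4 * B"])
      show "g k \<in> BC" for k
        unfolding g_def
        by (rule cfun_BC[OF \<phi>(1) continuous_on_diff[OF Gc Gc] order_trans[OF norm_triangle_ineq4 add_mono[OF GB GB]]])
      show "cmod (g k s) \<le> 4 * B" if "0 \<le> s" for k s
        using gb[of k s] norm_triangle_ineq4[of "G (m k) s" "G (n k) s"] GB[OF that, of "m k"] GB[OF that, of "n k"]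
        by linarith
      show "(\<lambda>k. g k s) \<longlonglongrightarrow> 0" if "0 \<le> s" for s
      proof (rule Lim_null_comparison)
        have "(\<lambda>k. G (m k) s) \<longlonglongrightarrow> F s" "(\<lambda>k. G (n k) s) \<longlonglongrightarrow> F s"
          using filterlim_compose[OF GF[OF that] filterlim_at_top_mono[OF filterlim_ident]] mn(1,2)
          by (simp_all add: always_eventually)
        from tendsto_diff[OF this] have "(\<lambda>k. G (m k) s - G (n k) s) \<longlonglongrightarrow> 0" by simp
        from tendsto_mult[OF tendsto_const tendsto_norm[OF this], of 2]
        show "(\<lambda>k. 2 * norm (G (m k) s - G (n k) s)) \<longlonglongrightarrow> 0" by simp
        show "\<forall>\<^sub>F k in sequentially. norm (g k s) \<le> 2 * norm (G (m k) s - G (n k) s)"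
          using gb by (simp add: always_eventually)
      qed
    qed simp
    moreover have "e \<le> cmod (L (g k))" for k
    proof -
      have "L (g k) = L (\<lambda>s. cfun (\<phi> k) (G (m k) s) - cfun (\<phi> k) (G (n k) s))"
        by (rule arg_cong[where f=L]) (simp add: g_def cfun_diff[OF \<phi>(1)] fun_eq_iff)
      also have "\<dots> = cfun (\<phi> k) (v (m k) - v (n k))"
        by (simp add: diff cfun_BC[OF \<phi>(1) Gc GB] vG[OF \<phi>(1)] cfun_diff[OF \<phi>(1)])
      finally have "Re (L (g k)) = norm (v (m k) - v (n k))" by (simp add: \<phi>(2))
      then show ?thesis using mn(3)[of k] complex_Re_le_cmod[of "L (g k)"] by (simp add: dist_norm)
    qed
    ultimately have "e \<le> 0"
      using tendsto_lowerbound[OF tendsto_norm, of "\<lambda>k. L (g k)" 0 sequentially e] by (simp add: zero)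
    then show False using e(1) by simp
  qed
  then obtain w where w: "v \<longlonglongrightarrow> w" using Cauchy_convergent convergent_def by blast
  have "cfun \<phi> w = L (\<lambda>s. cfun \<phi> (F s))" if \<phi>: "bounded_linear \<phi>" for \<phi>
  proof -
    interpret c: bounded_linear "cfun \<phi>" by (rule bounded_linear_cfun[OF \<phi>])
    obtain K where K: "K \<ge> 0" "\<And>x. norm (cfun \<phi> x) \<le> norm x * K" using c.nonneg_bounded by blast
    have "(\<lambda>n. L (\<lambda>s. cfun \<phi> (G n s))) \<longlonglongrightarrow> L (\<lambda>s. cfun \<phi> (F s))"
    proof (rule lim[where B="B * K"])
      show "cmod (cfun \<phi> (G n s)) \<le> B * K" if "0 \<le> s" for n s
        using K(2)[of "G n s"] mult_right_mono[OF GB[OF that] K(1)] by (rule order_trans)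
      show "(\<lambda>n. cfun \<phi> (G n s)) \<longlonglongrightarrow> cfun \<phi> (F s)" if "0 \<le> s" for s
        by (rule c.tendsto[OF GF[OF that]])
    qed (rule cfun_BC[OF \<phi> Gc GB] cfun_BC[OF \<phi> F]; assumption)+
    then have "(\<lambda>n. cfun \<phi> (v n)) \<longlonglongrightarrow> L (\<lambda>s. cfun \<phi> (F s))" by (simp add: vG[OF \<phi>])
    then show ?thesis using c.tendsto[OF w] LIMSEQ_unique by blast
  qed
  then show ?thesis by blast
qed

end

section \<open>Special functionals\<close>

lemma integral_exp_Icc:
  fixes w :: complex
  assumes "w \<noteq> 0" "0 \<le> t"
  shows "integral {0..t} (\<lambda>s. exp (of_real s * w)) = (exp (of_real t * w) - 1) / w"
proof -
  have "((\<lambda>s. exp (of_real s * w)) has_integral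
      exp (of_real t * w) / w - exp (of_real 0 * w) / w) {0..t}"
  proof (rule fundamental_theorem_of_calculus[OF assms(2)])
    fix s :: real
    have "((\<lambda>s. exp (s * w) / w) has_field_derivative exp (of_real s * w)) (at (of_real s))"
      using assms(1) by (auto intro!: derivative_eq_intros)
    from has_vector_derivative_real_field[OF this]
    show "((\<lambda>s. exp (of_real s * w) / w) has_vector_derivative exp (of_real s * w)) (at s within {0..t})"
      by simp
  qed
  then show ?thesis by (simp add: integral_unique diff_divide_distrib)
qed

lemma integrable_exp_Ici:
  assumes "Re w < 0"
  shows "integrable lborel (\<lambda>s. indicator {0..} s *\<^sub>R exp (of_real s * w))"
proof -
  have "(\<lambda>s. exp (- (- Re w) * s)) absolutely_integrable_on {0..}"
    by (intro nonnegative_absolutely_integrable_1 integrable_on_exp_minus_to_infinity) (use assms in auto)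
  then have "integrable (completion lborel) (\<lambda>s. indicator {0..} s *\<^sub>R exp (- (- Re w) * s))"
    by (simp add: set_integrable_def)
  then have "integrable lborel (\<lambda>s::real. indicator {0..} s *\<^sub>R exp (- (- Re w) * s))"
    by (subst (asm) integrable_completion) auto
  then show ?thesis
    by (rule Bochner_Integration.integrable_bound) (auto simp: mult.commute)
qed

lemma integral_exp_Ici:
  assumes "Re w < 0"
  shows "(\<integral>s. indicator {0..} s *\<^sub>R exp (of_real s * w) \<partial>lborel) = - 1 / w"
proof -
  have w: "w \<noteq> 0" using assms by auto
  have eq: "(\<integral>s. indicator {0..real n} s *\<^sub>R exp (of_real s * w) \<partial>lborel) = (exp (of_real (real n) * w) - 1) / w" for n
    using set_borel_integral_eq_integral(2)[OF borel_integrable_atLeastAtMost', of 0 "real n" "\<lambda>s. exp (of_real s * w)"]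
      integral_exp_Icc[OF w, of "real n"]
    by (simp add: set_lebesgue_integral_def continuous_intros)
  have "(\<lambda>n. \<integral>s. indicator {0..real n} s *\<^sub>R exp (of_real s * w) \<partial>lborel)
      \<longlonglongrightarrow> (\<integral>s. indicator {0..} s *\<^sub>R exp (of_real s * w) \<partial>lborel)"
  proof (rule integral_dominated_convergence[where w="\<lambda>s. norm (indicator {0..} s *\<^sub>R exp (of_real s * w))"])
    show "AE s in lborel. (\<lambda>n. indicator {0..real n} s *\<^sub>R exp (of_real s * w)) \<longlonglongrightarrow> indicator {0..} s *\<^sub>R exp (of_real s * w)"
    proof (rule AE_I2, rule tendsto_eventually)
      fix s :: real
      show "\<forall>\<^sub>F n in sequentially. indicator {0..real n} s *\<^sub>R exp (of_real s * w) = indicator {0..} s *\<^sub>R exp (of_real s * w)"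
        using eventually_ge_at_top[of "nat \<lceil>s\<rceil>"]
        by eventually_elim (auto simp: indicator_def nat_ceiling_le_eq)
    qed
    show "integrable lborel (\<lambda>s. norm (indicator {0..} s *\<^sub>R exp (of_real s * w)))"
      by (rule integrable_norm[OF integrable_exp_Ici[OF assms]])
    show "AE s in lborel. norm (indicator {0..real n} s *\<^sub>R exp (of_real s * w)) \<le> norm (indicator {0..} s *\<^sub>R exp (of_real s * w))" for n
      by (rule AE_I2) (auto simp: indicator_def)
  qed measurable
  moreover have "(\<lambda>n. (exp (of_real (real n) * w) - 1) / w) \<longlonglongrightarrow> (0 - 1) / w"
  proof (intro tendsto_intros w tendsto_norm_zero_cancel[of "\<lambda>n. exp (of_real (real n) * w)"])
    have "(\<lambda>n. exp (Re w) ^ n) \<longlonglongrightarrow> 0" using assms by (intro LIMSEQ_power_zero) simp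
    then show "(\<lambda>n. norm (exp (complex_of_real (real n) * w))) \<longlonglongrightarrow> 0"
      by (simp add: exp_of_nat_mult norm_power)
  qed
  ultimately show ?thesis unfolding eq using LIMSEQ_unique by fastforce
qed

lemma integral_Icc_eq_lborel:
  assumes k: "continuous_on {0..t} k" and f: "f \<in> BC"
  shows "integral {0..t} (\<lambda>s. k s * f s) = (\<integral>s. (indicator {0..t} s *\<^sub>R k s) * f (max 0 s) \<partial>lborel)"
proof -
  have "continuous_on {0..t} (\<lambda>s. k s * f s)"
    by (intro continuous_on_mult k continuous_on_subset[OF BC_continuous[OF f]]) auto
  from set_borel_integral_eq_integral(2)[OF borel_integrable_atLeastAtMost'[OF this]]
  have "integral {0..t} (\<lambda>s. k s * f s) = (\<integral>s. indicator {0..t} s *\<^sub>R (k s * f s) \<partial>lborel)"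
    by (simp add: set_lebesgue_integral_def)
  also have "\<dots> = (\<integral>s. (indicator {0..t} s *\<^sub>R k s) * f (max 0 s) \<partial>lborel)"
    by (rule Bochner_Integration.integral_cong) (auto simp: indicator_def)
  finally show ?thesis .
qed

lemma measure_functional_Icc:
  assumes k: "continuous_on {0..t} k"
  shows "measure_functional (\<lambda>f. integral {0..t} (\<lambda>s. k s * f s))"
proof (rule measure_functional_cong[OF _ integral_Icc_eq_lborel[OF k]])
  show "measure_functional (\<lambda>f. \<integral>s. (indicator {0..t} s *\<^sub>R k s) * f (max 0 s) \<partial>lborel)"
    using borel_integrable_atLeastAtMost'[OF k]
    by (intro measure_functional_integral) (auto simp: set_integrable_def)
qed

definition ifun :: "real \<Rightarrow> (real \<Rightarrow> complex) \<Rightarrow> complex" where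
  "ifun t f = integral {0..t} f"

lemma measure_functional_ifun: "measure_functional (ifun t)"
  using measure_functional_Icc[of t "\<lambda>_. 1"] by (simp add: ifun_def[abs_def])

lemma ifun_cexp: "z \<noteq> 0 \<Longrightarrow> 0 \<le> t \<Longrightarrow> ifun t (cexp z) = (1 - cexp z t) / z"
  using integral_exp_Icc[of "-z" t] by (simp add: ifun_def cexp_def[abs_def] minus_divide_left[symmetric] diff_divide_distrib)

lemma norm_ifun_le:
  assumes "f \<in> BC" "0 \<le> t" "\<And>s. 0 \<le> s \<Longrightarrow> cmod (f s) \<le> B"
  shows "cmod (ifun t f) \<le> B * t"
  using integral_bound[OF assms(2) continuous_on_subset[OF BC_continuous[OF assms(1)]], of B] assms(3)
  by (auto simp: ifun_def)

text \<open>The measure e^(sw) ds on the half-line has transform 1/(z - w), so its operator is the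
  inverse of A - w.\<close>

definition resolvent_fun :: "complex \<Rightarrow> (real \<Rightarrow> complex) \<Rightarrow> complex" where
  "resolvent_fun w f = (\<integral>s. (indicator {0..} s *\<^sub>R exp (of_real s * w)) * f (max 0 s) \<partial>lborel)"

lemma measure_functional_resolvent: "Re w < 0 \<Longrightarrow> measure_functional (resolvent_fun w)"
  unfolding resolvent_fun_def[abs_def]
  by (intro measure_functional_integral integrable_exp_Ici) auto

lemma resolvent_fun_cexp:
  assumes "Re w < 0" "0 \<le> Re z" shows "resolvent_fun w (cexp z) = 1 / (z - w)"
proof -
  have "resolvent_fun w (cexp z) = (\<integral>s. indicator {0..} s *\<^sub>R exp (of_real s * (w - z)) \<partial>lborel)"
    unfolding resolvent_fun_def cexp_def
    by (rule Bochner_Integration.integral_cong) (auto simp: indicator_def ring_distribs exp_diff exp_minus field_simps)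
  then show ?thesis using assms integral_exp_Ici[of "w - z"]
    by (simp add: minus_divide_right[of 1 "w - z"])
qed

text \<open>The substitution u = h + s, checked on exponentials. It exposes the dependence on h
  through an integral over [0,h], which can be differentiated at h = 0.\<close>

lemma resolvent_fun_shift:
  assumes w: "Re w < 0" and h: "0 \<le> h" and f: "f \<in> BC"
  shows "resolvent_fun w (\<lambda>s. f (h + s)) =
    cexp w h * (resolvent_fun w f - integral {0..h} (\<lambda>s. exp (of_real s * w) * f s))"
proof -
  let ?L = "conv (\<lambda>f. f h) (resolvent_fun w)"
  let ?L' = "\<lambda>f. cexp w h * (resolvent_fun w f - integral {0..h} (\<lambda>s. exp (of_real s * w) * f s))"
  note mf = measure_functional_resolvent[OF w]
  have "?L f = ?L' f"
  proof (rule measure_functional_eqI[OF _ _ _ f])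
    show "measure_functional ?L" by (intro measure_functional_conv measure_functional_point mf h)
    show "measure_functional ?L'"
      by (intro measure_functional_cmult measure_functional_diff mf measure_functional_Icc continuous_intros)
  next
    fix z :: real assume z: "0 < z"
    have "(\<lambda>s. exp (of_real s * w) * cexp (of_real z) s) = (\<lambda>s. exp (of_real s * (w - of_real z)))"
      by (rule ext) (simp add: cexp_def ring_distribs exp_diff exp_minus field_simps)
    moreover have ne: "w - of_real z \<noteq> 0" using w z by (auto simp: complex_eq_iff)
    ultimately have "?L' (cexp (of_real z)) = cexp w h * (1 / (of_real z - w) - (exp (of_real h * (w - of_real z)) - 1) / (w - of_real z))"
      using integral_exp_Icc[OF _ h, of "w - of_real z"] w z by (simp add: resolvent_fun_cexp)
    also have "1 / (of_real z - w) = - 1 / (w - of_real z)"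
      by (metis minus_diff_eq minus_divide_divide minus_divide_left)
    also have "cexp w h * (- 1 / (w - of_real z) - (exp (of_real h * (w - of_real z)) - 1) / (w - of_real z))
        = - (cexp w h * exp (of_real h * (w - of_real z))) / (w - of_real z)"
      using ne by (simp add: field_simps)
    also have "cexp w h * exp (of_real h * (w - of_real z)) = cexp (of_real z) h"
      by (simp add: cexp_def exp_add[symmetric] algebra_simps)
    also have "- cexp (of_real z) h / (w - of_real z) = cexp (of_real z) h * (1 / (of_real z - w))"
      by (metis divide_inverse minus_diff_eq minus_divide_left minus_divide_right mult.right_neutral times_divide_eq_right)
    also have "\<dots> = ?L (cexp (of_real z))"
      using z w by (simp add: conv_cexp measure_functional_point[OF h] mf resolvent_fun_cexp)
    finally show "?L (cexp (of_real z)) = ?L' (cexp (of_real z))" by simp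
  qed
  then show ?thesis by (simp add: conv_def)
qed

section \<open>Bernstein triples and the bounded measure with transform g(z)(1 - e^-z)/z\<close>

lemma
  assumes "bernstein_triple a b \<mu>"
  shows bernstein_sets: "sets \<mu> = sets borel"
    and bernstein_AE_pos: "AE s in \<mu>. 0 < s"
    and bernstein_integrable_clamp: "integrable \<mu> clamp01"
proof -
  show s: "sets \<mu> = sets borel" using assms by (simp add: bernstein_triple_def)
  show AE: "AE s in \<mu>. 0 < s"
    using assms s by (intro AE_I[where N="{..0}"]) (auto simp: bernstein_triple_def)
  have fin: "(\<integral>\<^sup>+ s. ennreal (s / (1 + s)) \<partial>\<mu>) < \<infinity>" using assms by (simp add: bernstein_triple_def)
  show "integrable \<mu> clamp01"
  proof (rule integrableI_bounded)
    show "clamp01 \<in> borel_measurable \<mu>" using s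
      by (subst measurable_cong_sets[OF s refl]) (simp add: clamp01_def[abs_def])
    have "(\<integral>\<^sup>+ s. ennreal (norm (clamp01 s)) \<partial>\<mu>) \<le> (\<integral>\<^sup>+ s. 2 * ennreal (s / (1 + s)) \<partial>\<mu>)"
    proof (rule nn_integral_mono_AE, use AE in eventually_elim)
      fix s :: real assume "0 < s"
      \<comment> \<open>On positive s the weights min(s,1) and s/(1+s) are comparable up to the
        factor 2.\<close>
      then have "clamp01 s \<le> 2 * (s / (1 + s))" "0 \<le> clamp01 s"
        by (auto simp: clamp01_def field_simps min_def)
      then show "ennreal (norm (clamp01 s)) \<le> 2 * ennreal (s / (1 + s))"
        using \<open>0 < s\<close> by (simp add: ennreal_mult[symmetric, of 2, simplified] ennreal_leI)
    qed
    also have "\<dots> = 2 * (\<integral>\<^sup>+ s. ennreal (s / (1 + s)) \<partial>\<mu>)"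
      by (rule nn_integral_cmult) (subst measurable_cong_sets[OF s refl], measurable)
    also have "\<dots> < \<infinity>" using fin by (simp add: ennreal_mult_less_top)
    finally show "(\<integral>\<^sup>+ s. ennreal (norm (clamp01 s)) \<partial>\<mu>) < \<infinity>" .
  qed
qed

text \<open>The functional whose Laplace transform is g(z)(1 - e^-z)/z for g ~ (a,b,\<mu>); the second
factor is the transform of Lebesgue measure on [0,1] and serves as a regulariser.\<close>
definition bern_functional :: "real \<Rightarrow> real \<Rightarrow> real measure \<Rightarrow> (real \<Rightarrow> complex) \<Rightarrow> complex" where
  "bern_functional a b \<mu> f = of_real a * ifun 1 f + of_real b * (f 0 - f 1) +
     (\<integral>s. (ifun 1 f - ifun 1 (\<lambda>r. f (max 0 s + r))) \<partial>\<mu>)"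

text \<open>[0,1] and [s,1+s] differ in the same signed way as [0,s] and [1,1+s]; the second pair
  has length s and so yields a bound that is small for small s.\<close>

lemma ifun_shift_diff:
  assumes s: "0 \<le> s" and f: "f \<in> BC"
  shows "ifun 1 f - ifun 1 (\<lambda>r. f (s + r)) = ifun s f - ifun s (\<lambda>r. f (1 + r))"
proof -
  have "ifun 1 f - conv (\<lambda>f. f s) (ifun 1) f = ifun s f - conv (\<lambda>f. f 1) (ifun s) f"
  proof (rule measure_functional_eqI[OF _ _ _ f])
    fix z :: real assume z: "0 < z"
    then show "ifun 1 (cexp (of_real z)) - conv (\<lambda>f. f s) (ifun 1) (cexp (of_real z)) =
        ifun s (cexp (of_real z)) - conv (\<lambda>f. f 1) (ifun s) (cexp (of_real z))"
      using s by (simp add: conv_cexp measure_functional_point measure_functional_ifun ifun_cexp field_simps)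
  qed (use s in \<open>intro measure_functional_diff measure_functional_conv measure_functional_ifun measure_functional_point; simp\<close>)+
  then show ?thesis by (simp add: conv_def)
qed

text \<open>The two forms of the difference give the bounds 2B and 2Bs; their minimum is integrable
  against \<mu>. This is what the averaging over [0,1] buys.\<close>

lemma norm_ifun_shift_diff:
  assumes f: "f \<in> BC" and B: "\<And>s. 0 \<le> s \<Longrightarrow> cmod (f s) \<le> B"
  shows "cmod (ifun 1 f - ifun 1 (\<lambda>r. f (max 0 s + r))) \<le> 2 * B * clamp01 s"
proof -
  define m where "m = max 0 s"
  have m: "0 \<le> m" by (simp add: m_def)
  have i: "cmod (ifun t (\<lambda>r. f (u + r))) \<le> B * t" if "0 \<le> t" "0 \<le> u" for t u
    using that by (intro norm_ifun_le BC_shift[OF f] B) auto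
  have "cmod (ifun 1 f - ifun 1 (\<lambda>r. f (m + r))) \<le> 2 * B"
    using norm_triangle_ineq4[of "ifun 1 f" "ifun 1 (\<lambda>r. f (m + r))"] i[of 1 0] i[of 1 m] m by simp
  moreover have "cmod (ifun 1 f - ifun 1 (\<lambda>r. f (m + r))) \<le> 2 * B * m"
    unfolding ifun_shift_diff[OF m f]
    using norm_triangle_ineq4[of "ifun m f" "ifun m (\<lambda>r. f (1 + r))"] i[of m 0] i[of m 1] m by simp
  ultimately show ?thesis by (auto simp: clamp01_def m_def[symmetric] max_def min_def m_def)
qed

lemma bern_functional_integrable:
  assumes t: "bernstein_triple a b \<mu>" and f: "f \<in> BC"
  shows "integrable \<mu> (\<lambda>s. ifun 1 f - ifun 1 (\<lambda>r. f (max 0 s + r)))"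
proof -
  obtain B where B: "\<And>s. 0 \<le> s \<Longrightarrow> cmod (f s) \<le> B" by (rule BC_bound[OF f]) blast
  interpret measure_functional "ifun 1" by (rule measure_functional_ifun)
  have "(\<lambda>s. ifun 1 (\<lambda>r. f (max 0 s + r))) \<in> borel_measurable \<mu>"
    by (rule measurable_BC_compose[OF shift_BC[OF f]])
      (simp add: measurable_cong_sets[OF bernstein_sets[OF t] refl])
  moreover have "cmod (ifun 1 f - ifun 1 (\<lambda>r. f (max 0 s + r))) \<le> norm (2 * B * clamp01 s)" for s
    using order_trans[OF norm_ifun_shift_diff[OF f B] abs_ge_self, of s] by simp
  ultimately show ?thesis
    by (intro Bochner_Integration.integrable_bound[OF integrable_mult_right[OF bernstein_integrable_clamp[OF t], of "2 * B"]] AE_I2)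
      simp_all
qed

text \<open>\<open>measure_functional_integral\<close> does not cover the \<mu>-part: \<mu> may be
  infinite, and only the difference of averages is integrable, dominated by 2 B
  \<open>clamp01\<close>.\<close>

lemma measure_functional_bern:
  assumes t: "bernstein_triple a b \<mu>"
  shows "measure_functional (bern_functional a b \<mu>)"
proof -
  interpret U: measure_functional "ifun 1" by (rule measure_functional_ifun)
  note int = bern_functional_integrable[OF t]
  have K: "measure_functional (\<lambda>f. \<integral>s. (ifun 1 f - ifun 1 (\<lambda>r. f (max 0 s + r))) \<partial>\<mu>)"
  proof
    fix f g assume fg: "f \<in> BC" "g \<in> BC"
    have "ifun 1 (\<lambda>s. f s + g s) - ifun 1 (\<lambda>r. f (max 0 s + r) + g (max 0 s + r)) =
        (ifun 1 f - ifun 1 (\<lambda>r. f (max 0 s + r))) + (ifun 1 g - ifun 1 (\<lambda>r. g (max 0 s + r)))" for s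
      using U.add[OF fg] U.add[OF BC_shift[OF fg(1), of "max 0 s"] BC_shift[OF fg(2), of "max 0 s"]] by simp
    then show "(\<integral>s. (ifun 1 (\<lambda>s. f s + g s) - ifun 1 (\<lambda>r. f (max 0 s + r) + g (max 0 s + r))) \<partial>\<mu>) =
        (\<integral>s. (ifun 1 f - ifun 1 (\<lambda>r. f (max 0 s + r))) \<partial>\<mu>) + (\<integral>s. (ifun 1 g - ifun 1 (\<lambda>r. g (max 0 s + r))) \<partial>\<mu>)"
      using int[OF fg(1)] int[OF fg(2)] by (simp only: Bochner_Integration.integral_add)
  next
    fix f and c :: complex assume f: "f \<in> BC"
    have "ifun 1 (\<lambda>s. c * f s) - ifun 1 (\<lambda>r. c * f (max 0 s + r)) = c * (ifun 1 f - ifun 1 (\<lambda>r. f (max 0 s + r)))" for s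
      using U.cmult[OF f] U.cmult[OF BC_shift[OF f, of "max 0 s"]] by (simp add: right_diff_distrib)
    then show "(\<integral>s. (ifun 1 (\<lambda>s. c * f s) - ifun 1 (\<lambda>r. c * f (max 0 s + r))) \<partial>\<mu>) =
        c * (\<integral>s. (ifun 1 f - ifun 1 (\<lambda>r. f (max 0 s + r))) \<partial>\<mu>)"
      by simp
  next
    show "\<exists>C\<ge>0. \<forall>f\<in>BC. \<forall>B. (\<forall>s\<ge>0. cmod (f s) \<le> B) \<longrightarrow>
        cmod (\<integral>s. (ifun 1 f - ifun 1 (\<lambda>r. f (max 0 s + r))) \<partial>\<mu>) \<le> C * B"
    proof (intro exI[of _ "\<integral>s. 2 * clamp01 s \<partial>\<mu>"] conjI ballI allI impI)
      show "0 \<le> (\<integral>s. 2 * clamp01 s \<partial>\<mu>)" by (rule integral_nonneg_AE) (simp add: clamp01_def)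
      fix f B assume f: "f \<in> BC" and B: "\<forall>s\<ge>0. cmod (f s) \<le> B"
      have "cmod (\<integral>s. (ifun 1 f - ifun 1 (\<lambda>r. f (max 0 s + r))) \<partial>\<mu>) \<le>
          (\<integral>s. cmod (ifun 1 f - ifun 1 (\<lambda>r. f (max 0 s + r))) \<partial>\<mu>)"
        by (rule integral_norm_bound)
      also have "\<dots> \<le> (\<integral>s. 2 * clamp01 s * B \<partial>\<mu>)"
      proof (rule integral_mono[OF integrable_norm[OF int[OF f]]])
        show "cmod (ifun 1 f - ifun 1 (\<lambda>r. f (max 0 s + r))) \<le> 2 * clamp01 s * B" for s
          using norm_ifun_shift_diff[OF f, of B s] B by (simp add: mult_ac)
      qed (use bernstein_integrable_clamp[OF t] in simp)
      finally show "cmod (\<integral>s. (ifun 1 f - ifun 1 (\<lambda>r. f (max 0 s + r))) \<partial>\<mu>) \<le> (\<integral>s. 2 * clamp01 s \<partial>\<mu>) * B"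
        by simp
    qed
  next
    fix F f B assume F: "\<And>n::nat. F n \<in> BC" and f: "f \<in> BC"
      and B: "\<And>n s. 0 \<le> s \<Longrightarrow> cmod (F n s) \<le> B" and l: "\<And>s. 0 \<le> s \<Longrightarrow> (\<lambda>n. F n s) \<longlonglongrightarrow> f s"
    show "(\<lambda>n. \<integral>s. (ifun 1 (F n) - ifun 1 (\<lambda>r. F n (max 0 s + r))) \<partial>\<mu>)
        \<longlonglongrightarrow> (\<integral>s. (ifun 1 f - ifun 1 (\<lambda>r. f (max 0 s + r))) \<partial>\<mu>)"
    proof (rule integral_dominated_convergence[where w="\<lambda>s. 2 * B * clamp01 s"])
      show "AE s in \<mu>. (\<lambda>n. ifun 1 (F n) - ifun 1 (\<lambda>r. F n (max 0 s + r))) \<longlonglongrightarrow> ifun 1 f - ifun 1 (\<lambda>r. f (max 0 s + r))"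
      proof (rule AE_I2, rule tendsto_diff)
        show "(\<lambda>n. ifun 1 (F n)) \<longlonglongrightarrow> ifun 1 f" by (rule U.lim[OF F f B l])
        show "(\<lambda>n. ifun 1 (\<lambda>r. F n (max 0 s + r))) \<longlonglongrightarrow> ifun 1 (\<lambda>r. f (max 0 s + r))" for s
          by (rule U.lim[OF BC_shift[OF F] BC_shift[OF f] B l]) auto
      qed
      show "AE s in \<mu>. cmod (ifun 1 (F n) - ifun 1 (\<lambda>r. F n (max 0 s + r))) \<le> 2 * B * clamp01 s" for n
        by (rule AE_I2, rule norm_ifun_shift_diff[OF F B])
      show "integrable \<mu> (\<lambda>s. 2 * B * clamp01 s)" using bernstein_integrable_clamp[OF t] by simp
    qed (rule borel_measurable_integrable[OF int[OF f]] borel_measurable_integrable[OF int[OF F]])+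
  qed
  have "measure_functional (\<lambda>f. of_real a * ifun 1 f + of_real b * (f 0 - f 1) +
     (\<integral>s. (ifun 1 f - ifun 1 (\<lambda>r. f (max 0 s + r))) \<partial>\<mu>))"
    by (rule measure_functional_add[OF measure_functional_add[OF
        measure_functional_cmult[OF measure_functional_ifun]
        measure_functional_cmult[OF measure_functional_diff[OF measure_functional_point measure_functional_point]]] K]) simp_all
  then show ?thesis by (simp add: bern_functional_def[abs_def])
qed

lemma bern_functional_cexp:
  assumes t: "bernstein_triple a b \<mu>" and z: "0 \<le> Re z" "z \<noteq> 0"
  shows "bern_functional a b \<mu> (cexp z) = bern_fun a b \<mu> z * ifun 1 (cexp z)"
proof -
  interpret U: measure_functional "ifun 1" by (rule measure_functional_ifun)
  have s: "clamp01 \<in> borel_measurable \<mu>" using bernstein_integrable_clamp[OF t] by (rule borel_measurable_integrable)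
  have "(\<integral>s. (ifun 1 (cexp z) - ifun 1 (\<lambda>r. cexp z (max 0 s + r))) \<partial>\<mu>)
      = (\<integral>s. (1 - cexp z (max 0 s)) * ifun 1 (cexp z) \<partial>\<mu>)"
    by (simp add: U.cexp_shift[OF z(1)] left_diff_distrib)
  also have "\<dots> = (\<integral>s. (1 - exp (- (of_real s * z))) * ifun 1 (cexp z) \<partial>\<mu>)"
  proof (rule integral_cong_AE)
    have "(\<lambda>s. 1 - cexp z (max 0 s)) \<in> borel_measurable \<mu>"
      by (intro borel_measurable_diff borel_measurable_const measurable_BC_compose[OF cexp_BC[OF z(1)]])
        (simp add: measurable_cong_sets[OF bernstein_sets[OF t] refl])
    then show "(\<lambda>s. (1 - cexp z (max 0 s)) * ifun 1 (cexp z)) \<in> borel_measurable \<mu>" by simp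
    show "(\<lambda>s. (1 - exp (- (of_real s * z))) * ifun 1 (cexp z)) \<in> borel_measurable \<mu>"
      by (subst measurable_cong_sets[OF bernstein_sets[OF t] refl]) measurable
    show "AE s in \<mu>. (1 - cexp z (max 0 s)) * ifun 1 (cexp z) = (1 - exp (- (of_real s * z))) * ifun 1 (cexp z)"
      using bernstein_AE_pos[OF t] by eventually_elim (simp add: cexp_def)
  qed
  finally have "(\<integral>s. (ifun 1 (cexp z) - ifun 1 (\<lambda>r. cexp z (max 0 s + r))) \<partial>\<mu>)
      = (\<integral>s. (1 - exp (- (of_real s * z))) \<partial>\<mu>) * ifun 1 (cexp z)" by simp
  \<comment> \<open>The factor z of the linear term cancels the denominator of (1 - e^-z)/z, leaving
    point masses at 0 and 1.\<close>
  moreover have "cexp z 0 - cexp z 1 = z * ifun 1 (cexp z)" using z by (simp add: ifun_cexp)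
  ultimately show ?thesis by (simp add: bern_functional_def bern_fun_def ring_distribs)
qed

section \<open>The Hille--Phillips calculus\<close>

lemma tendsto_at_right_cong:
  fixes f g :: "real \<Rightarrow> 'b::topological_space"
  assumes "\<And>h. 0 < h \<Longrightarrow> f h = g h" "(g \<longlongrightarrow> l) (at_right 0)"
  shows "(f \<longlongrightarrow> l) (at_right 0)"
  using assms(2) by (rule Lim_transform_eventually) (rule eventually_mono[OF eventually_at_right_less], simp add: assms(1))

locale bounded_c0_semigroup = complex_banach sc for sc :: "complex \<Rightarrow> 'a::banach \<Rightarrow> 'a" +
  fixes T :: "real \<Rightarrow> 'a \<Rightarrow> 'a"
  assumes c0: "c0_semigroup sc T" and bounded: "bounded_semigroup T"
begin

lemma T_0 [simp]: "T 0 x = x"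
  and T_add: "0 \<le> s \<Longrightarrow> 0 \<le> t \<Longrightarrow> T (s + t) x = T s (T t x)"
  and T_bounded_linear: "0 \<le> s \<Longrightarrow> bounded_linear (T s)"
  and T_sc: "0 \<le> s \<Longrightarrow> T s (sc c x) = sc c (T s x)"
  and T_continuous: "continuous_on {0..} (\<lambda>s. T s x)"
  using c0 by (auto simp: c0_semigroup_def)

definition M :: real where
  "M = (SOME M. 0 \<le> M \<and> (\<forall>s\<ge>0. \<forall>x. norm (T s x) \<le> M * norm x))"

lemma M_nonneg: "0 \<le> M" and M: "0 \<le> s \<Longrightarrow> norm (T s x) \<le> M * norm x"
proof -
  obtain K where K: "\<And>s x. 0 \<le> s \<Longrightarrow> norm (T s x) \<le> K * norm x"
    using bounded by (auto simp: bounded_semigroup_def)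
  have "norm (T s x) \<le> max 0 K * norm x" if "0 \<le> s" for s x
    using K[OF that, of x] mult_right_mono[of K "max 0 K" "norm x"] by simp
  then have "\<exists>M. 0 \<le> M \<and> (\<forall>s\<ge>0. \<forall>x. norm (T s x) \<le> M * norm x)"
    by (intro exI[of _ "max 0 K"]) simp
  from someI_ex[OF this] show "0 \<le> M" "0 \<le> s \<Longrightarrow> norm (T s x) \<le> M * norm x"
    unfolding M_def by blast+
qed

lemma orbit_BC: "bounded_linear \<phi> \<Longrightarrow> (\<lambda>s. cfun \<phi> (T s x)) \<in> BC"
  by (rule cfun_BC[OF _ T_continuous M])

text \<open>V is the operator \<integral> T(s) d\<nu>, where \<nu> is the complex measure represented by L.\<close>
definition rep :: "((real \<Rightarrow> complex) \<Rightarrow> complex) \<Rightarrow> ('a \<Rightarrow> 'a) \<Rightarrow> bool" where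
  "rep L V \<longleftrightarrow> (\<forall>\<phi> x. bounded_linear \<phi> \<longrightarrow> cfun \<phi> (V x) = L (\<lambda>s. cfun \<phi> (T s x)))"

lemma repD: "rep L V \<Longrightarrow> bounded_linear \<phi> \<Longrightarrow> cfun \<phi> (V x) = L (\<lambda>s. cfun \<phi> (T s x))"
  by (simp add: rep_def)

lemma rep_unique:
  assumes "rep L V" "rep L' V'" "\<And>f. f \<in> BC \<Longrightarrow> L f = L' f" shows "V = V'"
proof (rule ext, rule cfun_separate)
  fix x \<phi> assume "bounded_linear (\<phi> :: 'a \<Rightarrow> real)"
  then show "cfun \<phi> (V x) = cfun \<phi> (V' x)"
    using repD[OF assms(1)] repD[OF assms(2)] assms(3)[OF orbit_BC] by simp
qed

lemma rep_exists:
  assumes "measure_functional L" obtains V where "rep L V"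
proof -
  have "\<forall>x. \<exists>v. \<forall>\<phi>. bounded_linear \<phi> \<longrightarrow> cfun \<phi> v = L (\<lambda>s. cfun \<phi> (T s x))"
    using weak_integral_exists[OF assms T_continuous M] by blast
  then obtain V where "\<And>x \<phi>. bounded_linear \<phi> \<Longrightarrow> cfun \<phi> (V x) = L (\<lambda>s. cfun \<phi> (T s x))" by metis
  then show ?thesis by (intro that[of V]) (simp add: rep_def)
qed

lemma rep_bounded_linear:
  assumes L: "measure_functional L" and V: "rep L V" shows "bounded_linear V"
proof -
  interpret measure_functional L by (rule L)
  obtain C where C: "C \<ge> 0" "\<And>f B. f \<in> BC \<Longrightarrow> (\<forall>s\<ge>0. cmod (f s) \<le> B) \<Longrightarrow> cmod (L f) \<le> C * B"
    using bounded by blast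
  show ?thesis
  proof (rule bounded_linear_intro[where K="C * (2 * M)"])
    fix x y show "V (x + y) = V x + V y"
    proof (rule cfun_separate)
      fix \<phi> :: "'a \<Rightarrow> real" assume \<phi>: "bounded_linear \<phi>"
      have "cfun \<phi> (V (x + y)) = L (\<lambda>s. cfun \<phi> (T s (x + y)))" by (rule repD[OF V \<phi>])
      also have "\<dots> = L (\<lambda>s. cfun \<phi> (T s x) + cfun \<phi> (T s y))"
        using T_bounded_linear
        by (intro cong orbit_BC[OF \<phi>] BC_add) (simp add: bounded_linear.linear linear_add flip: cfun_add[OF \<phi>])
      finally show "cfun \<phi> (V (x + y)) = cfun \<phi> (V x + V y)"
        by (simp add: add orbit_BC[OF \<phi>] cfun_add[OF \<phi>] repD[OF V \<phi>])
    qed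
  next
    fix r x show "V (r *\<^sub>R x) = r *\<^sub>R V x"
    proof (rule cfun_separate)
      fix \<phi> :: "'a \<Rightarrow> real" assume \<phi>: "bounded_linear \<phi>"
      have "cfun \<phi> (V (r *\<^sub>R x)) = L (\<lambda>s. cfun \<phi> (T s (r *\<^sub>R x)))" by (rule repD[OF V \<phi>])
      also have "\<dots> = L (\<lambda>s. of_real r * cfun \<phi> (T s x))"
        using T_bounded_linear
        by (intro cong orbit_BC[OF \<phi>] BC_cmult) (simp add: bounded_linear.linear linear_cmul flip: cfun_scaleR[OF \<phi>])
      finally show "cfun \<phi> (V (r *\<^sub>R x)) = cfun \<phi> (r *\<^sub>R V x)"
        by (simp add: cmult orbit_BC[OF \<phi>] cfun_scaleR[OF \<phi>] repD[OF V \<phi>])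
    qed
  next
    fix x show "norm (V x) \<le> norm x * (C * (2 * M))"
    proof (rule norm_le_cfun)
      fix \<phi> :: "'a \<Rightarrow> real" assume \<phi>: "bounded_linear \<phi>" "\<And>x. \<bar>\<phi> x\<bar> \<le> norm x"
      have "cmod (cfun \<phi> (T s x)) \<le> 2 * (M * norm x)" if "0 \<le> s" for s
        using norm_cfun_le[OF \<phi>(1), of 1 "T s x"] \<phi>(2) M[OF that, of x] by simp
      then show "cmod (cfun \<phi> (V x)) \<le> norm x * (C * (2 * M))"
        using C(2)[OF orbit_BC[OF \<phi>(1), of x], of "2 * (M * norm x)"] by (simp add: repD[OF V \<phi>(1)] mult_ac)
    qed
  qed
qed

lemma bounded_linear_comp_T: "bounded_linear \<phi> \<Longrightarrow> 0 \<le> t \<Longrightarrow> bounded_linear (\<lambda>x. \<phi> (T t x))"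
  using bounded_linear_compose T_bounded_linear by blast

text \<open>T t passes under the weak integral because \<phi> composed with T t is again a bounded
  functional.\<close>

lemma cfun_T_rep:
  assumes L: "measure_functional L" and V: "rep L V" and \<phi>: "bounded_linear \<phi>" and t: "0 \<le> t"
  shows "cfun \<phi> (T t (V x)) = L (\<lambda>s. cfun \<phi> (T (t + s) x))"
proof -
  interpret measure_functional L by (rule L)
  have eq: "cfun (\<lambda>x. \<phi> (T t x)) y = cfun \<phi> (T t y)" for y
    using t by (simp add: cfun_def T_sc)
  have "cfun \<phi> (T t (V x)) = L (\<lambda>s. cfun \<phi> (T t (T s x)))"
    using repD[OF V bounded_linear_comp_T[OF \<phi> t], of x] by (simp add: eq)
  also have "\<dots> = L (\<lambda>s. cfun \<phi> (T (t + s) x))"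
  proof (rule cong)
    show "(\<lambda>s. cfun \<phi> (T t (T s x))) \<in> BC"
      using orbit_BC[OF bounded_linear_comp_T[OF \<phi> t], of x] by (simp add: eq)
    show "(\<lambda>s. cfun \<phi> (T (t + s) x)) \<in> BC" by (rule BC_shift[OF orbit_BC[OF \<phi>] t])
  qed (simp add: T_add t)
  finally show ?thesis .
qed

text \<open>Multiplicativity of the calculus: composing operators means convolving measures, hence
  multiplying transforms.\<close>

lemma rep_conv:
  assumes L: "measure_functional L" "measure_functional L'" and V: "rep L V" "rep L' V'"
  shows "rep (conv L L') (\<lambda>x. V (V' x))"
  unfolding rep_def conv_def
proof (intro allI impI)
  interpret measure_functional L by (rule L)
  interpret L': measure_functional L' by (rule L)
  fix \<phi> :: "'a \<Rightarrow> real" and x assume \<phi>: "bounded_linear \<phi>"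
  have "cfun \<phi> (V (V' x)) = L (\<lambda>t. cfun \<phi> (T t (V' x)))" by (rule repD[OF V(1) \<phi>])
  also have "\<dots> = L (\<lambda>t. L' (\<lambda>s. cfun \<phi> (T (t + s) x)))"
    by (rule cong[OF orbit_BC[OF \<phi>] L'.shift_BC[OF orbit_BC[OF \<phi>]] cfun_T_rep[OF L(2) V(2) \<phi>]])
  finally show "cfun \<phi> (V (V' x)) = L (\<lambda>t. L' (\<lambda>s. cfun \<phi> (T (t + s) x)))" .
qed

lemma rep_point: "rep (\<lambda>f. f t) (T t)"
  by (simp add: rep_def)

lemma rep_commute:
  assumes L: "measure_functional L" "measure_functional L'" and V: "rep L V" "rep L' V'"
  shows "V (V' x) = V' (V x)"
proof -
  have "(\<lambda>x. V (V' x)) = (\<lambda>x. V' (V x))"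
  proof (rule rep_unique[OF rep_conv[OF L V] rep_conv[OF L(2,1) V(2,1)]])
    fix f assume "f \<in> BC"
    then show "conv L L' f = conv L' L f"
      by (rule measure_functional_eqI[OF measure_functional_conv[OF L] measure_functional_conv[OF L(2,1)], rotated])
        (simp add: conv_cexp L mult.commute)
  qed
  then show ?thesis by (rule fun_cong)
qed

lemma rep_T_commute: "measure_functional L \<Longrightarrow> rep L V \<Longrightarrow> 0 \<le> t \<Longrightarrow> T t (V x) = V (T t x)"
  using rep_commute[OF measure_functional_point _ rep_point] by blast

lemma laplace_bcm_eq:
  assumes "bcm \<rho> h"
  shows "laplace_bcm \<rho> h z = (\<integral>s. h s * cexp z (max 0 s) \<partial>\<rho>)"
proof -
  have s: "sets \<rho> = sets borel" and h: "h \<in> borel_measurable \<rho>" and 0: "emeasure \<rho> {..<0} = 0"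
    using assms by (auto simp: bcm_def)
  have AE: "AE s in \<rho>. 0 \<le> s"
    using 0 s by (intro AE_I[where N="{..<0}"]) auto
  have "cexp z \<in> borel_measurable \<rho>" "(\<lambda>s. cexp z (max 0 s)) \<in> borel_measurable \<rho>"
    unfolding cexp_def by (subst measurable_cong_sets[OF s refl], measurable)+
  then have "(\<lambda>s. h s * cexp z s) \<in> borel_measurable \<rho>" "(\<lambda>s. h s * cexp z (max 0 s)) \<in> borel_measurable \<rho>"
    using h by auto
  then show ?thesis unfolding laplace_bcm_def cexp_def[symmetric]
    by (rule integral_cong_AE) (use AE in \<open>eventually_elim, simp\<close>)
qed

definition bcm_fun :: "real measure \<Rightarrow> (real \<Rightarrow> complex) \<Rightarrow> (real \<Rightarrow> complex) \<Rightarrow> complex" where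
  "bcm_fun \<rho> h f = (\<integral>s. h s * f (max 0 s) \<partial>\<rho>)"

lemma measure_functional_bcm: "bcm \<rho> h \<Longrightarrow> measure_functional (bcm_fun \<rho> h)"
  unfolding bcm_fun_def[abs_def]
proof (rule measure_functional_integral)
  assume b: "bcm \<rho> h"
  then have s: "sets \<rho> = sets borel" by (simp add: bcm_def)
  show "(\<lambda>s. s) \<in> borel_measurable \<rho>" by (subst measurable_cong_sets[OF s refl]) simp
  show "integrable \<rho> h" using b by (simp add: bcm_def)
qed

text \<open>Resolves the definite description in \<open>hp_op\<close>: a candidate exists by
  \<open>rep_exists\<close>, and bounded functionals separate points.\<close>

lemma rep_hp_op:
  assumes b: "bcm \<rho> h" shows "rep (bcm_fun \<rho> h) (hp_op sc T \<rho> h)"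
proof -
  obtain V where V: "rep (bcm_fun \<rho> h) V" by (rule rep_exists[OF measure_functional_bcm[OF b]])
  have s: "sets \<rho> = sets borel" and h: "integrable \<rho> h" and 0: "emeasure \<rho> {..<0} = 0"
    using b by (auto simp: bcm_def)
  have AE: "AE s in \<rho>. 0 \<le> s" using 0 s by (intro AE_I[where N="{..<0}"]) auto
  have X: "(\<lambda>s. s) \<in> borel_measurable \<rho>" by (subst measurable_cong_sets[OF s refl]) simp
  have *: "integrable \<rho> (\<lambda>s. if 0 \<le> s then \<phi> (sc (h s) (T s x)) else 0)
     \<and> (\<integral>s. (if 0 \<le> s then \<phi> (sc (h s) (T s x)) else 0) \<partial>\<rho>) = \<phi> (V x)"
    if \<phi>: "bounded_linear \<phi>" for \<phi> :: "'a \<Rightarrow> real" and x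
  proof -
    have i: "integrable \<rho> (\<lambda>s. h s * cfun \<phi> (T (max 0 s) x))"
      by (rule integrable_mult_BC[OF h X orbit_BC[OF \<phi>]])
    \<comment> \<open>\<open>hp_integral\<close> tests real functionals only; each is the real part
      of its complex-linear companion \<open>cfun\<close>. The indicator is harmless since \<rho>
      has no mass below 0.\<close>
    have eq: "(if 0 \<le> s then \<phi> (sc (h s) (T s x)) else 0) = indicator {0..} s * Re (h s * cfun \<phi> (T (max 0 s) x))" for s
      using Re_cfun[of \<phi> "sc (h s) (T s x)"] by (simp add: cfun_sc[OF \<phi>])
    have m: "{0..} \<in> sets \<rho>" by (simp add: s)
    have "integrable \<rho> (\<lambda>s. indicator {0..} s * Re (h s * cfun \<phi> (T (max 0 s) x)))"
      using integrable_mult_indicator[OF m integrable_Re[OF i]] by (simp only: real_scaleR_def)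
    moreover have "(\<integral>s. indicator {0..} s * Re (h s * cfun \<phi> (T (max 0 s) x)) \<partial>\<rho>) = (\<integral>s. Re (h s * cfun \<phi> (T (max 0 s) x)) \<partial>\<rho>)"
      by (rule integral_cong_AE[OF borel_measurable_integrable[OF calculation] borel_measurable_integrable[OF integrable_Re[OF i]]])
        (use AE in \<open>eventually_elim, simp\<close>)
    moreover have "\<dots> = Re (\<integral>s. h s * cfun \<phi> (T (max 0 s) x) \<partial>\<rho>)" by (rule integral_Re[OF i])
    moreover have "(\<integral>s. h s * cfun \<phi> (T (max 0 s) x) \<partial>\<rho>) = cfun \<phi> (V x)"
      using repD[OF V \<phi>, of x] by (simp only: bcm_fun_def)
    moreover have "Re (cfun \<phi> (V x)) = \<phi> (V x)" by simp
    ultimately show ?thesis unfolding eq by (simp only: simp_thms)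
  qed
  have "hp_op sc T \<rho> h x = V x" for x
    unfolding hp_op_def
  proof (rule the_equality)
    show "hp_integral sc T \<rho> h x (V x)"
      unfolding hp_integral_def
    proof (intro allI impI)
      fix \<phi> :: "'a \<Rightarrow> real" assume "bounded_linear \<phi>"
      from *[OF this, of x] show "integrable \<rho> (\<lambda>s. if 0 \<le> s then \<phi> (sc (h s) (T s x)) else 0)
        \<and> \<phi> (V x) = (\<integral>s. (if 0 \<le> s then \<phi> (sc (h s) (T s x)) else 0) \<partial>\<rho>)" by argo
    qed
    fix v assume v: "hp_integral sc T \<rho> h x v"
    show "v = V x"
    proof (rule functionals_separate)
      fix \<phi> :: "'a \<Rightarrow> real" assume \<phi>: "bounded_linear \<phi>"
      have "\<phi> v = (\<integral>s. (if 0 \<le> s then \<phi> (sc (h s) (T s x)) else 0) \<partial>\<rho>)"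
        using v \<phi> unfolding hp_integral_def by blast
      then show "\<phi> v = \<phi> (V x)" using *[OF \<phi>, of x] by argo
    qed
  qed
  then have "hp_op sc T \<rho> h = V" by (rule ext)
  then show ?thesis using V by simp
qed

end

locale semigroup_generator = bounded_c0_semigroup sc T for sc :: "complex \<Rightarrow> 'a::banach \<Rightarrow> 'a" and T +
  fixes D :: "'a set" and A :: "'a \<Rightarrow> 'a"
  assumes gen: "is_neg_generator T D A"
begin

lemma genD: "x \<in> D \<Longrightarrow> ((\<lambda>h. (1 / h) *\<^sub>R (T h x - x)) \<longlongrightarrow> - A x) (at_right 0)"
  using gen by (simp add: is_neg_generator_def)

lemma genI:
  assumes "((\<lambda>h. (1 / h) *\<^sub>R (T h x - x)) \<longlongrightarrow> - y) (at_right 0)"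
  shows "x \<in> D" "A x = y"
proof -
  show x: "x \<in> D" using gen assms by (auto simp: is_neg_generator_def)
  show "A x = y" using tendsto_unique[OF _ assms genD[OF x]] by simp
qed

lemma D_linear:
  assumes "x \<in> D" "y \<in> D"
  shows "sc c x + sc d y \<in> D" "A (sc c x + sc d y) = sc c (A x) + sc d (A y)"
proof -
  interpret c: bounded_linear "sc c" by (rule bounded_linear_sc)
  interpret d: bounded_linear "sc d" by (rule bounded_linear_sc)
  have eq: "(1 / h) *\<^sub>R (T h (sc c x + sc d y) - (sc c x + sc d y)) =
      sc c ((1 / h) *\<^sub>R (T h x - x)) + sc d ((1 / h) *\<^sub>R (T h y - y))" if "h > 0" for h
    using T_bounded_linear[of h] that
    by (simp add: bounded_linear.linear linear_add T_sc sc_scaleR sc_diff_right algebra_simps)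
  have "((\<lambda>h. sc c ((1 / h) *\<^sub>R (T h x - x)) + sc d ((1 / h) *\<^sub>R (T h y - y))) \<longlongrightarrow> sc c (- A x) + sc d (- A y)) (at_right 0)"
    by (intro tendsto_add c.tendsto d.tendsto genD assms)
  moreover have "sc c (- A x) + sc d (- A y) = - (sc c (A x) + sc d (A y))" by (simp add: sc_minus_right)
  ultimately have "((\<lambda>h. (1 / h) *\<^sub>R (T h (sc c x + sc d y) - (sc c x + sc d y))) \<longlongrightarrow> - (sc c (A x) + sc d (A y))) (at_right 0)"
    by (intro tendsto_at_right_cong[OF eq]) simp_all
  then show "sc c x + sc d y \<in> D" "A (sc c x + sc d y) = sc c (A x) + sc d (A y)" using genI by blast+
qed

lemma D_sc: "x \<in> D \<Longrightarrow> sc c x \<in> D" and A_sc: "x \<in> D \<Longrightarrow> A (sc c x) = sc c (A x)"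
  using D_linear[of x x c 0] by simp_all

lemma D_rep:
  assumes L: "measure_functional L" and V: "rep L V" and x: "x \<in> D"
  shows "V x \<in> D" "A (V x) = V (A x)"
proof -
  interpret V: bounded_linear V by (rule rep_bounded_linear[OF L V])
  have "(1 / h) *\<^sub>R (T h (V x) - V x) = V ((1 / h) *\<^sub>R (T h x - x))" if "h > 0" for h
    using that by (simp add: rep_T_commute[OF L V] V.scaleR V.diff)
  then have "((\<lambda>h. (1 / h) *\<^sub>R (T h (V x) - V x)) \<longlongrightarrow> V (- A x)) (at_right 0)"
    by (rule tendsto_at_right_cong) (assumption, rule V.tendsto[OF genD[OF x]])
  then have "((\<lambda>h. (1 / h) *\<^sub>R (T h (V x) - V x)) \<longlongrightarrow> - V (A x)) (at_right 0)"
    by (simp add: V.neg)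
  then show "V x \<in> D" "A (V x) = V (A x)" using genI by blast+
qed

end

section \<open>Spectrum of the generator\<close>

context complex_banach
begin

lemma bounded_bilinear_sc: "bounded_bilinear sc"
proof
  fix r a b x y
  show "sc (r *\<^sub>R a) x = r *\<^sub>R sc a x"
    using sc_mult[of "of_real r" a x] by (simp add: scaleR_conv_of_real sc_of_real)
  show "\<exists>K. \<forall>a b. norm (sc a b) \<le> norm a * norm b * K"
    by (rule exI[of _ 1]) (simp add: norm_sc)
qed (simp_all add: sc_add_left sc_add_right sc_scaleR)

lemmas tendsto_sc = bounded_bilinear.tendsto[OF bounded_bilinear_sc]
  and continuous_on_sc = bounded_bilinear.continuous_on[OF bounded_bilinear_sc]

lemma sc_quotient: "sc ((a - 1) / of_real h) x = (1 / h) *\<^sub>R (sc a x - x)"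
proof -
  have "(a - 1) / of_real h = of_real (1 / h) * (a - 1)" by simp
  then show ?thesis by (simp only: sc_mult sc_of_real sc_diff_left sc_1)
qed

end

lemma has_vector_derivative_at_right_0:
  assumes "(f has_vector_derivative f') (at_right 0)"
  shows "((\<lambda>h. (1 / h) *\<^sub>R (f h - f 0)) \<longlongrightarrow> f') (at_right 0)"
proof -
  have "((\<lambda>h. (1 / norm (h - 0)) *\<^sub>R (f h - (f 0 + (h - 0) *\<^sub>R f'))) \<longlongrightarrow> 0) (at_right 0)"
    using assms unfolding has_vector_derivative_def has_derivative_within by blast
  then have "((\<lambda>h. (1 / h) *\<^sub>R (f h - f 0) - f') \<longlongrightarrow> 0) (at_right 0)"
    by (rule tendsto_at_right_cong[rotated]) (simp add: scaleR_diff_right scaleR_add_right)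
  then show ?thesis by (rule LIM_zero_cancel)
qed

lemma cexp_quotient_tendsto:
  "((\<lambda>h. (cexp w h - 1) / of_real h) \<longlongrightarrow> - w) (at_right 0)"
proof -
  have "((\<lambda>h. exp (- (h * w))) has_field_derivative - w) (at (of_real 0))"
    by (auto intro!: derivative_eq_intros)
  from has_vector_derivative_real_field[OF this]
  have "((\<lambda>h. cexp w h) has_vector_derivative - w) (at_right 0)"
    by (auto simp: cexp_def[abs_def] intro: has_vector_derivative_at_within)
  from has_vector_derivative_at_right_0[OF this] show ?thesis
    by (simp add: scaleR_conv_of_real)
qed

context semigroup_generator
begin

text \<open>\<open>resolvent_fun_shift\<close> gives T h V y = e^(-wh) (V y - \<integral> of e^(sw)
  T s y over [0,h]); its right derivative at h = 0 is -w V y - y, which has to be -A V y.\<close>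

lemma resolvent_left_half_plane:
  assumes w: "Re w < 0" and V: "rep (resolvent_fun w) V"
  shows "V y \<in> D" "A (V y) = sc w (V y) + y"
proof -
  define G where "G s = sc (exp (of_real s * w)) (T s y)" for s
  have Gc: "continuous_on {0..h} G" for h
    unfolding G_def by (intro continuous_on_sc continuous_intros continuous_on_subset[OF T_continuous]) auto
  define I where "I h = integral {0..h} G" for h
  have key: "T h (V y) = sc (cexp w h) (V y - I h)" if h: "0 \<le> h" for h
  proof (rule cfun_separate)
    fix \<phi> :: "'a \<Rightarrow> real" assume \<phi>: "bounded_linear \<phi>"
    have "cfun \<phi> (T h (V y)) = resolvent_fun w (\<lambda>s. cfun \<phi> (T (h + s) y))"
      by (rule cfun_T_rep[OF measure_functional_resolvent[OF w] V \<phi> h])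
    also have "\<dots> = cexp w h * (resolvent_fun w (\<lambda>s. cfun \<phi> (T s y)) - integral {0..h} (\<lambda>s. exp (of_real s * w) * cfun \<phi> (T s y)))"
      by (rule resolvent_fun_shift[OF w h orbit_BC[OF \<phi>]])
    also have "integral {0..h} (\<lambda>s. exp (of_real s * w) * cfun \<phi> (T s y)) = cfun \<phi> (I h)"
      using integral_linear[OF integrable_continuous_real[OF Gc] bounded_linear_cfun[OF \<phi>], of h]
      by (simp add: I_def comp_def G_def[abs_def] cfun_sc[OF \<phi>])
    also have "resolvent_fun w (\<lambda>s. cfun \<phi> (T s y)) = cfun \<phi> (V y)" by (simp add: repD[OF V \<phi>])
    finally show "cfun \<phi> (T h (V y)) = cfun \<phi> (sc (cexp w h) (V y - I h))"
      by (simp add: cfun_sc[OF \<phi>] cfun_diff[OF \<phi>])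
  qed
  have "(I has_vector_derivative G 0) (at 0 within {0..1})"
    unfolding I_def by (rule integral_has_vector_derivative[OF Gc]) simp
  then have "(I has_vector_derivative y) (at_right 0)"
    by (simp add: at_within_Icc_at_right G_def)
  from has_vector_derivative_at_right_0[OF this]
  have I: "((\<lambda>h. (1 / h) *\<^sub>R I h) \<longlongrightarrow> y) (at_right 0)" by (simp add: I_def)
  have c1: "((\<lambda>h. cexp w h) \<longlongrightarrow> 1) (at_right 0)"
    using continuous_on_cexp[of UNIV w] by (auto simp: continuous_on_def cexp_0[of w, symmetric] simp del: cexp_0 intro: tendsto_within_subset)
  have "((\<lambda>h. (1 / h) *\<^sub>R (T h (V y) - V y)) \<longlongrightarrow> sc (- w) (V y) - sc 1 y) (at_right 0)"
  proof (rule tendsto_at_right_cong)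
    show "(1 / h) *\<^sub>R (T h (V y) - V y) = sc ((cexp w h - 1) / of_real h) (V y) - sc (cexp w h) ((1 / h) *\<^sub>R I h)"
      if "0 < h" for h
      unfolding sc_quotient using that by (simp add: key sc_diff_right sc_scaleR algebra_simps)
    show "((\<lambda>h. sc ((cexp w h - 1) / of_real h) (V y) - sc (cexp w h) ((1 / h) *\<^sub>R I h)) \<longlongrightarrow> sc (- w) (V y) - sc 1 y) (at_right 0)"
      by (intro tendsto_diff tendsto_sc tendsto_const cexp_quotient_tendsto c1 I)
  qed
  then have "((\<lambda>h. (1 / h) *\<^sub>R (T h (V y) - V y)) \<longlongrightarrow> - (sc w (V y) + y)) (at_right 0)"
    by (simp add: sc_minus_left)
  then show "V y \<in> D" "A (V y) = sc w (V y) + y" using genI by blast+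
qed

lemma in_resolvent_left_half_plane:
  assumes w: "Re w < 0" shows "in_resolvent sc D A w"
proof -
  note mf = measure_functional_resolvent[OF w]
  obtain V where V: "rep (resolvent_fun w) V" by (rule rep_exists[OF mf])
  note R = resolvent_left_half_plane[OF w V]
  interpret V: bounded_linear V by (rule rep_bounded_linear[OF mf V])
  show ?thesis unfolding in_resolvent_def
  \<comment> \<open>The sign: V inverts A - w, while \<open>in_resolvent\<close> asks for an inverse
    of w - A.\<close>
  proof (intro exI[of _ "\<lambda>y. - V y"] conjI allI ballI)
    show "bounded_linear (\<lambda>y. - V y)" by (rule bounded_linear_minus[OF V.bounded_linear_axioms])
    show "- V y \<in> D" for y using D_sc[OF R(1), of "-1" y] by (simp add: sc_minus_left)
    have Am: "A (- V y) = - A (V y)" for y using A_sc[OF R(1), of "-1" y] by (simp add: sc_minus_left)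
    show "sc w (- V y) - A (- V y) = y" for y by (simp add: Am R(2) sc_minus_right)
    show "- V (sc w x - A x) = x" if "x \<in> D" for x
    proof -
      have "V (A x) = A (V x)" using D_rep(2)[OF mf V that] by simp
      \<comment> \<open>\<open>rep_bounded_linear\<close> gives real linearity only; complex
        homogeneity comes from that of T and L.\<close>
      moreover have "V (sc w x) = sc w (V x)"
      proof (rule cfun_separate)
        fix \<phi> :: "'a \<Rightarrow> real" assume \<phi>: "bounded_linear \<phi>"
        interpret measure_functional "resolvent_fun w" by (rule mf)
        have "cfun \<phi> (V (sc w x)) = resolvent_fun w (\<lambda>s. cfun \<phi> (T s (sc w x)))" by (rule repD[OF V \<phi>])
        also have "\<dots> = resolvent_fun w (\<lambda>s. w * cfun \<phi> (T s x))"
          by (rule cong[OF orbit_BC[OF \<phi>] BC_cmult[OF orbit_BC[OF \<phi>]]]) (simp add: T_sc cfun_sc[OF \<phi>])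
        also have "\<dots> = w * resolvent_fun w (\<lambda>s. cfun \<phi> (T s x))" by (rule cmult[OF orbit_BC[OF \<phi>]])
        finally show "cfun \<phi> (V (sc w x)) = cfun \<phi> (sc w (V x))" by (simp add: repD[OF V \<phi>] cfun_sc[OF \<phi>])
      qed
      ultimately show ?thesis by (simp add: V.diff R(2))
    qed
  qed
qed

text \<open>Neumann series, in the form of Banach's fixed point theorem.\<close>
lemma in_resolvent_near:
  assumes R: "bounded_linear R" "\<And>y. R y \<in> D" "\<And>y. sc w (R y) - A (R y) = y"
      "\<And>x. x \<in> D \<Longrightarrow> R (sc w x - A x) = x"
    and K: "0 \<le> K" "\<And>y. norm (R y) \<le> K * norm y" "cmod (z - w) * K < 1"
  shows "in_resolvent sc D A z"
proof -
  interpret R: bounded_linear R by (rule R(1))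
  define q where "q = cmod (z - w) * K"
  have q: "0 \<le> q" "q < 1" using K by (auto simp: q_def)
  have contr: "norm (R (sc (z - w) u)) \<le> q * norm u" for u
    using K(2)[of "sc (z - w) u"] by (simp add: norm_sc q_def mult_ac)
  \<comment> \<open>(z - A) x = y is the same as (w - A) x = y - (z - w) x, that is, x is a fixed
    point of this contraction.\<close>
  have ex1: "\<exists>!x. R (y - sc (z - w) x) = x" for y
  proof (rule banach_fix_type[OF q], intro allI)
    fix u v
    have "R (y - sc (z - w) u) - R (y - sc (z - w) v) = R (sc (z - w) (v - u))"
      by (simp add: sc_diff_right R.diff)
    then show "dist (R (y - sc (z - w) u)) (R (y - sc (z - w) v)) \<le> q * dist u v"
      using contr[of "v - u"] by (simp add: dist_norm norm_minus_commute)
  qed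
  define S where "S y = (THE x. R (y - sc (z - w) x) = x)" for y
  have S: "R (y - sc (z - w) (S y)) = S y" for y
    unfolding S_def by (rule theI'[OF ex1])
  have SI: "S y = x" if "R (y - sc (z - w) x) = x" for x y
    using ex1[of y] S[of y] that by blast
  have SD: "S y \<in> D" for y using R(2) S by metis
  have eq1: "sc w (S y) - A (S y) = y - sc (z - w) (S y)" for y using R(3) S by metis
  show ?thesis unfolding in_resolvent_def
  proof (intro exI[of _ S] conjI allI ballI)
    show "bounded_linear S"
    proof (rule bounded_linear_intro[where K="K / (1 - q)"])
      show "S (x + y) = S x + S y" for x y
      proof (rule SI)
        have "R (x + y - sc (z - w) (S x + S y)) = R (x - sc (z - w) (S x)) + R (y - sc (z - w) (S y))"
          by (simp add: sc_add_right R.diff R.add)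
        then show "R (x + y - sc (z - w) (S x + S y)) = S x + S y" by (simp only: S)
      qed
      show "S (r *\<^sub>R x) = r *\<^sub>R S x" for r x
      proof (rule SI)
        have "R (r *\<^sub>R x - sc (z - w) (r *\<^sub>R S x)) = r *\<^sub>R R (x - sc (z - w) (S x))"
          by (simp add: sc_scaleR R.diff R.scaleR scaleR_diff_right)
        then show "R (r *\<^sub>R x - sc (z - w) (r *\<^sub>R S x)) = r *\<^sub>R S x" by (simp only: S)
      qed
      show "norm (S y) \<le> norm y * (K / (1 - q))" for y
      proof -
        have "norm (S y) \<le> norm (R y) + norm (R (sc (z - w) (S y)))"
          using norm_triangle_ineq4[of "R y" "R (sc (z - w) (S y))"] S[of y] by (simp add: R.diff)
        also have "\<dots> \<le> K * norm y + q * norm (S y)" using K(2) contr by (rule add_mono)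
        finally show ?thesis using q by (simp add: field_simps)
      qed
    qed
    show "S y \<in> D" for y by (rule SD)
    show "sc z (S y) - A (S y) = y" for y using eq1[of y] by (simp add: sc_diff_left algebra_simps)
    show "S (sc z x - A x) = x" if "x \<in> D" for x
      by (rule SI) (use R(4)[OF that] in \<open>simp add: sc_diff_left\<close>)
  qed
qed

lemma closed_spectrum: "closed (op_spectrum sc D A)"
proof -
  have "open (- op_spectrum sc D A)"
    unfolding open_dist
  proof
    fix w assume "w \<in> - op_spectrum sc D A"
    then obtain R where R: "bounded_linear R" "\<And>y. R y \<in> D" "\<And>y. sc w (R y) - A (R y) = y"
      "\<And>x. x \<in> D \<Longrightarrow> R (sc w x - A x) = x"
      by (auto simp: op_spectrum_def in_resolvent_def)
    obtain K where K: "K > 0" "\<And>y. norm (R y) \<le> norm y * K" using bounded_linear.pos_bounded[OF R(1)] by blast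
    have "z \<in> - op_spectrum sc D A" if "dist z w < 1 / K" for z
      using in_resolvent_near[OF R, of K z] K that by (simp add: op_spectrum_def dist_norm field_simps)
    then show "\<exists>e>0. \<forall>y. dist y w < e \<longrightarrow> y \<in> - op_spectrum sc D A"
      using K(1) by (intro exI[of _ "1 / K"]) auto
  qed
  then show ?thesis by (simp add: closed_def)
qed

text \<open>The resolvent blows up near the spectrum, so boundary points are approximate eigenvalues.\<close>
lemma frontier_approximate_eigenvector:
  assumes z: "z \<in> frontier (op_spectrum sc D A)" and \<delta>: "0 < \<delta>"
  shows "\<exists>x\<in>D. norm x = 1 \<and> norm (sc z x - A x) \<le> \<delta>"
proof -
  have zs: "z \<in> op_spectrum sc D A" using z closed_spectrum frontier_subset_closed by blast
  have "z \<in> closure (- op_spectrum sc D A)" using z by (simp add: frontier_closures)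
  then obtain w where w: "w \<in> - op_spectrum sc D A" "dist w z < \<delta> / 3"
    using \<delta> by (metis closure_approachable divide_pos_pos zero_less_numeral)
  then obtain R where R: "bounded_linear R" "\<And>y. R y \<in> D" "\<And>y. sc w (R y) - A (R y) = y"
    "\<And>x. x \<in> D \<Longrightarrow> R (sc w x - A x) = x"
    by (auto simp: op_spectrum_def in_resolvent_def)
  have zw: "z \<noteq> w" using zs w(1) by auto
  \<comment> \<open>Then |z - w| K = 1/2, so if K bounded R, z would lie in the resolvent set. Some
    y violates the bound, and u = R y has |y| < 2 |z - w| |u|; with the perturbation (z - w) u this
    gives the factor 3 that matches \<delta> / 3.\<close>
  define K where "K = 1 / (2 * cmod (z - w))"
  have K: "0 < K" "cmod (z - w) * K < 1" using zw by (auto simp: K_def)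
  have "\<not> (\<forall>y. norm (R y) \<le> K * norm y)"
    using in_resolvent_near[OF R, of K z] K zs by (auto simp: op_spectrum_def)
  then obtain y where y: "norm (R y) > K * norm y" by (auto simp: not_le)
  define u where "u = R y"
  have "0 \<le> K * norm y" using K(1) by simp
  then have u0: "norm u > 0" using y unfolding u_def by linarith
  have "norm y < 2 * cmod (z - w) * norm u" using y zw by (simp add: K_def u_def field_simps)
  moreover have "sc z u - A u = y + sc (z - w) u"
    using R(3)[of y] by (simp add: u_def sc_diff_left algebra_simps)
  ultimately have "norm (sc z u - A u) \<le> 3 * cmod (z - w) * norm u"
    using norm_triangle_ineq[of y "sc (z - w) u"] by (simp add: norm_sc)
  also have "\<dots> \<le> \<delta> * norm u" using w(2) by (intro mult_right_mono) (auto simp: dist_norm norm_minus_commute)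
  finally have *: "norm (sc z u - A u) \<le> \<delta> * norm u" .
  have uD: "u \<in> D" by (simp add: u_def R(2))
  define c where "c = complex_of_real (1 / norm u)"
  have "sc z (sc c u) - A (sc c u) = sc c (sc z u - A u)"
    by (simp add: A_sc[OF uD] sc_diff_right sc_mult[symmetric] mult.commute)
  then have "norm (sc z (sc c u) - A (sc c u)) \<le> \<delta>" using * u0 by (simp add: norm_sc c_def norm_divide field_simps)
  moreover have "norm (sc c u) = 1" using u0 by (simp add: norm_sc c_def norm_divide)
  ultimately show ?thesis using D_sc[OF uD, of c] by blast
qed

text \<open>Cut [0,s] into n+1 steps of length h. Telescoping with |e^(-zh)| \<le> 1 bounds the
  error by (n+1) M d(h) = M s d(h)/h, and d(h)/h tends to the norm of zx - Ax by the definition of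
  the generator.\<close>

lemma approximate_eigenvector_orbit:
  assumes z: "0 \<le> Re z" and x: "x \<in> D" and s: "0 < s"
  shows "norm (T s x - sc (cexp z s) x) \<le> M * s * norm (sc z x - A x)"
proof -
  define d where "d h = norm (T h x - sc (cexp z h) x)" for h
  have tel: "norm (T (real n * h) x - sc (cexp z (real n * h)) x) \<le> real n * (M * d h)" if "0 \<le> h" for n h
  proof (induction n)
    case (Suc n)
    have e: "real (Suc n) * h = real n * h + h" by (simp add: algebra_simps)
    have nh: "0 \<le> real n * h" using that by simp
    interpret t: bounded_linear "T (real n * h)" by (rule T_bounded_linear[OF nh])
    have "T (real (Suc n) * h) x - sc (cexp z (real (Suc n) * h)) x =
        T (real n * h) (T h x - sc (cexp z h) x) + sc (cexp z h) (T (real n * h) x - sc (cexp z (real n * h)) x)"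
      unfolding e T_add[OF nh that] cexp_add
      by (simp add: t.diff T_sc[OF nh] sc_diff_right sc_mult[symmetric] mult.commute[of "cexp z (real n * h)"])
    also have "norm \<dots> \<le> M * d h + 1 * (real n * (M * d h))"
    proof (rule order_trans[OF norm_triangle_ineq add_mono])
      show "norm (T (real n * h) (T h x - sc (cexp z h) x)) \<le> M * d h" unfolding d_def by (rule M[OF nh])
      show "norm (sc (cexp z h) (T (real n * h) x - sc (cexp z (real n * h)) x)) \<le> 1 * (real n * (M * d h))"
        unfolding norm_sc by (rule mult_mono[OF norm_cexp_le_1[OF z that] Suc.IH]) simp_all
    qed
    finally show ?case by (simp add: algebra_simps)
  qed simp
  have "((\<lambda>h. norm ((1 / h) *\<^sub>R (T h x - x) - sc ((cexp z h - 1) / of_real h) x)) \<longlongrightarrow> norm (- A x - sc (- z) x)) (at_right 0)"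
    by (intro tendsto_norm tendsto_diff genD[OF x] tendsto_sc cexp_quotient_tendsto tendsto_const)
  moreover have eq2: "norm (- A x - sc (- z) x) = norm (sc z x - A x)" by (simp add: sc_minus_left)
  moreover have eq1: "d h / h = norm ((1 / h) *\<^sub>R (T h x - x) - sc ((cexp z h - 1) / of_real h) x)" if "0 < h" for h
    using that by (simp add: d_def sc_quotient flip: scaleR_diff_right)
  ultimately have lim: "((\<lambda>h. d h / h) \<longlongrightarrow> norm (sc z x - A x)) (at_right 0)"
    unfolding eq2 by (intro tendsto_at_right_cong[OF eq1]) auto
  have "filterlim (\<lambda>n. s / real (Suc n)) (at_right 0) sequentially"
    unfolding filterlim_at
  proof
    show "(\<lambda>n. s / real (Suc n)) \<longlonglongrightarrow> 0" by (rule LIMSEQ_Suc[OF lim_const_over_n])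
  qed (use s in auto)
  from filterlim_compose[OF lim this]
  have "(\<lambda>n. M * s * (d (s / real (Suc n)) / (s / real (Suc n)))) \<longlonglongrightarrow> M * s * norm (sc z x - A x)"
    by (intro tendsto_mult tendsto_const)
  moreover have "norm (T s x - sc (cexp z s) x) \<le> M * s * (d (s / real (Suc n)) / (s / real (Suc n)))" for n
    using tel[of "s / real (Suc n)" "Suc n"] s by (simp add: field_simps del: of_nat_Suc)
  ultimately show ?thesis by (intro tendsto_lowerbound[OF _ always_eventually]) auto
qed

text \<open>Spectral inclusion: on approximate eigenvectors V acts almost as multiplication by the
Laplace transform at z.\<close>
lemma laplace_le_norm_rep:
  assumes L: "measure_functional L" and V: "rep L V" and K: "\<And>x. norm (V x) \<le> K * norm x"
    and z: "z \<in> frontier (op_spectrum sc D A)" "0 \<le> Re z"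
  shows "cmod (L (cexp z)) \<le> 2 * K"
proof -
  interpret measure_functional L by (rule L)
  have "\<forall>n::nat. \<exists>x. x \<in> D \<and> norm x = 1 \<and> norm (sc z x - A x) \<le> 1 / real (Suc n)"
    using frontier_approximate_eigenvector[OF z(1)] by (metis of_nat_0_less_iff zero_less_Suc zero_less_divide_1_iff)
  then obtain x where x: "\<And>n::nat. x n \<in> D" "\<And>n. norm (x n) = 1" "\<And>n. norm (sc z (x n) - A (x n)) \<le> 1 / real (Suc n)"
    by metis
  have "\<forall>n. \<exists>\<phi>::'a \<Rightarrow> real. bounded_linear \<phi> \<and> \<phi> (x n) = 1 \<and> (\<forall>y. \<bar>\<phi> y\<bar> \<le> norm y)"
  proof
    fix n show "\<exists>\<phi>::'a \<Rightarrow> real. bounded_linear \<phi> \<and> \<phi> (x n) = 1 \<and> (\<forall>y. \<bar>\<phi> y\<bar> \<le> norm y)"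
      using x(2)[of n] by (metis hahn_banach_norming)
  qed
  then obtain \<phi> :: "nat \<Rightarrow> 'a \<Rightarrow> real" where \<phi>: "\<And>n. bounded_linear (\<phi> n)" "\<And>n. \<phi> n (x n) = 1" "\<And>n y. \<bar>\<phi> n y\<bar> \<le> norm y"
    by metis
  define m where "m n = cfun (\<phi> n) (x n)" for n
  \<comment> \<open>The deviation of the orbit from the exponential. It tends to 0 only pointwise,
    at rate 2 M s/(n+1), but is uniformly bounded, which is all that \<open>lim\<close> asks
    for.\<close>
  define g where "g n s = cfun (\<phi> n) (T s (x n)) - m n * cexp z s" for n s
  have b: "cmod (cfun (\<phi> n) y) \<le> 2 * norm y" for n y
    using norm_cfun_le[OF \<phi>(1), of n 1 y] \<phi>(3) by simp
  have g_eq: "g n s = cfun (\<phi> n) (T s (x n) - sc (cexp z s) (x n))" for n s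
    by (simp add: g_def m_def cfun_diff[OF \<phi>(1)] cfun_sc[OF \<phi>(1)] mult.commute)
  have "(\<lambda>n. L (g n)) \<longlonglongrightarrow> L (\<lambda>s. 0)"
  proof (rule lim[where B="2 * (M + 1)"])
    show "g n \<in> BC" for n
      unfolding g_def by (rule BC_diff[OF orbit_BC[OF \<phi>(1)] BC_cmult[OF cexp_BC[OF z(2)]]])
    show "cmod (g n s) \<le> 2 * (M + 1)" if "0 \<le> s" for n s
    proof -
      have "norm (T s (x n) - sc (cexp z s) (x n)) \<le> M * 1 + 1"
        using norm_triangle_ineq4[of "T s (x n)" "sc (cexp z s) (x n)"] M[OF that, of "x n"] norm_cexp_le_1[OF z(2) that]
        by (simp add: norm_sc x(2))
      then show ?thesis using b[of n "T s (x n) - sc (cexp z s) (x n)"] by (simp add: g_eq)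
    qed
    show "(\<lambda>n. g n s) \<longlonglongrightarrow> 0" if "0 \<le> s" for s
    proof (rule Lim_null_comparison)
      show "\<forall>\<^sub>F n in sequentially. norm (g n s) \<le> 2 * M * s * (1 / real (Suc n))"
      proof (rule always_eventually, rule allI)
        fix n
        have "norm (T s (x n) - sc (cexp z s) (x n)) \<le> M * s * norm (sc z (x n) - A (x n))"
          using approximate_eigenvector_orbit[OF z(2) x(1), of s n] that by (cases "s = 0") auto
        also have "\<dots> \<le> M * s * (1 / real (Suc n))"
          using x(3) M_nonneg that by (intro mult_left_mono) auto
        finally show "norm (g n s) \<le> 2 * M * s * (1 / real (Suc n))"
          using b[of n "T s (x n) - sc (cexp z s) (x n)"] by (simp add: g_eq)
      qed
      show "(\<lambda>n. 2 * M * s * (1 / real (Suc n))) \<longlonglongrightarrow> 0"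
        using tendsto_mult[OF tendsto_const LIMSEQ_Suc[OF lim_1_over_n], of "2 * M * s"] by simp
    qed
  qed simp
  then have lim0: "(\<lambda>n. cmod (L (g n)) + 2 * K) \<longlonglongrightarrow> 0 + 2 * K"
    by (intro tendsto_add tendsto_const) (simp add: zero tendsto_norm_zero)
  have "cmod (L (cexp z)) \<le> cmod (L (g n)) + 2 * K" for n
  proof -
    have "L (g n) = cfun (\<phi> n) (V (x n)) - m n * L (cexp z)"
      unfolding g_def
      using diff[OF orbit_BC[OF \<phi>(1)] BC_cmult[OF cexp_BC[OF z(2)]]] repD[OF V \<phi>(1)]
      by (simp add: cmult cexp_BC[OF z(2)])
    then have "m n * L (cexp z) = cfun (\<phi> n) (V (x n)) - L (g n)" by simp
    then have "cmod (m n * L (cexp z)) \<le> cmod (L (g n)) + cmod (cfun (\<phi> n) (V (x n)))"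
      using norm_triangle_ineq4[of "cfun (\<phi> n) (V (x n))" "L (g n)"] by simp
    also have "cmod (cfun (\<phi> n) (V (x n))) \<le> 2 * K" using b[of n "V (x n)"] K[of "x n"] by (simp add: x(2))
    finally have "cmod (m n) * cmod (L (cexp z)) \<le> cmod (L (g n)) + 2 * K" by (simp add: norm_mult)
    moreover have "1 \<le> cmod (m n)" using complex_Re_le_cmod[of "m n"] by (simp add: m_def \<phi>(2))
    ultimately show ?thesis using mult_right_mono[of 1 "cmod (m n)" "cmod (L (cexp z))"] by simp
  qed
  then show ?thesis using tendsto_lowerbound[OF lim0 always_eventually] by simp
qed

end

section \<open>A regulariser for Bernstein functions\<close>

lemma cexp_zero: "cexp 0 s = 1"
  by (simp add: cexp_def)

lemma clamp01_nonneg: "0 \<le> clamp01 s"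
  by (simp add: clamp01_def)

text \<open>Needed for Fubini with \<mu>. By Markov's inequality \<mu> is finite where min(s,1) is
  at least 1/(n+1); these sets exhaust the positive half-line, and the rest is null.\<close>

lemma bernstein_sigma_finite:
  assumes t: "bernstein_triple a b \<mu>" shows "sigma_finite_measure \<mu>"
proof
  have s: "sets \<mu> = sets borel" by (rule bernstein_sets[OF t])
  have sp: "space \<mu> = UNIV" using sets_eq_imp_space_eq[OF s] by simp
  define B where "B n = {s::real. 1 \<le> ennreal (real (Suc n)) * ennreal (clamp01 s)}" for n
  have BB: "B n = {s. 1 / real (Suc n) \<le> clamp01 s}" for n
    by (auto simp: B_def ennreal_mult[symmetric] clamp01_def field_simps simp del: of_nat_Suc)
  have Bs: "B n \<in> sets \<mu>" for n unfolding BB s clamp01_def by measurable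
  have fin: "emeasure \<mu> (B n) \<noteq> \<infinity>" for n
  proof -
    have cm: "clamp01 \<in> borel_measurable \<mu>"
      by (rule borel_measurable_integrable[OF bernstein_integrable_clamp[OF t]])
    have "emeasure \<mu> {x\<in>UNIV. 1 \<le> ennreal (real (Suc n)) * ennreal (clamp01 x)} \<le>
        ennreal (real (Suc n)) * (\<integral>\<^sup>+ x. ennreal (clamp01 x) * indicator UNIV x \<partial>\<mu>)"
    proof (rule nn_integral_Markov_inequality)
      show "(\<lambda>x. ennreal (clamp01 x) * indicator UNIV x) \<in> borel_measurable \<mu>" using cm by simp
      show "UNIV \<in> sets \<mu>" by (simp add: s)
    qed
    also have "(\<integral>\<^sup>+ x. ennreal (clamp01 x) * indicator UNIV x \<partial>\<mu>) = ennreal (\<integral>x. clamp01 x \<partial>\<mu>)"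
      using nn_integral_eq_integral[OF bernstein_integrable_clamp[OF t]] clamp01_nonneg by simp
    also have "ennreal (real (Suc n)) * ennreal (\<integral>x. clamp01 x \<partial>\<mu>) < \<infinity>"
      by (simp add: ennreal_mult_less_top del: of_nat_Suc)
    finally show ?thesis by (simp add: B_def less_top)
  qed
  have "\<exists>n. s \<in> B n" if "0 < s" for s
  proof -
    have "0 < clamp01 s" using that by (simp add: clamp01_def)
    then obtain n where "1 / real (Suc n) < clamp01 s" by (rule nat_approx_posE)
    then show ?thesis by (intro exI[of _ n]) (simp add: BB)
  qed
  then have "(\<Union>(insert {..0} (range B))) = UNIV"
    by (auto simp: not_le[symmetric])
  then show "\<exists>A. countable A \<and> A \<subseteq> sets \<mu> \<and> \<Union> A = space \<mu> \<and> (\<forall>a\<in>A. emeasure \<mu> a \<noteq> \<infinity>)"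
    using Bs fin t s sp by (intro exI[of _ "insert {..0} (range B)"]) (auto simp: bernstein_triple_def)
qed

text \<open>\<open>bcm\<close> demands a finite reference measure, which Lebesgue measure is not;
  densities of the regulariser are therefore written relative to the probability measure e^-r
  dr.\<close>

definition expdens :: "real \<Rightarrow> real" where
  "expdens r = indicator {0..} r * exp (- r)"

definition expm :: "real measure" where
  "expm = density lborel expdens"

lemma expdens_nonneg: "0 \<le> expdens r" and expdens_measurable [measurable]: "expdens \<in> borel_measurable borel"
  unfolding expdens_def[abs_def] by simp_all

lemma integrable_indicator_exp:
  assumes "0 < c" shows "integrable lborel (\<lambda>r. indicator {0..} r * exp (- (c * r)) :: real)"
  using integrable_norm[OF integrable_exp_Ici[of "- of_real c"]] assms
  by (simp add: mult.commute norm_exp_eq_Re)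

lemma integrable_expdens: "integrable lborel expdens"
  using integrable_indicator_exp[of 1] by (simp add: expdens_def[abs_def])

lemma integral_indicator_exp:
  assumes "0 < c" "0 \<le> Re z"
  shows "integrable lborel (\<lambda>r. of_real (indicator {0..} r * exp (- (c * r))) * cexp z (max 0 r))"
    and "(\<integral>r. of_real (indicator {0..} r * exp (- (c * r))) * cexp z (max 0 r) \<partial>lborel) = 1 / (of_real c + z)"
proof -
  have eq: "complex_of_real (indicator {0..} r * exp (- (c * r))) = indicator {0..} r *\<^sub>R exp (of_real r * (- of_real c))" for r
    by (simp add: scaleR_conv_of_real exp_of_real[symmetric] mult.commute indicator_def)
  show "integrable lborel (\<lambda>r. of_real (indicator {0..} r * exp (- (c * r))) * cexp z (max 0 r))"
    unfolding eq by (intro integrable_mult_BC integrable_exp_Ici cexp_BC) (use assms in auto)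
  show "(\<integral>r. of_real (indicator {0..} r * exp (- (c * r))) * cexp z (max 0 r) \<partial>lborel) = 1 / (of_real c + z)"
    unfolding eq using resolvent_fun_cexp[of "- of_real c" z] assms by (simp add: resolvent_fun_def add.commute)
qed

text \<open>The density of the regulariser e(z) = 1/(1+z) - 1/(2+z) = 1/((1+z)(2+z)).\<close>
definition regdens :: "real \<Rightarrow> real" where
  "regdens r = indicator {0..} r * (exp (- r) - exp (- (2 * r)))"

lemma regdens_measurable [measurable]: "regdens \<in> borel_measurable borel"
  unfolding regdens_def[abs_def] by measurable

lemma regdens_nonneg: "0 \<le> regdens r"
  by (auto simp: regdens_def indicator_def)

lemma regdens_transform:
  assumes "0 \<le> Re z"
  shows "integrable lborel (\<lambda>r. of_real (regdens r) * cexp z (max 0 r))"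
    and "(\<integral>r. of_real (regdens r) * cexp z (max 0 r) \<partial>lborel) = 1 / (1 + z) - 1 / (2 + z)"
proof -
  have eq: "of_real (regdens r) * cexp z (max 0 r) = of_real (indicator {0..} r * exp (- (1 * r))) * cexp z (max 0 r)
      - of_real (indicator {0..} r * exp (- (2 * r))) * cexp z (max 0 r)" for r
    by (simp add: regdens_def algebra_simps)
  note i = integral_indicator_exp[OF _ assms, of 1] integral_indicator_exp[OF _ assms, of 2]
  show "integrable lborel (\<lambda>r. of_real (regdens r) * cexp z (max 0 r))"
    unfolding eq by (rule Bochner_Integration.integrable_diff) (use i in auto)
  show "(\<integral>r. of_real (regdens r) * cexp z (max 0 r) \<partial>lborel) = 1 / (1 + z) - 1 / (2 + z)"
    unfolding eq by (subst Bochner_Integration.integral_diff) (use i in auto)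
qed

lemma integrable_regdens: "integrable lborel regdens"
proof -
  have "complex_integrable lborel (\<lambda>r. of_real (regdens r))"
    using regdens_transform(1)[of 0] by (simp add: cexp_def)
  then show ?thesis by (simp add: complex_of_real_integrable_eq)
qed

text \<open>The density with transform (1 - e^(-sz)) e(z); integrating it over \<mu>(ds) produces
  the integral part of e g.\<close>

definition shiftdiff :: "real \<Rightarrow> real \<Rightarrow> real" where
  "shiftdiff s r = regdens r - regdens (r - s)"

lemma shiftdiff_transform:
  assumes s: "0 \<le> s" and z: "0 \<le> Re z"
  shows "integrable lborel (\<lambda>r. of_real (shiftdiff s r) * cexp z (max 0 r))"
    and "(\<integral>r. of_real (shiftdiff s r) * cexp z (max 0 r) \<partial>lborel) = (1 - cexp z s) * (1 / (1 + z) - 1 / (2 + z))"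
proof -
  have eq1: "of_real (regdens (r - s)) * cexp z (max 0 r) = cexp z s * (of_real (regdens (- s + 1 * r)) * cexp z (max 0 (- s + 1 * r)))" for r
  proof (cases "r < s")
    case True then show ?thesis by (simp add: regdens_def)
  next
    case False
    then have "cexp z (max 0 r) = cexp z s * cexp z (max 0 (- s + 1 * r))"
      using s by (simp flip: cexp_add)
    then show ?thesis by (simp add: mult.left_commute)
  qed
  have i1: "integrable lborel (\<lambda>r. of_real (regdens (r - s)) * cexp z (max 0 r))"
    unfolding eq1 by (intro integrable_mult_right lborel_integrable_real_affine[OF regdens_transform(1)[OF z]]) simp
  have v1: "(\<integral>r. of_real (regdens (r - s)) * cexp z (max 0 r) \<partial>lborel) = cexp z s * (1 / (1 + z) - 1 / (2 + z))"
    unfolding eq1 using lborel_integral_real_affine[of 1 "\<lambda>r. of_real (regdens r) * cexp z (max 0 r)" "-s"] regdens_transform(2)[OF z]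
    by simp
  have eq2: "of_real (shiftdiff s r) * cexp z (max 0 r) = of_real (regdens r) * cexp z (max 0 r) - of_real (regdens (r - s)) * cexp z (max 0 r)" for r
    by (simp add: shiftdiff_def algebra_simps)
  show "integrable lborel (\<lambda>r. of_real (shiftdiff s r) * cexp z (max 0 r))"
    unfolding eq2 by (rule Bochner_Integration.integrable_diff[OF regdens_transform(1)[OF z] i1])
  show "(\<integral>r. of_real (shiftdiff s r) * cexp z (max 0 r) \<partial>lborel) = (1 - cexp z s) * (1 / (1 + z) - 1 / (2 + z))"
    unfolding eq2 Bochner_Integration.integral_diff[OF regdens_transform(1)[OF z] i1] v1 regdens_transform(2)[OF z]
    by (simp only: left_diff_distrib mult_1_left)
qed

text \<open>The density of e starts at 0 without a jump, so translating it by s changes it by order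
  s pointwise. For r \<ge> s the constant is (2 + 1) e^2, from e^x - 1 \<le> x e^x at x = 2s and x =
  s, both at most 2; for r < s it suffices that 1 - e^-r \<le> r.\<close>

lemma shiftdiff_bound:
  assumes "0 < s" "s \<le> 1"
  shows "\<bar>shiftdiff s r\<bar> \<le> 3 * exp 2 * s * expdens r"
proof -
  consider "r < 0" | "0 \<le> r" "r < s" | "s \<le> r" "0 \<le> r" using assms by linarith
  then show ?thesis
  proof cases
    case 1 then show ?thesis using assms by (simp add: shiftdiff_def regdens_def expdens_def)
  next
    case 2
    have "\<bar>shiftdiff s r\<bar> = exp (- r) * (1 - exp (- r))"
      using 2 by (simp add: shiftdiff_def regdens_def right_diff_distrib exp_add[symmetric])
    also have "\<dots> \<le> exp (- r) * s" using 2 exp_ge_add_one_self[of "- r"] by (intro mult_left_mono) auto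
    also have "\<dots> \<le> exp (- r) * (3 * exp 2 * s)"
    proof (rule mult_left_mono)
      have "1 \<le> exp (2::real)" by simp
      then have "1 * s \<le> 3 * exp 2 * s" using assms by (intro mult_right_mono) linarith+
      then show "s \<le> 3 * exp 2 * s" by simp
    qed simp
    finally show ?thesis using 2 by (simp add: expdens_def mult_ac)
  next
    case 3
    have e: "exp x - 1 \<le> x * exp x" for x :: real
      using exp_ge_add_one_self[of "- x"] mult_right_mono[of "1 - x" "exp (- x)" "exp x"]
      by (simp add: exp_minus_inverse left_diff_distrib exp_add[symmetric])
    have r2: "exp (- (2 * r)) \<le> exp (- r)" using 3 by simp
    have "exp s \<le> exp 2" "exp (2 * s) \<le> exp 2" using assms by simp_all
    then have e1: "exp s - 1 \<le> s * exp 2" and e2: "exp (2 * s) - 1 \<le> 2 * s * exp 2"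
      using e[of s] e[of "2 * s"] mult_left_mono[of "exp s" "exp 2" s] mult_left_mono[of "exp (2 * s)" "exp 2" "2 * s"] assms
      by linarith+
    have "shiftdiff s r = exp (- (2 * r)) * (exp (2 * s) - 1) - exp (- r) * (exp s - 1)"
      using 3 by (simp add: shiftdiff_def regdens_def algebra_simps exp_add[symmetric])
    also have "\<bar>\<dots>\<bar> \<le> exp (- (2 * r)) * (exp (2 * s) - 1) + exp (- r) * (exp s - 1)"
      using assms by (simp add: abs_le_iff)
    also have "\<dots> \<le> exp (- r) * (2 * s * exp 2) + exp (- r) * (s * exp 2)"
      using e1 e2 r2 assms by (intro add_mono mult_mono) auto
    also have "\<dots> = 3 * exp 2 * s * expdens r" using 3 by (simp add: expdens_def)
    finally show ?thesis .
  qed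
qed

text \<open>For s \<le> 1 integrate the pointwise bound; for larger s use that the density and its
  translate have mass 1/2 each. The resulting multiple of min(s,1) is what Fubini needs.\<close>

lemma integral_abs_shiftdiff:
  assumes s: "0 < s"
  shows "(\<integral>r. \<bar>shiftdiff s r\<bar> \<partial>lborel) \<le> 3 * exp 2 * clamp01 s"
proof -
  have i0: "integrable lborel (\<lambda>r. regdens (r - s))"
    using lborel_integrable_real_affine[OF integrable_regdens, of 1 "- s"] by simp
  have i: "integrable lborel (shiftdiff s)"
    unfolding shiftdiff_def[abs_def] by (rule Bochner_Integration.integrable_diff[OF integrable_regdens i0])
  show ?thesis
  proof (cases "s \<le> 1")
    case True
    have "(\<integral>r. expdens r \<partial>lborel) = 1"
    proof -
      have "complex_of_real (\<integral>r. expdens r \<partial>lborel) = (\<integral>r. of_real (expdens r) \<partial>lborel)" by simp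
      also have "\<dots> = 1 / (of_real 1 + 0)"
      proof -
        have "0 \<le> Re 0" by simp
        from integral_indicator_exp(2)[OF zero_less_one this] show ?thesis
          by (simp only: cexp_zero mult_1_left mult_1_right expdens_def)
      qed
      finally show ?thesis by simp
    qed
    moreover have "(\<integral>r. \<bar>shiftdiff s r\<bar> \<partial>lborel) \<le> (\<integral>r. 3 * exp 2 * s * expdens r \<partial>lborel)"
      by (rule integral_mono[OF integrable_abs[OF i] integrable_mult_right[OF integrable_expdens] shiftdiff_bound[OF s True]])
    ultimately show ?thesis using True s by (simp add: clamp01_def)
  next
    case False
    have v: "(\<integral>r. regdens r \<partial>lborel) = 1/2"
    proof -
      have "complex_of_real (\<integral>r. regdens r \<partial>lborel) = 1/2"
        using regdens_transform(2)[of 0] by (simp add: cexp_def)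
      then show ?thesis by (metis of_real_eq_iff of_real_divide of_real_1 of_real_numeral)
    qed
    have "(\<integral>r. \<bar>shiftdiff s r\<bar> \<partial>lborel) \<le> (\<integral>r. regdens r + regdens (r - s) \<partial>lborel)"
      by (rule integral_mono[OF integrable_abs[OF i] Bochner_Integration.integrable_add[OF integrable_regdens i0]])
        (use regdens_nonneg[of "r - s" for r] regdens_nonneg in \<open>auto simp: shiftdiff_def abs_le_iff\<close>)
    also have "\<dots> = 1"
      using lborel_integral_real_affine[of 1 regdens "- s"] integrable_regdens i0 v by simp
    also have "1 \<le> 3 * exp 2 * clamp01 s"
    proof -
      have "1 \<le> exp (2::real)" by simp
      then have "1 \<le> 3 * exp (2::real)" by linarith
      then show ?thesis using False by (simp add: clamp01_def)
    qed
    finally show ?thesis .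
  qed
qed

lemma shiftdiff_Fubini:
  assumes t: "bernstein_triple a b \<mu>" and z: "0 \<le> Re z"
  shows "integrable lborel (\<lambda>r. \<integral>s. of_real (shiftdiff s r) * cexp z (max 0 r) \<partial>\<mu>)"
    and "(\<integral>r. (\<integral>s. of_real (shiftdiff s r) * cexp z (max 0 r) \<partial>\<mu>) \<partial>lborel)
      = (\<integral>s. (1 - exp (- (of_real s * z))) \<partial>\<mu>) * (1 / (1 + z) - 1 / (2 + z))"
proof -
  have s: "sets \<mu> = sets borel" by (rule bernstein_sets[OF t])
  interpret M: sigma_finite_measure \<mu> by (rule bernstein_sigma_finite[OF t])
  interpret pair_sigma_finite \<mu> lborel ..
  define F where "F s r = of_real (shiftdiff s r) * cexp z (max 0 r)" for s r
  have F_meas: "case_prod F \<in> borel_measurable (\<mu> \<Otimes>\<^sub>M lborel)"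
  proof -
    have "sets (\<mu> \<Otimes>\<^sub>M (lborel :: real measure)) = sets (borel \<Otimes>\<^sub>M borel)"
      by (rule sets_pair_measure_cong[OF s]) simp
    moreover have "case_prod F \<in> borel_measurable (borel \<Otimes>\<^sub>M borel)"
      unfolding F_def shiftdiff_def cexp_def by measurable
    ultimately show ?thesis by (subst measurable_cong_sets[OF _ refl])
  qed
  have nb: "cmod (F s r) \<le> \<bar>shiftdiff s r\<bar>" for s r
    using norm_cexp_le_1[OF z, of "max 0 r"] mult_left_mono[of "cmod (cexp z (max 0 r))" 1 "\<bar>shiftdiff s r\<bar>"]
    by (simp add: F_def norm_mult)
  have intF: "integrable (\<mu> \<Otimes>\<^sub>M lborel) (case_prod F)"
  proof (rule Fubini_integrable[OF F_meas])
    show "AE s in \<mu>. integrable lborel (\<lambda>r. case_prod F (s, r))"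
      using bernstein_AE_pos[OF t] by eventually_elim (simp add: F_def shiftdiff_transform(1)[OF _ z])
    have m: "(\<lambda>s. \<integral>r. cmod (case_prod F (s, r)) \<partial>lborel) \<in> borel_measurable \<mu>"
      by (rule lborel.borel_measurable_lebesgue_integral) (use F_meas in measurable)
    show "integrable \<mu> (\<lambda>s. \<integral>r. cmod (case_prod F (s, r)) \<partial>lborel)"
    proof (rule Bochner_Integration.integrable_bound[OF integrable_mult_right[OF bernstein_integrable_clamp[OF t], of "3 * exp 2"] m])
      show "AE s in \<mu>. norm (\<integral>r. cmod (case_prod F (s, r)) \<partial>lborel) \<le> norm (3 * exp 2 * clamp01 s)"
        using bernstein_AE_pos[OF t]
      proof eventually_elim
        fix s :: real assume s: "0 < s"
        have i: "integrable lborel (shiftdiff s)"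
        proof -
          have "complex_integrable lborel (\<lambda>r. of_real (shiftdiff s r))"
            using shiftdiff_transform(1)[of s 0] s by (simp add: cexp_def)
          then show ?thesis by (simp add: complex_of_real_integrable_eq)
        qed
        have "(\<integral>r. cmod (F s r) \<partial>lborel) \<le> (\<integral>r. \<bar>shiftdiff s r\<bar> \<partial>lborel)"
          by (rule integral_mono[OF integrable_norm integrable_abs[OF i] nb])
            (use s shiftdiff_transform(1)[OF _ z, of s] in \<open>simp add: F_def\<close>)
        also have "\<dots> \<le> 3 * exp 2 * clamp01 s" by (rule integral_abs_shiftdiff[OF s])
        finally show "norm (\<integral>r. cmod (case_prod F (s, r)) \<partial>lborel) \<le> norm (3 * exp 2 * clamp01 s)"
          by (simp add: clamp01_def)
      qed
    qed
  qed
  show "integrable lborel (\<lambda>r. \<integral>s. of_real (shiftdiff s r) * cexp z (max 0 r) \<partial>\<mu>)"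
    using integrable_snd[OF intF] by (simp add: F_def)
  have "(\<integral>r. (\<integral>s. F s r \<partial>\<mu>) \<partial>lborel) = (\<integral>s. (\<integral>r. F s r \<partial>lborel) \<partial>\<mu>)"
    by (rule Fubini_integral[OF intF])
  also have "\<dots> = (\<integral>s. (1 - exp (- (of_real s * z))) * (1 / (1 + z) - 1 / (2 + z)) \<partial>\<mu>)"
  proof (rule integral_cong_AE)
    show "(\<lambda>s. \<integral>r. F s r \<partial>lborel) \<in> borel_measurable \<mu>" using integrable_fst[OF intF] by simp
    show "(\<lambda>s. (1 - exp (- (of_real s * z))) * (1 / (1 + z) - 1 / (2 + z))) \<in> borel_measurable \<mu>"
      by (subst measurable_cong_sets[OF s refl]) measurable
    show "AE s in \<mu>. (\<integral>r. F s r \<partial>lborel) = (1 - exp (- (of_real s * z))) * (1 / (1 + z) - 1 / (2 + z))"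
      using bernstein_AE_pos[OF t]
      by eventually_elim (simp add: F_def shiftdiff_transform(2)[OF _ z], simp add: cexp_def)
  qed
  finally show "(\<integral>r. (\<integral>s. of_real (shiftdiff s r) * cexp z (max 0 r) \<partial>\<mu>) \<partial>lborel)
      = (\<integral>s. (1 - exp (- (of_real s * z))) \<partial>\<mu>) * (1 / (1 + z) - 1 / (2 + z))"
    by (simp add: F_def)
qed

lemma bcm_expmI:
  assumes h: "h \<in> borel_measurable borel" and i: "integrable lborel (\<lambda>r. expdens r *\<^sub>R h r)"
  shows "bcm expm h"
proof -
  have "emeasure expm (space expm) = (\<integral>\<^sup>+ r. ennreal (expdens r) \<partial>lborel)"
    unfolding expm_def by (subst emeasure_density) auto
  also have "\<dots> = ennreal (\<integral>r. expdens r \<partial>lborel)"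
    by (rule nn_integral_eq_integral[OF integrable_expdens]) (simp add: expdens_nonneg)
  finally have "finite_measure expm" by (intro finite_measureI) simp
  moreover have "emeasure expm {..<0} = 0"
    unfolding expm_def by (subst emeasure_density) (auto simp: expdens_def indicator_def nn_integral_0_iff_AE)
  ultimately show ?thesis
    using h i unfolding bcm_def expm_def by (simp add: integrable_density expdens_nonneg)
qed

lemma laplace_expm:
  assumes "h \<in> borel_measurable borel"
  shows "laplace_bcm expm h z = (\<integral>r. (expdens r *\<^sub>R h r) * cexp z (max 0 r) \<partial>lborel)"
proof -
  have "laplace_bcm expm h z = (\<integral>r. expdens r *\<^sub>R (h r * exp (- (of_real r * z))) \<partial>lborel)"
    unfolding laplace_bcm_def expm_def
    by (rule integral_density) (use assms in \<open>auto simp: expdens_nonneg\<close>)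
  also have "\<dots> = (\<integral>r. (expdens r *\<^sub>R h r) * cexp z (max 0 r) \<partial>lborel)"
    by (rule Bochner_Integration.integral_cong) (auto simp: expdens_def cexp_def indicator_def)
  finally show ?thesis .
qed

definition reg1 :: "real \<Rightarrow> complex" where
  "reg1 r = of_real (1 - exp (- r))"

text \<open>The density of e g relative to e^-r dr. The b-term comes from z e(z) = 2/(2+z) -
  1/(1+z), which has no constant part, so no point mass at 0 is required.\<close>

definition reg2 :: "real \<Rightarrow> real \<Rightarrow> real measure \<Rightarrow> real \<Rightarrow> complex" where
  "reg2 a b \<mu> r = of_real (a * (1 - exp (- r)) + b * (2 * exp (- r) - 1)) +
     of_real (exp r) * (\<integral>s. of_real (shiftdiff s r) \<partial>\<mu>)"

lemma reg1_measurable: "reg1 \<in> borel_measurable borel"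
  unfolding reg1_def[abs_def] by measurable

lemma expdens_reg1: "expdens r *\<^sub>R reg1 r = of_real (regdens r)"
  by (simp add: expdens_def reg1_def regdens_def indicator_def scaleR_conv_of_real algebra_simps exp_add[symmetric]
      flip: of_real_mult)

lemma bcm_reg1: "bcm expm reg1"
  using regdens_transform(1)[of 0]
  by (intro bcm_expmI reg1_measurable) (simp add: expdens_reg1 cexp_def)

lemma laplace_reg1: "0 \<le> Re z \<Longrightarrow> laplace_bcm expm reg1 z = 1 / (1 + z) - 1 / (2 + z)"
  by (simp add: laplace_expm[OF reg1_measurable] expdens_reg1 regdens_transform)

lemma reg2_transform:
  assumes t: "bernstein_triple a b \<mu>" and z: "0 \<le> Re z"
  shows "reg2 a b \<mu> \<in> borel_measurable borel"
    and "integrable lborel (\<lambda>r. (expdens r *\<^sub>R reg2 a b \<mu> r) * cexp z (max 0 r))"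
    and "(\<integral>r. (expdens r *\<^sub>R reg2 a b \<mu> r) * cexp z (max 0 r) \<partial>lborel) = bern_fun a b \<mu> z * (1 / (1 + z) - 1 / (2 + z))"
proof -
  define m where "m r = (\<integral>s. complex_of_real (shiftdiff s r) \<partial>\<mu>)" for r
  have "integrable lborel m" using shiftdiff_Fubini(1)[OF t, of 0] by (simp add: cexp_def m_def[abs_def])
  then have m: "m \<in> borel_measurable borel" by simp
  show "reg2 a b \<mu> \<in> borel_measurable borel"
    using m unfolding reg2_def[abs_def] m_def[symmetric] by measurable
  \<comment> \<open>For \<mu>-almost every s, s is positive, so translating to the right creates no
    mass below 0; thus weighting by a density that vanishes there loses nothing.\<close>
  have m0: "m r = 0" if "r < 0" for r
  proof -
    have "m r = (\<integral>s. 0 \<partial>\<mu>)" unfolding m_def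
    proof (rule integral_cong_AE)
      show "(\<lambda>s. complex_of_real (shiftdiff s r)) \<in> borel_measurable \<mu>"
        unfolding shiftdiff_def by (subst measurable_cong_sets[OF bernstein_sets[OF t] refl]) measurable
      show "AE s in \<mu>. complex_of_real (shiftdiff s r) = 0"
        using bernstein_AE_pos[OF t] by eventually_elim (use that in \<open>simp add: shiftdiff_def regdens_def\<close>)
    qed simp
    then show ?thesis by simp
  qed
  let ?E = "\<lambda>c r. of_real (indicator {0..} r * exp (- (c * r))) * cexp z (max 0 r)"
  have eq: "(expdens r *\<^sub>R reg2 a b \<mu> r) * cexp z (max 0 r) =
      of_real a * (of_real (regdens r) * cexp z (max 0 r)) + of_real b * (2 * ?E 2 r - ?E 1 r)
      + (\<integral>s. of_real (shiftdiff s r) * cexp z (max 0 r) \<partial>\<mu>)" for r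
  proof (cases "r < 0")
    case True
    then show ?thesis using m0[OF True] by (simp add: expdens_def regdens_def m_def)
  next
    case False
    have e2: "exp (- (2 * r)) = exp (- r) * exp (- r)" by (simp add: exp_add[symmetric])
    have "exp (- r) * exp r = 1" by (simp add: exp_minus)
    then have e1: "complex_of_real (exp (- r)) * of_real (exp r) = 1" by (metis of_real_1 of_real_mult)
    have d: "expdens r = exp (- r)" "regdens r = exp (- r) - exp (- r) * exp (- r)"
      using False by (simp_all add: expdens_def regdens_def e2)
    have R: "reg2 a b \<mu> r = of_real (a * (1 - exp (- r)) + b * (2 * exp (- r) - 1)) + of_real (exp r) * m r"
      by (simp only: reg2_def m_def)
    have "expdens r *\<^sub>R reg2 a b \<mu> r = of_real a * of_real (regdens r)
        + of_real b * (2 * of_real (exp (- (2 * r))) - of_real (exp (- r))) + (of_real (exp (- r)) * of_real (exp r)) * m r"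
      unfolding R d e2 scaleR_conv_of_real of_real_add of_real_diff of_real_mult of_real_1 of_real_numeral
      by algebra
    then show ?thesis using False by (simp only: e1) (simp add: m_def algebra_simps)
  qed
  note i = regdens_transform(1)[OF z] integral_indicator_exp(1)[OF _ z, of 1] integral_indicator_exp(1)[OF _ z, of 2] shiftdiff_Fubini(1)[OF t z]
  have j: "integrable lborel (\<lambda>r. of_real b * (2 * ?E 2 r - ?E 1 r))" "integrable lborel (\<lambda>r. of_real a * (of_real (regdens r) * cexp z (max 0 r)))"
    by (intro integrable_mult_right Bochner_Integration.integrable_diff i; simp)+
  show "integrable lborel (\<lambda>r. (expdens r *\<^sub>R reg2 a b \<mu> r) * cexp z (max 0 r))"
    unfolding eq by (intro Bochner_Integration.integrable_add j i)
  have nz: "1 + z \<noteq> 0" "2 + z \<noteq> 0" using z by (auto simp: complex_eq_iff)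
  have b: "(\<integral>r. of_real b * (2 * ?E 2 r - ?E 1 r) \<partial>lborel) = of_real b * (2 * (1 / (2 + z)) - 1 / (1 + z))"
    using integral_indicator_exp[OF _ z, of 1] integral_indicator_exp[OF _ z, of 2] by simp
  have "(\<integral>r. (expdens r *\<^sub>R reg2 a b \<mu> r) * cexp z (max 0 r) \<partial>lborel)
      = of_real a * (1 / (1 + z) - 1 / (2 + z)) + of_real b * (2 * (1 / (2 + z)) - 1 / (1 + z))
       + (\<integral>s. (1 - exp (- (of_real s * z))) \<partial>\<mu>) * (1 / (1 + z) - 1 / (2 + z))"
    unfolding eq Bochner_Integration.integral_add[OF Bochner_Integration.integrable_add[OF j(2,1)] i(4)]
      Bochner_Integration.integral_add[OF j(2,1)] b shiftdiff_Fubini(2)[OF t z]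
    by (simp add: regdens_transform[OF z])
  moreover have "2 * (1 / (2 + z)) - 1 / (1 + z) = z * (1 / (1 + z) - 1 / (2 + z))"
    using nz by (simp add: field_simps)
  ultimately show "(\<integral>r. (expdens r *\<^sub>R reg2 a b \<mu> r) * cexp z (max 0 r) \<partial>lborel) = bern_fun a b \<mu> z * (1 / (1 + z) - 1 / (2 + z))"
    by (simp only: bern_fun_def distrib_right mult.assoc)
qed

lemma bcm_reg2:
  assumes t: "bernstein_triple a b \<mu>" shows "bcm expm (reg2 a b \<mu>)"
proof (rule bcm_expmI[OF reg2_transform(1)[OF t, of 0]])
  show "integrable lborel (\<lambda>r. expdens r *\<^sub>R reg2 a b \<mu> r)"
    using reg2_transform(2)[OF t, of 0] by (simp add: cexp_def)
qed simp

context semigroup_generator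
begin

lemma inj_rep_resolvent:
  assumes "Re w < 0" "rep (resolvent_fun w) V" shows "inj V"
proof (rule injI)
  fix x y assume eq: "V x = V y"
  note R = resolvent_left_half_plane(2)[OF assms]
  have "sc w (V y) + x = sc w (V y) + y" using R[of x] R[of y] unfolding eq by (rule subst)
  then show "x = y" by (rule add_left_imp_eq)
qed

text \<open>e(A) is the composition of the operators for w = -1 and w = -2. Each is injective,
  having A - w as a left inverse.\<close>

lemma regulariser_exists:
  assumes t: "bernstein_triple a b \<mu>"
  shows "\<exists>R. regulariser sc T (bern_fun a b \<mu>) R"
proof -
  let ?r = resolvent_fun
  have w: "Re (- 1) < 0" "Re (- 2) < 0" by simp_all
  note mf = measure_functional_resolvent[OF w(1)] measure_functional_resolvent[OF w(2)]
  obtain V where V: "rep (?r (- 1)) V" by (rule rep_exists[OF mf(1)])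
  obtain W where W: "rep (?r (- 2)) W" by (rule rep_exists[OF mf(2)])
  have "hp_op sc T expm reg1 = (\<lambda>x. V (W x))"
  proof (rule rep_unique[OF rep_hp_op[OF bcm_reg1] rep_conv[OF mf V W]])
    fix f assume "f \<in> BC"
    then show "bcm_fun expm reg1 f = conv (?r (- 1)) (?r (- 2)) f"
    proof (rule measure_functional_eqI[OF measure_functional_bcm[OF bcm_reg1] measure_functional_conv[OF mf], rotated])
      fix z :: real assume z: "0 < z"
      have nz: "1 + complex_of_real z \<noteq> 0" "2 + complex_of_real z \<noteq> 0" using z by (auto simp: complex_eq_iff)
      have "bcm_fun expm reg1 (cexp (of_real z)) = 1 / (1 + of_real z) - 1 / (2 + of_real z)"
        using laplace_bcm_eq[OF bcm_reg1, of "of_real z"] laplace_reg1[of "of_real z"] z by (simp add: bcm_fun_def)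
      also have "\<dots> = 1 / (of_real z - (- 1)) * (1 / (of_real z - (- 2)))"
        using nz by (simp add: field_simps)
      finally show "bcm_fun expm reg1 (cexp (of_real z)) = conv (?r (- 1)) (?r (- 2)) (cexp (of_real z))"
        using z by (simp add: conv_cexp mf resolvent_fun_cexp)
    qed
  qed
  then have "inj (hp_op sc T expm reg1)"
    using inj_compose[OF inj_rep_resolvent[OF w(1) V] inj_rep_resolvent[OF w(2) W]] by (simp add: comp_def)
  moreover have "laplace_bcm expm reg1 z * bern_fun a b \<mu> z = laplace_bcm expm (reg2 a b \<mu>) z" if "0 < Re z" for z
    using that reg2_transform(3)[OF t, of z] laplace_expm[OF reg2_transform(1)[OF t, of 0], of z]
    by (simp add: laplace_reg1)
  ultimately have "regulariser sc T (bern_fun a b \<mu>) (expm, reg1, expm, reg2 a b \<mu>)"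
    by (simp add: regulariser_def bcm_reg1 bcm_reg2[OF t])
  then show ?thesis by blast
qed

end

section \<open>Lower bounds for special Bernstein functions\<close>

lemma norm_one_minus_cexp:
  assumes "0 \<le> Re z" "0 \<le> s" shows "cmod (1 - cexp z s) \<le> 2 * min (s * cmod z) 1"
proof -
  have "cmod (1 - cexp z s) \<le> 2"
    using norm_triangle_ineq4[of 1 "cexp z s"] norm_cexp_le_1[OF assms] by simp
  moreover have "cmod (1 - cexp z s) \<le> s * cmod z"
  proof (cases "z = 0")
    case False
    then have "1 - cexp z s = z * ifun s (cexp z)" using assms by (simp add: ifun_cexp)
    moreover have "cmod (ifun s (cexp z)) \<le> 1 * s"
      by (rule norm_ifun_le) (use assms in \<open>auto simp: norm_cexp_le_1\<close>)
    ultimately show ?thesis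
      using mult_left_mono[of "cmod (ifun s (cexp z))" s "cmod z"] by (simp add: norm_mult mult.commute)
  qed (simp add: cexp_zero)
  moreover have "0 \<le> s * cmod z" using assms by simp
  ultimately show ?thesis by (auto simp: min_def)
qed

lemma one_minus_exp_ge:
  assumes "0 \<le> (u::real)" shows "min u 1 \<le> 2 * (1 - exp (- u))"
proof -
  have "min u 1 \<le> 2 * (1 - 1 / (1 + u))"
    using assms mult_left_le[of u u] by (auto simp: min_def field_simps)
  also have "exp (- u) \<le> 1 / (1 + u)"
    using exp_ge_add_one_self[of u] assms by (simp add: exp_minus field_simps)
  then have "2 * (1 - 1 / (1 + u)) \<le> 2 * (1 - exp (- u))" by simp
  finally show ?thesis .
qed

text \<open>For |w| \<le> 1/4 the Taylor remainder is at most (4/3)(1/4)|w| = |w|/3. Applied to both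
  z and tz in the final argument, this dictates t = 1/(4|z|).\<close>

lemma norm_one_minus_exp_ge:
  fixes w :: complex
  assumes "cmod w \<le> 1/4" shows "cmod w / 2 \<le> cmod (1 - exp (- w))"
proof -
  have "cmod (exp (- w) - (\<Sum>i\<le>1. (- w) ^ i / fact i)) \<le> exp (cmod (- w)) * cmod (- w) ^ Suc 1 / fact 1"
    by (rule Taylor_exp_field)
  then have 1: "cmod (exp (- w) - (1 - w)) \<le> exp (cmod w) * (cmod w * cmod w)"
    by (simp add: numeral_2_eq_2[symmetric] power2_eq_square)
  have "exp (cmod w) \<le> exp (1/4)" using assms by simp
  moreover have "exp (1/4::real) \<le> 4/3"
    using exp_ge_add_one_self[of "-1/4::real"] by (simp add: exp_minus field_simps)
  ultimately have "exp (cmod w) \<le> 4/3" by linarith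
  from mult_mono[OF this mult_left_mono[OF assms, of "cmod w"]]
  have "exp (cmod w) * (cmod w * cmod w) \<le> 4/3 * (cmod w * (1/4))" by simp
  with 1 have "cmod (exp (- w) - (1 - w)) \<le> cmod w / 3" by simp
  moreover have "cmod w \<le> cmod (1 - exp (- w)) + cmod (exp (- w) - (1 - w))"
    using norm_triangle_ineq[of "1 - exp (- w)" "exp (- w) - (1 - w)"] by simp
  ultimately show ?thesis using norm_ge_zero[of w] by linarith
qed

lemma integrable_min:
  assumes t: "bernstein_triple a b \<mu>" and x: "0 < x"
  shows "integrable \<mu> (\<lambda>s. min (s * x) 1)"
proof (rule Bochner_Integration.integrable_bound[OF integrable_mult_right[OF bernstein_integrable_clamp[OF t], of "1 + x"]])
  show "(\<lambda>s. min (s * x) 1) \<in> borel_measurable \<mu>"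
    by (subst measurable_cong_sets[OF bernstein_sets[OF t] refl]) measurable
  show "AE s in \<mu>. norm (min (s * x) 1) \<le> norm ((1 + x) * clamp01 s)"
    using bernstein_AE_pos[OF t]
  proof eventually_elim
    fix s :: real assume s: "0 < s"
    have "0 \<le> min (s * x) 1" using s x by simp
    moreover have "min (s * x) 1 \<le> (1 + x) * clamp01 s"
    proof (cases "s \<le> 1")
      case True
      have "min (s * x) 1 \<le> s * x" by simp
      also have "\<dots> \<le> (1 + x) * s" using s by (simp add: algebra_simps)
      finally show ?thesis using True s by (simp add: clamp01_def)
    next
      case False
      have "min (s * x) 1 \<le> 1" by simp
      also have "1 \<le> 1 + x" using x by simp
      finally show ?thesis using False by (simp add: clamp01_def)
    qed
    ultimately show "norm (min (s * x) 1) \<le> norm ((1 + x) * clamp01 s)" by simp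
  qed
qed

lemma rate_antimono:
  assumes t: "bernstein_triple a b \<mu>" and "0 < s" "s \<le> t"
  shows "rate_fun a b \<mu> t \<le> rate_fun a b \<mu> s"
proof -
  have "(\<integral>u. min (u / t) 1 \<partial>\<mu>) \<le> (\<integral>u. min (u / s) 1 \<partial>\<mu>)"
  proof (rule integral_mono_AE)
    show "AE u in \<mu>. min (u / t) 1 \<le> min (u / s) 1"
      using bernstein_AE_pos[OF t]
      by eventually_elim (intro min.mono divide_left_mono; use assms in simp)
  qed (use integrable_min[OF t, of "1 / t"] integrable_min[OF t, of "1 / s"] assms in simp_all)
  moreover have "b / t \<le> b / s" using assms by (intro divide_left_mono) (auto simp: bernstein_triple_def)
  ultimately show ?thesis by (simp add: rate_fun_def)
qed

text \<open>Pays for the gap between t = 1/(4|z|) and the point 1/|z| at which |g(z)| is compared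
  with r; it rests on min(v,1) \<le> 4 min(v/4,1).\<close>

lemma rate_scale:
  assumes t: "bernstein_triple a b \<mu>" and "0 < t"
  shows "rate_fun a b \<mu> t \<le> 4 * rate_fun a b \<mu> (4 * t)"
proof -
  have "(\<integral>u. min (u / t) 1 \<partial>\<mu>) \<le> (\<integral>u. 4 * min (u / (4 * t)) 1 \<partial>\<mu>)"
  proof (rule integral_mono_AE)
    show "AE u in \<mu>. min (u / t) 1 \<le> 4 * min (u / (4 * t)) 1"
    proof (rule AE_I2)
      fix u :: real
      have "u / (4 * t) = (u / t) / 4" by simp
      then show "min (u / t) 1 \<le> 4 * min (u / (4 * t)) 1" by (simp only: min_def) auto
    qed
  qed (use integrable_min[OF t, of "1 / t"] integrable_min[OF t, of "1 / (4 * t)"] assms in simp_all)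
  moreover have "0 \<le> a" using t by (simp add: bernstein_triple_def)
  ultimately show ?thesis by (simp add: rate_fun_def)
qed

lemma bern_fun_upper:
  assumes t: "bernstein_triple a b \<mu>" and z: "0 \<le> Re z" "z \<noteq> 0"
  shows "cmod (bern_fun a b \<mu> z) \<le> a + b * cmod z + 2 * (\<integral>s. min (s * cmod z) 1 \<partial>\<mu>)"
proof -
  have ab: "0 \<le> a" "0 \<le> b" using t by (auto simp: bernstein_triple_def)
  have m: "(\<lambda>s. 1 - exp (- (of_real s * z))) \<in> borel_measurable \<mu>"
    by (subst measurable_cong_sets[OF bernstein_sets[OF t] refl]) measurable
  have i: "integrable \<mu> (\<lambda>s. 2 * min (s * cmod z) 1)"
    using integrable_min[OF t, of "cmod z"] z by simp
  have AE: "AE s in \<mu>. cmod (1 - exp (- (of_real s * z))) \<le> 2 * min (s * cmod z) 1"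
    using bernstein_AE_pos[OF t]
    by eventually_elim (use norm_one_minus_cexp[OF z(1)] in \<open>simp add: cexp_def\<close>)
  have i2: "integrable \<mu> (\<lambda>s. 1 - exp (- (of_real s * z)))"
    by (rule Bochner_Integration.integrable_bound[OF i m], use AE in eventually_elim, simp)
  have "cmod (\<integral>s. (1 - exp (- (of_real s * z))) \<partial>\<mu>) \<le> (\<integral>s. cmod (1 - exp (- (of_real s * z))) \<partial>\<mu>)"
    by (rule integral_norm_bound)
  also have "\<dots> \<le> (\<integral>s. 2 * min (s * cmod z) 1 \<partial>\<mu>)"
    by (rule integral_mono_AE[OF integrable_norm[OF i2] i AE])
  finally have "cmod (\<integral>s. (1 - exp (- (of_real s * z))) \<partial>\<mu>) \<le> 2 * (\<integral>s. min (s * cmod z) 1 \<partial>\<mu>)" by simp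
  moreover have "cmod (of_real a + of_real b * z) \<le> a + b * cmod z"
    using norm_triangle_ineq[of "of_real a" "of_real b * z"] ab by (simp add: norm_mult)
  ultimately show ?thesis
    unfolding bern_fun_def
    using norm_triangle_ineq[of "of_real a + of_real b * z" "\<integral>s. (1 - exp (- (of_real s * z))) \<partial>\<mu>"] by linarith
qed

lemma bern_fun_lower:
  assumes t: "bernstein_triple a b \<mu>" and x: "0 < x"
  shows "a + b * x + (\<integral>s. min (s * x) 1 \<partial>\<mu>) / 2 \<le> cmod (bern_fun a b \<mu> (of_real x))"
proof -
  have i: "integrable \<mu> (\<lambda>s. 1 - exp (- (s * x)))"
  proof (rule Bochner_Integration.integrable_bound[OF integrable_mult_right[OF integrable_min[OF t x], of 2]])
    show "(\<lambda>s. 1 - exp (- (s * x))) \<in> borel_measurable \<mu>"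
      by (subst measurable_cong_sets[OF bernstein_sets[OF t] refl]) measurable
    show "AE s in \<mu>. norm (1 - exp (- (s * x))) \<le> norm (2 * min (s * x) 1)"
      using bernstein_AE_pos[OF t]
    proof eventually_elim
      fix s :: real assume s: "0 < s"
      have "1 - cexp (of_real x) s = of_real (1 - exp (- (s * x)))"
        by (simp add: cexp_def exp_of_real[symmetric])
      then have "cmod (1 - cexp (of_real x) s) = norm (1 - exp (- (s * x)))"
        by (simp only: norm_of_real real_norm_def)
      then show "norm (1 - exp (- (s * x))) \<le> norm (2 * min (s * x) 1)"
        using norm_one_minus_cexp[of "of_real x" s] s x by simp
    qed
  qed
  have "(\<integral>s. (1 - exp (- (complex_of_real s * of_real x))) \<partial>\<mu>) = (\<integral>s. of_real (1 - exp (- (s * x))) \<partial>\<mu>)"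
    by (simp add: exp_of_real[symmetric])
  also have "\<dots> = of_real (\<integral>s. 1 - exp (- (s * x)) \<partial>\<mu>)" by (rule integral_complex_of_real)
  finally have "bern_fun a b \<mu> (of_real x) = of_real (a + b * x + (\<integral>s. 1 - exp (- (s * x)) \<partial>\<mu>))"
    by (simp add: bern_fun_def)
  then have "a + b * x + (\<integral>s. 1 - exp (- (s * x)) \<partial>\<mu>) \<le> cmod (bern_fun a b \<mu> (of_real x))"
    by (simp only: norm_of_real)
  moreover
  have "(\<integral>s. min (s * x) 1 \<partial>\<mu>) \<le> (\<integral>s. 2 * (1 - exp (- (s * x))) \<partial>\<mu>)"
    by (rule integral_mono_AE[OF integrable_min[OF t x] integrable_mult_right[OF i]],
        use bernstein_AE_pos[OF t] in eventually_elim, rule one_minus_exp_ge) (use x in simp)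
  then have "(\<integral>s. min (s * x) 1 \<partial>\<mu>) \<le> 2 * (\<integral>s. 1 - exp (- (s * x)) \<partial>\<mu>)"
    by (simp only: integral_mult_right_zero)
  ultimately show ?thesis by linarith
qed

lemma rate_le_bern_fun:
  assumes t: "bernstein_triple a b \<mu>" and x: "0 < x"
  shows "rate_fun a b \<mu> (1 / x) \<le> 2 * cmod (bern_fun a b \<mu> (of_real x))"
proof -
  have "rate_fun a b \<mu> (1 / x) = a / 2 + b * x + (\<integral>s. min (s * x) 1 \<partial>\<mu>)" by (simp add: rate_fun_def)
  moreover have "0 \<le> a" "0 \<le> b * x" using t x by (auto simp: bernstein_triple_def)
  ultimately show ?thesis using bern_fun_lower[OF t x] by linarith
qed

text \<open>Both sides are compared with a + b|z| + \<integral> min(s|z|,1) \<mu>(ds): the integral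
  enters above with factor 2 and below with 1/2, hence 4.\<close>

lemma bern_fun_le_modulus:
  assumes t: "bernstein_triple a b \<mu>" and z: "0 \<le> Re z" "z \<noteq> 0"
  shows "cmod (bern_fun a b \<mu> z) \<le> 4 * cmod (bern_fun a b \<mu> (of_real (cmod z)))"
proof -
  have "0 \<le> a" "0 \<le> b * cmod z" using t by (auto simp: bernstein_triple_def)
  then show ?thesis using bern_fun_upper[OF t z] bern_fun_lower[OF t, of "cmod z"] z(2) by simp
qed

text \<open>The identity g(z) h(z) = z extends from the positive half-line by uniqueness of Laplace
transforms instead of analytic continuation.\<close>
lemma bern_fun_conjugate:
  assumes g: "bernstein_triple a b \<mu>" and h: "bernstein_triple a' b' \<mu>'"
    and gh: "\<And>x. 0 < x \<Longrightarrow> bern_fun a b \<mu> (of_real x) * bern_fun a' b' \<mu>' (of_real x) = of_real x"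
    and z: "0 \<le> Re z" "z \<noteq> 0" "cmod z \<le> 1/4"
  shows "bern_fun a b \<mu> z * bern_fun a' b' \<mu>' z = z"
proof -
  let ?U = "ifun 1" and ?B = "bern_functional a b \<mu>" and ?B' = "bern_functional a' b' \<mu>'"
  let ?D = "\<lambda>f :: real \<Rightarrow> complex. f 0 - f 1"
  note U = measure_functional_ifun[of 1] and B = measure_functional_bern[OF g] and B' = measure_functional_bern[OF h]
  have D: "measure_functional ?D" by (intro measure_functional_diff measure_functional_point) simp_all
  have Dc: "?D (cexp w) = w * ?U (cexp w)" if "w \<noteq> 0" for w using that by (simp add: ifun_cexp)
  \<comment> \<open>With c(z) = (1 - e^-z)/z, both sides have transform z c(z)^2 on the positive
    reals: the left as (gc)(hc), the right as (zc)c.\<close>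
  have "conv ?B ?B' (cexp z) = conv ?D ?U (cexp z)"
  proof (rule measure_functional_eqI[OF measure_functional_conv[OF B B'] measure_functional_conv[OF D U] _ cexp_BC[OF z(1)]])
    fix x :: real assume x: "0 < x"
    then have "conv ?B ?B' (cexp (of_real x)) = (bern_fun a b \<mu> (of_real x) * bern_fun a' b' \<mu>' (of_real x)) * (?U (cexp (of_real x)) * ?U (cexp (of_real x)))"
      by (simp add: conv_cexp[OF B B'] bern_functional_cexp[OF g] bern_functional_cexp[OF h] mult_ac)
    also have "\<dots> = conv ?D ?U (cexp (of_real x))"
      using x by (simp add: gh conv_cexp[OF D U] Dc del: cexp_0)
    finally show "conv ?B ?B' (cexp (of_real x)) = conv ?D ?U (cexp (of_real x))" .
  qed
  then have "(bern_fun a b \<mu> z * bern_fun a' b' \<mu>' z) * (?U (cexp z) * ?U (cexp z)) = z * (?U (cexp z) * ?U (cexp z))"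
    using z by (simp add: conv_cexp[OF B B'] conv_cexp[OF D U] bern_functional_cexp[OF g] bern_functional_cexp[OF h] Dc mult_ac del: cexp_0)
  \<comment> \<open>c has zeros on the imaginary axis; |z| \<le> 1/4 stays clear of them, so c(z)^2
    may be cancelled.\<close>
  moreover have "?U (cexp z) \<noteq> 0"
    using norm_one_minus_exp_ge[OF z(3)] z(2) by (auto simp: ifun_cexp cexp_def)
  ultimately show ?thesis by simp
qed

text \<open>Specialness turns an upper bound into a lower one: g(|z|) h(|z|) = |z| = |g(z)| |h(z)|
  \<le> 4 |g(z)| h(|z|), so |g(z)| \<ge> g(|z|)/4. The remaining factor 2 is that of
  \<open>rate_le_bern_fun\<close>.\<close>

lemma special_bern_fun_ge:
  assumes sp: "special_bernstein a b \<mu>" and pos: "\<And>t. 0 < t \<Longrightarrow> 0 < rate_fun a b \<mu> t"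
    and z: "0 \<le> Re z" "z \<noteq> 0" "cmod z \<le> 1/4"
  shows "rate_fun a b \<mu> (1 / cmod z) \<le> 8 * cmod (bern_fun a b \<mu> z)"
proof -
  have g: "bernstein_triple a b \<mu>" using sp by (simp add: special_bernstein_def)
  obtain a' b' \<mu>' where h: "bernstein_triple a' b' \<mu>'"
    and gh': "\<And>x. 0 < x \<Longrightarrow> of_real x / bern_fun a b \<mu> (of_real x) = bern_fun a' b' \<mu>' (of_real x)"
    using sp unfolding special_bernstein_def by blast
  have g0: "bern_fun a b \<mu> (of_real x) \<noteq> 0" if "0 < x" for x
    using rate_le_bern_fun[OF g that] pos[of "1 / x"] that by auto
  have gh: "bern_fun a b \<mu> (of_real x) * bern_fun a' b' \<mu>' (of_real x) = of_real x" if "0 < x" for x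
    using g0[OF that] by (simp flip: gh'[OF that])
  let ?g = "\<lambda>z. cmod (bern_fun a b \<mu> z)" and ?h = "\<lambda>z. cmod (bern_fun a' b' \<mu>' z)" and ?x = "of_real (cmod z)"
  have x: "0 < cmod z" using z by simp
  have 1: "?g z * ?h z = cmod z" using bern_fun_conjugate[OF g h gh z] by (simp flip: norm_mult)
  have 2: "?g ?x * ?h ?x = cmod z" using arg_cong[OF gh[OF x], of cmod] by (simp add: norm_mult)
  have h0: "0 < ?h ?x" using 2 x by (metis less_irrefl mult_zero_right norm_ge_zero order_less_le)
  have "?g ?x * ?h ?x = ?g z * ?h z" using 1 2 by (rule trans[OF _ sym, rotated])
  also have "\<dots> \<le> ?g z * (4 * ?h ?x)"
    by (rule mult_left_mono[OF bern_fun_le_modulus[OF h z(1,2)]]) simp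
  finally have "?g ?x \<le> 4 * ?g z" using h0 by simp
  then show ?thesis using rate_le_bern_fun[OF g x] by simp
qed

section \<open>Cesaro means, the range of g(A), and boundary spectrum near 0\<close>

context semigroup_generator
begin

lemma rep_cesaro:
  assumes t: "0 < t" shows "rep (\<lambda>f. of_real (1 / t) * ifun t f) (cesaro T t)"
  unfolding rep_def
proof (intro allI impI)
  fix \<phi> :: "'a \<Rightarrow> real" and x assume \<phi>: "bounded_linear \<phi>"
  have "(\<lambda>s. T s x) integrable_on {0..t}"
    by (intro integrable_continuous_real continuous_on_subset[OF T_continuous]) auto
  from integral_linear[OF this bounded_linear_cfun[OF \<phi>]]
  show "cfun \<phi> (cesaro T t x) = of_real (1 / t) * ifun t (\<lambda>s. cfun \<phi> (T s x))"
    by (simp only: cesaro_def cfun_scaleR[OF \<phi>] ifun_def comp_def)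
qed

text \<open>Y u is g(A) applied to c(A) u: for any regulariser e, e (gc) = (eg) c as transforms, so
  e(A) Y u = (eg)(A) c(A) u. Nothing about the chosen e enters except its defining identity.\<close>

lemma range_bern:
  assumes t: "bernstein_triple a b \<mu>" and Y: "rep (bern_functional a b \<mu>) Y"
  shows "Y u \<in> fc_range sc T (bern_fun a b \<mu>)"
proof -
  let ?R = "SOME R. regulariser sc T (bern_fun a b \<mu>) R"
  have ex: "\<exists>R. regulariser sc T (bern_fun a b \<mu>) R" by (rule regulariser_exists[OF t])
  obtain \<rho>1 h1 \<rho>2 h2 where R: "?R = (\<rho>1, h1, \<rho>2, h2)" by (metis prod_cases4)
  have "regulariser sc T (bern_fun a b \<mu>) ?R" by (rule someI_ex[OF ex])
  then have b: "bcm \<rho>1 h1" "bcm \<rho>2 h2"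
    and l: "\<And>z. 0 < Re z \<Longrightarrow> laplace_bcm \<rho>1 h1 z * bern_fun a b \<mu> z = laplace_bcm \<rho>2 h2 z"
    unfolding R by (auto simp: regulariser_def)
  note U = measure_functional_ifun[of 1] and B = measure_functional_bern[OF t]
    and L1 = measure_functional_bcm[OF b(1)] and L2 = measure_functional_bcm[OF b(2)]
  obtain X where X: "rep (ifun 1) X" by (rule rep_exists[OF U])
  have "(\<lambda>u. hp_op sc T \<rho>1 h1 (Y u)) = (\<lambda>u. hp_op sc T \<rho>2 h2 (X u))"
  proof (rule rep_unique[OF rep_conv[OF L1 B rep_hp_op[OF b(1)] Y] rep_conv[OF L2 U rep_hp_op[OF b(2)] X]])
    fix f assume "f \<in> BC"
    then show "conv (bcm_fun \<rho>1 h1) (bern_functional a b \<mu>) f = conv (bcm_fun \<rho>2 h2) (ifun 1) f"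
    proof (rule measure_functional_eqI[OF measure_functional_conv[OF L1 B] measure_functional_conv[OF L2 U], rotated])
      fix x :: real assume x: "0 < x"
      have "bcm_fun \<rho>2 h2 (cexp (of_real x)) = bcm_fun \<rho>1 h1 (cexp (of_real x)) * bern_fun a b \<mu> (of_real x)"
        using l[of "of_real x"] x by (simp add: laplace_bcm_eq[OF b(1)] laplace_bcm_eq[OF b(2)] bcm_fun_def)
      then show "conv (bcm_fun \<rho>1 h1) (bern_functional a b \<mu>) (cexp (of_real x)) = conv (bcm_fun \<rho>2 h2) (ifun 1) (cexp (of_real x))"
        using x by (simp add: conv_cexp[OF L1 B] conv_cexp[OF L2 U] bern_functional_cexp[OF t])
    qed
  qed
  then have "\<exists>x. hp_op sc T \<rho>1 h1 (Y u) = hp_op sc T \<rho>2 h2 x" by metis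
  then show ?thesis using ex by (simp add: fc_range_def R)
qed

lemma frontier_spectrum_near_0:
  assumes lp: "0 islimpt op_spectrum sc D A" and \<eta>: "0 < \<eta>"
  obtains z where "z \<in> frontier (op_spectrum sc D A)" "0 \<le> Re z" "z \<noteq> 0" "cmod z < \<eta>"
proof -
  obtain w where w: "w \<in> op_spectrum sc D A" "w \<noteq> 0" "dist w 0 < \<eta>"
    using lp \<eta> by (auto simp: islimpt_approachable)
  let ?S = "sphere (0::complex) (cmod w)"
  have "of_real (- cmod w) \<notin> op_spectrum sc D A"
    using in_resolvent_left_half_plane[of "of_real (- cmod w)"] w(2) by (simp add: op_spectrum_def)
  moreover have "of_real (- cmod w) \<in> ?S" by simp
  moreover have "w \<in> ?S" by simp
  moreover have "connected ?S" by (rule connected_sphere) simp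
  \<comment> \<open>The circle through w joins a spectral point to -|w| in the resolvent set, so it
    crosses the frontier at the same distance from 0.\<close>
  ultimately have "?S \<inter> frontier (op_spectrum sc D A) \<noteq> {}"
    using w(1) by (intro connected_Int_frontier) blast+
  then obtain z where z: "cmod z = cmod w" "z \<in> frontier (op_spectrum sc D A)" by auto
  then have "z \<in> op_spectrum sc D A" using closed_spectrum frontier_subset_closed by blast
  then have "0 \<le> Re z" using in_resolvent_left_half_plane[of z] by (force simp: op_spectrum_def)
  moreover have "z \<noteq> 0" using z(1) w(2) by (metis norm_eq_zero)
  moreover have "cmod z < \<eta>" using z(1) w(3) by simp
  ultimately show ?thesis using that z(2) by blast
qed

end

lemma SUP_ereal_finite_bound:
  fixes f :: "real \<Rightarrow> real"
  assumes "(SUP t\<in>S. ereal (f t)) \<noteq> \<infinity>" shows "\<exists>K. \<forall>t\<in>S. f t \<le> K"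
proof (cases "SUP t\<in>S. ereal (f t)")
  case (real k)
  then have "ereal (f t) \<le> ereal k" if "t \<in> S" for t using SUP_upper[OF that, of "\<lambda>t. ereal (f t)"] by simp
  then show ?thesis by auto
next
  case MInf
  then have "ereal (f t) \<le> - \<infinity>" if "t \<in> S" for t using SUP_upper[OF that, of "\<lambda>t. ereal (f t)"] by simp
  then show ?thesis by auto
qed (use assms in simp)

theorem theorem4p5:
  fixes sc :: "complex \<Rightarrow> 'a::banach \<Rightarrow> 'a"
    and T :: "real \<Rightarrow> 'a \<Rightarrow> 'a"
    and D :: "'a set" and A :: "'a \<Rightarrow> 'a"
    and a b :: real and \<mu> :: "real measure"
    and \<epsilon> :: "real \<Rightarrow> real"
  assumes "complex_scaling sc"
    and "special_bernstein a b \<mu>"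
    and "filterlim (\<lambda>t. t * rate_fun a b \<mu> t) at_top at_top"
    and "c0_semigroup sc T" and "bounded_semigroup T"
    and "is_neg_generator T D A"
    and "0 islimpt op_spectrum sc D A"
    and "\<forall>t>0. 0 < \<epsilon> t"
    and "\<forall>s t. 0 < s \<longrightarrow> s \<le> t \<longrightarrow> \<epsilon> t \<le> \<epsilon> s"
    and "(\<epsilon> \<longlongrightarrow> 0) at_top"
  shows "\<exists>y \<in> fc_range sc T (bern_fun a b \<mu>).
           (SUP t\<in>{1..}. ereal (norm (cesaro T t y) / (\<epsilon> t * rate_fun a b \<mu> t))) = \<infinity>"
proof (rule ccontr)
  assume neg: "\<not> ?thesis"
  interpret semigroup_generator sc T D A
    by unfold_locales (fact assms)+
  let ?r = "rate_fun a b \<mu>"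
  have g: "bernstein_triple a b \<mu>" using assms(2) by (simp add: special_bernstein_def)
  \<comment> \<open>Divergence of s r(s) makes r positive at some s beyond t, and r is decreasing.
    This permits division by r below.\<close>
  have pos: "0 < ?r t" if t: "0 < t" for t
  proof -
    have "\<forall>\<^sub>F s in at_top. 0 < s * ?r s \<and> t \<le> s"
      using filterlim_at_top_dense[THEN iffD1, OF assms(3), rule_format, of 0] eventually_ge_at_top[of t]
      by eventually_elim simp
    then obtain s where s: "0 < s * ?r s" "t \<le> s" using eventually_happens by fastforce
    then have "0 < ?r s" using t by (simp add: zero_less_mult_iff)
    then show ?thesis using rate_antimono[OF g t s(2)] by linarith
  qed
  note B = measure_functional_bern[OF g]
  obtain Y where Y: "rep (bern_functional a b \<mu>) Y" by (rule rep_exists[OF B])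
  define C where "C t f = of_real (1 / t) * ifun t f" for t f
  have Cm: "measure_functional (C t)" for t
    unfolding C_def[abs_def] by (intro measure_functional_cmult measure_functional_ifun)
  define V where "V t u = cesaro T t (Y u)" for t u
  have V: "rep (conv (C t) (bern_functional a b \<mu>)) (V t)" if "0 < t" for t
    unfolding V_def[abs_def] by (rule rep_conv[OF Cm B _ Y]) (use rep_cesaro[OF that] in \<open>simp add: C_def[abs_def]\<close>)
  have Vm: "measure_functional (conv (C t) (bern_functional a b \<mu>))" for t
    by (rule measure_functional_conv[OF Cm B])
  define \<kappa> where "\<kappa> t = \<epsilon> t * ?r t" for t
  have \<kappa>: "0 < \<kappa> t" if "1 \<le> t" for t using pos[of t] assms(8) that by (simp add: \<kappa>_def)
  \<comment> \<open>Every Y u lies in the range of g(A), so the negated claim bounds the normalised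
    family pointwise in u.\<close>
  have "\<exists>K. \<forall>t\<in>{1..}. \<forall>u. norm ((1 / \<kappa> t) *\<^sub>R V t u) \<le> K * norm u"
  proof (rule uniform_boundedness)
    show "bounded_linear (\<lambda>u. (1 / \<kappa> t) *\<^sub>R V t u)" if "t \<in> {1..}" for t
      using rep_bounded_linear[OF Vm V] that by (intro bounded_linear_scaleR_const bounded_linear_const_scaleR) auto
    show "\<exists>K. \<forall>t\<in>{1..}. norm ((1 / \<kappa> t) *\<^sub>R V t u) \<le> K" for u
    proof -
      have "(SUP t\<in>{1..}. ereal (norm (cesaro T t (Y u)) / (\<epsilon> t * ?r t))) \<noteq> \<infinity>"
        using neg range_bern[OF g Y, of u] by blast
      from SUP_ereal_finite_bound[OF this] obtain K where "\<forall>t\<in>{1..}. norm (V t u) / \<kappa> t \<le> K"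
        unfolding V_def \<kappa>_def by blast
      then show ?thesis using \<kappa> by (intro exI[of _ K]) (simp add: less_imp_le)
    qed
  qed
  then obtain K where K: "\<And>t u. 1 \<le> t \<Longrightarrow> norm ((1 / \<kappa> t) *\<^sub>R V t u) \<le> K * norm u" by auto
  have KV: "norm (V t u) \<le> (K * \<kappa> t) * norm u" if "1 \<le> t" for t u
    using K[OF that, of u] \<kappa>[OF that] by (simp add: field_simps)
  have "((\<lambda>t. K * \<epsilon> t) \<longlongrightarrow> K * 0) at_top" by (intro tendsto_intros assms)
  \<comment> \<open>256 = 2 * 128: spectral inclusion contributes 2, and 128 = 2 * 32 * 2 collects
    |c(tz)| \<ge> 1/2, |g(z)| \<ge> r(t)/32 with 32 = 4 * 8, and |c(z)| \<ge> 1/2.\<close>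
  then have "\<forall>\<^sub>F t in at_top. K * \<epsilon> t < 1/256" by (rule order_tendstoD) simp
  then obtain t0 where t0: "\<And>t. t0 \<le> t \<Longrightarrow> K * \<epsilon> t < 1/256" by (auto simp: eventually_at_top_linorder)
  define t1 where "t1 = max 1 t0"
  obtain z where z: "z \<in> frontier (op_spectrum sc D A)" "0 \<le> Re z" "z \<noteq> 0" "cmod z < 1 / (4 * t1)"
    by (rule frontier_spectrum_near_0[OF assms(7), of "1 / (4 * t1)"]) (auto simp: t1_def)
  \<comment> \<open>The largest t with |tz| \<le> 1/4, so that c(tz) is still bounded below; the
    choice of z ensures t \<ge> 1 and t \<ge> t0.\<close>
  define t where "t = 1 / (4 * cmod z)"
  have "0 < t1" by (simp add: t1_def)
  then have t: "t1 \<le> t" "0 < t" using z(3,4) by (auto simp: t_def field_simps)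
  have t1: "1 \<le> t" "t0 \<le> t" using t by (auto simp: t1_def)
  have tz: "t * cmod z = 1/4" using z(3) by (simp add: t_def)
  have "cmod z \<le> 1/4"
  proof -
    have "1 * cmod z \<le> t * cmod z" using t1 by (intro mult_right_mono) auto
    then show ?thesis using tz by simp
  qed
  note z4 = z(2,3) this
  have a1: "1/2 \<le> cmod (ifun 1 (cexp z))"
    using norm_one_minus_exp_ge[OF z4(3)] z(3) by (simp add: ifun_cexp cexp_def norm_divide field_simps)
  \<comment> \<open>The transform of the Cesaro mean at z is (1 - e^(-tz))/(tz) = c(tz).\<close>
  have a2: "1/2 \<le> cmod (C t (cexp z))"
  proof -
    have "cmod (of_real t * z) / 2 \<le> cmod (1 - cexp z t)"
      using norm_one_minus_exp_ge[of "of_real t * z"] tz t(2) by (simp add: cexp_def norm_mult)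
    then show ?thesis using z(3) t(2) by (simp add: C_def ifun_cexp norm_mult norm_divide field_simps)
  qed
  have "?r t \<le> 4 * ?r (4 * t)" by (rule rate_scale[OF g t(2)])
  also have "4 * t = 1 / cmod z" by (simp add: t_def)
  also have "?r (1 / cmod z) \<le> 8 * cmod (bern_fun a b \<mu> z)" by (rule special_bern_fun_ge[OF assms(2) pos z4])
  finally have a3: "?r t / 32 \<le> cmod (bern_fun a b \<mu> z)" by simp
  have "?r t / 128 = 1/2 * (?r t / 32 * (1/2))" by simp
  also have "\<dots> \<le> cmod (C t (cexp z)) * (cmod (bern_fun a b \<mu> z) * cmod (ifun 1 (cexp z)))"
    using pos[OF t(2)] by (intro mult_mono a1 a2 a3) auto
  also have "\<dots> = cmod (conv (C t) (bern_functional a b \<mu>) (cexp z))"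
    by (simp add: conv_cexp[OF Cm B z(2)] bern_functional_cexp[OF g z(2,3)] norm_mult)
  also have "\<dots> \<le> 2 * (K * \<kappa> t)"
    by (rule laplace_le_norm_rep[OF Vm V[OF t(2)] KV[OF t1(1)] z(1,2)])
  also have "\<dots> = 2 * (K * \<epsilon> t) * ?r t" by (simp add: \<kappa>_def)
  also have "\<dots> < 2 * (1/256) * ?r t"
    using t0[OF t1(2)] pos[OF t(2)] by (intro mult_strict_right_mono) auto
  finally show False by simp
qed

end
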